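(* Let $M$ be a simply connected, compact subset, with piecewise smooth boundary $\partial M$ all of whose angles are nonzero, of a compact, closed 2-dimensional smooth manifold $\mathbf{M}$ with Riemannian metric $g$. Let $f$ be a Morse-eigenfunction on $M$ with the extension property, satisfying Dirichlet boundary conditions on $\partial M$. If $N(f)\neq\emptyset$ then $\overline{M}$ is the disjoint union $$\overline{M}=\Big\{\bigsqcup_{p\in\mathscr{M}_-(f),\,q\in\mathscr{M}_+(f)}\Omega_{p,q}(f)\Big\}\sqcup\Big\{\bigsqcup_{p\in\mathscr{M}_-(f)}\Omega_{p,\circ}(f)\Big\}\sqcup\Big\{\bigsqcup_{q\in\mathscr{M}_+(f)}\Omega_{\circ,q}(f)\Big\}\sqcup N(f).$$
   Context: $\overline{M}$ is the closure of $M$ (equal to $M$). A Morse-eigenfunction is a real solution of $-\Delta_g f=\lambda f$ that is a Morse function on $\overline{M}$ (no degenerate critical points); Dirichlet condition: $f=0$ on $\partial M$. $f$ has the extension property if there are an open $\widehat M$ with $\overline M\subset\widehat M\subset\mathbf M$ and a Morse function $\widehat f:\widehat M\to\mathbb R$ with $\widehat f|_{\overline M}=f$; then $f$ also extends to a Morse function $\tilde f:\mathbf M\to\mathbb R$. $\mathscr C(f)$ and $\mathscr S(f)$ are the sets of critical points and saddle points of $f$ in $\overline M$, including those on $\partial M$; $\mathscr M_-(f)$, $\mathscr M_+(f)$ are the sets of (local) minima and maxima of $f$ (none lies on $\partial M$). Flow: let $\tilde\varphi$ be the flow on $\mathbf M$ of $-\nabla\tilde f$. Define $\varphi:\mathbb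 R\times\overline M\to\overline M$ as follows: for $t\ge 0$, $\varphi(t,x)=\tilde\varphi(t,x)$ if $\tilde\varphi([0,t],x)\subset\overline M$, and otherwise $\varphi(t,x)=\tilde\varphi(t_0,x)$ with $t_0\in[0,t]$ minimal such that $\tilde\varphi(t_0,x)\in\partial M$; for $t<0$, $\varphi(t,x)=\tilde\varphi(t,x)$ if $\tilde\varphi([t,0],x)\subset\overline M$, and otherwise $\varphi(t,x)=\tilde\varphi(t_0,x)$ with $t_0\in[t,0]$ maximal such that $\tilde\varphi(t_0,x)\in\partial M$. (The flow does not depend on the choice of $\tilde f$.) For $x\in\mathscr C(f)\cup\partial M$ put $W^s(x)=\{y\in\overline M:\lim_{t\to\infty}\varphi(t,y)=x\}$, $W^u(x)=\{y\in\overline M:\lim_{t\to-\infty}\varphi(t,y)=x\}$. For $p\in\mathscr M_-(f)$, $q\in\mathscr M_+(f)$: $\Omega_{p,q}(f)=W^s(p)\cap W^u(q)$, $\Omega_{p,\circ}(f)=W^s(p)\cap\big(\bigcup_{y\in\partial M\setminus\mathscr S(f)}W^u(y)\big)$, $\Omega_{\circ,q}(f)=\big(\bigcup_{y\in\partial M\setminus\mathscr S(f)}W^s(y)\big)\cap W^u(q)$. The Neumann line set is $N(f)=\overline{\bigcup_{r\in\mathscr S(f)}W^s(r)\cup W^u(r)}$. *)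

theory Defs
  imports "HOL-Analysis.Analysis"
begin

section \<open>Smoothness between Euclidean spaces\<close>

primrec Ck_on :: "nat \<Rightarrow> 'a::euclidean_space set \<Rightarrow> ('a \<Rightarrow> 'b::real_normed_vector) \<Rightarrow> bool" where
  "Ck_on 0 S h \<longleftrightarrow> continuous_on S h"
| "Ck_on (Suc k) S h \<longleftrightarrow>
     (\<forall>u\<in>S. h differentiable (at u)) \<and>
     (\<forall>b\<in>Basis. Ck_on k S (\<lambda>u. frechet_derivative h (at u) b))"

text \<open>Used for open \<open>S\<close> only: the derivatives are two-sided.\<close>

definition smooth_on :: "'a::euclidean_space set \<Rightarrow> ('a \<Rightarrow> 'b::real_normed_vector) \<Rightarrow> bool" where
  "smooth_on S h \<longleftrightarrow> (\<forall>k. Ck_on k S h)"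

definition partial_deriv :: "2 \<Rightarrow> (real^2 \<Rightarrow> real) \<Rightarrow> real^2 \<Rightarrow> real" where
  "partial_deriv i h u = frechet_derivative h (at u) (axis i 1)"


section \<open>Closed Riemannian surfaces\<close>

text \<open>A chart \<open>(D, \<phi>)\<close> maps its open domain \<open>D\<close> homeomorphically onto an open subset of the plane;
  \<open>\<phi>\<close> is irrelevant outside \<open>D\<close>. The manifold is the whole type, with a (not necessarily
  maximal) atlas.\<close>

type_synonym 'm chart = "'m set \<times> ('m \<Rightarrow> real^2)"

abbreviation chart_inv :: "'m chart \<Rightarrow> real^2 \<Rightarrow> 'm" where
  "chart_inv c \<equiv> inv_into (fst c) (snd c)"

definition smooth_atlas :: "'m::topological_space chart set \<Rightarrow> bool" where
  "smooth_atlas A \<longleftrightarrow>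
     (\<forall>c\<in>A. open (fst c) \<and> open (snd c ` fst c) \<and>
        homeomorphism (fst c) (snd c ` fst c) (snd c) (chart_inv c)) \<and>
     (\<Union>c\<in>A. fst c) = UNIV \<and>
     (\<forall>c\<in>A. \<forall>c'\<in>A. smooth_on (snd c ` (fst c \<inter> fst c')) (snd c' \<circ> chart_inv c))"

text \<open>A compact Hausdorff space with such an atlas is automatically second countable.\<close>

definition closed_smooth_surface :: "'m::t2_space chart set \<Rightarrow> bool" where
  "closed_smooth_surface A \<longleftrightarrow> compact (UNIV :: 'm set) \<and> smooth_atlas A"

text \<open>A metric is given by its Gram matrices \<open>g c x\<close> with respect to the coordinate basis of the
  chart \<open>c\<close> at the point \<open>x\<close>, subject to the transformation law of a covariant 2-tensor.\<close>

definition riemannian_metric ::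
    "'m::topological_space chart set \<Rightarrow> ('m chart \<Rightarrow> 'm \<Rightarrow> real^2^2) \<Rightarrow> bool" where
  "riemannian_metric A g \<longleftrightarrow>
     (\<forall>c\<in>A. smooth_on (snd c ` fst c) (\<lambda>u. g c (chart_inv c u)) \<and>
        (\<forall>x\<in>fst c. transpose (g c x) = g c x \<and> (\<forall>v. v \<noteq> 0 \<longrightarrow> v \<bullet> (g c x *v v) > 0))) \<and>
     (\<forall>c\<in>A. \<forall>c'\<in>A. \<forall>x\<in>fst c \<inter> fst c'.
        let J = matrix (frechet_derivative (snd c' \<circ> chart_inv c) (at (snd c x)))
        in g c x = transpose J ** g c' x ** J)"


section \<open>Functions on a surface\<close>

definition smooth_function :: "'m::topological_space chart set \<Rightarrow> 'm set \<Rightarrow> ('m \<Rightarrow> real) \<Rightarrow> bool" where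
  "smooth_function A S F \<longleftrightarrow> (\<forall>c\<in>A. smooth_on (snd c ` (fst c \<inter> S)) (F \<circ> chart_inv c))"

definition critical_point :: "'m chart set \<Rightarrow> ('m \<Rightarrow> real) \<Rightarrow> 'm \<Rightarrow> bool" where
  "critical_point A F x \<longleftrightarrow>
     (\<forall>c\<in>A. x \<in> fst c \<longrightarrow> (\<forall>i. partial_deriv i (F \<circ> chart_inv c) (snd c x) = 0))"

definition hessian :: "'m chart \<Rightarrow> ('m \<Rightarrow> real) \<Rightarrow> 'm \<Rightarrow> real^2^2" where
  "hessian c F x = (\<chi> i j. partial_deriv i (partial_deriv j (F \<circ> chart_inv c)) (snd c x))"

definition nondegenerate_at :: "'m chart set \<Rightarrow> ('m \<Rightarrow> real) \<Rightarrow> 'm \<Rightarrow> bool" where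
  "nondegenerate_at A F x \<longleftrightarrow> (\<forall>c\<in>A. x \<in> fst c \<longrightarrow> det (hessian c F x) \<noteq> 0)"

text \<open>For arbitrary \<open>S\<close>, a function is smooth on \<open>S\<close> if it is the restriction of a smooth function
  on an open neighbourhood. If \<open>S\<close> is contained in the closure of its interior (in particular, if
  \<open>S\<close> is open), then the derivatives of \<open>G\<close> at the points of \<open>S\<close> are determined by \<open>f\<close>.\<close>

definition morse_on :: "'m::topological_space chart set \<Rightarrow> 'm set \<Rightarrow> ('m \<Rightarrow> real) \<Rightarrow> bool" where
  "morse_on A S f \<longleftrightarrow>
     (\<exists>V G. open V \<and> S \<subseteq> V \<and> smooth_function A V G \<and> (\<forall>x\<in>S. G x = f x) \<and>
        (\<forall>x\<in>S. critical_point A G x \<longrightarrow> nondegenerate_at A G x))"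

definition gradient ::
    "('m chart \<Rightarrow> 'm \<Rightarrow> real^2^2) \<Rightarrow> 'm chart \<Rightarrow> ('m \<Rightarrow> real) \<Rightarrow> 'm \<Rightarrow> real^2" where
  "gradient g c F x =
     matrix_inv (g c x) *v (\<chi> i. partial_deriv i (F \<circ> chart_inv c) (snd c x))"

text \<open>\<open>\<Delta>\<^sub>g F = (det g)\<^sup>-\<^sup>1\<^sup>/\<^sup>2 \<Sum>\<^sub>i \<partial>\<^sub>i ((det g)\<^sup>1\<^sup>/\<^sup>2 (grad F)\<^sub>i)\<close>\<close>

definition laplace_beltrami ::
    "('m chart \<Rightarrow> 'm \<Rightarrow> real^2^2) \<Rightarrow> 'm chart \<Rightarrow> ('m \<Rightarrow> real) \<Rightarrow> 'm \<Rightarrow> real" where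
  "laplace_beltrami g c F x =
     (\<Sum>i\<in>UNIV. partial_deriv i
        (\<lambda>u. sqrt (det (g c (chart_inv c u))) * gradient g c F (chart_inv c u) $ i) (snd c x))
     / sqrt (det (g c x))"

definition morse_eigenfunction ::
    "'m::topological_space chart set \<Rightarrow> ('m chart \<Rightarrow> 'm \<Rightarrow> real^2^2) \<Rightarrow> 'm set \<Rightarrow> ('m \<Rightarrow> real) \<Rightarrow> bool" where
  "morse_eigenfunction A g M f \<longleftrightarrow>
     (\<exists>l::real. \<forall>c\<in>A. \<forall>x\<in>fst c \<inter> interior M. - laplace_beltrami g c f x = l * f x) \<and>
     morse_on A M f"

definition morse_extension ::
    "'m::topological_space chart set \<Rightarrow> 'm set \<Rightarrow> ('m \<Rightarrow> real) \<Rightarrow> 'm set \<Rightarrow> ('m \<Rightarrow> real) \<Rightarrow> bool" where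
  "morse_extension A M f U F \<longleftrightarrow>
     open U \<and> M \<subseteq> U \<and> morse_on A U F \<and> (\<forall>x\<in>M. F x = f x)"

definition extension_property ::
    "'m::topological_space chart set \<Rightarrow> 'm set \<Rightarrow> ('m \<Rightarrow> real) \<Rightarrow> bool" where
  "extension_property A M f \<longleftrightarrow> (\<exists>U F. morse_extension A M f U F)"


section \<open>Piecewise smooth boundary and its angles\<close>

definition regular_smooth_curve ::
    "'m::topological_space chart set \<Rightarrow> real set \<Rightarrow> (real \<Rightarrow> 'm) \<Rightarrow> bool" where
  "regular_smooth_curve A J \<delta> \<longleftrightarrow>
     continuous_on J \<delta> \<and>
     (\<forall>c\<in>A. smooth_on {s\<in>J. \<delta> s \<in> fst c} (snd c \<circ> \<delta>) \<and>
        (\<forall>s\<in>J. \<delta> s \<in> fst c \<longrightarrow> vector_derivative (snd c \<circ> \<delta>) (at s) \<noteq> 0))"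

text \<open>\<open>T\<close> is the set of break points; each piece is smooth and regular up to its end points, i.e.\ it
  extends to a regular smooth curve on an open set of parameters.\<close>

definition piecewise_smooth_loop ::
    "'m::topological_space chart set \<Rightarrow> (real \<Rightarrow> 'm) \<Rightarrow> bool" where
  "piecewise_smooth_loop A \<gamma> \<longleftrightarrow>
     simple_path \<gamma> \<and> pathfinish \<gamma> = pathstart \<gamma> \<and>
     (\<exists>T. finite T \<and> {0, 1} \<subseteq> T \<and> T \<subseteq> {0..1} \<and>
        (\<forall>a\<in>T. \<forall>b\<in>T. a < b \<and> {a<..<b} \<inter> T = {} \<longrightarrow>
           (\<exists>J \<delta>. open J \<and> {a..b} \<subseteq> J \<and> regular_smooth_curve A J \<delta> \<and> (\<forall>s\<in>{a..b}. \<delta> s = \<gamma> s))))"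

text \<open>The empty boundary is allowed, so \<open>M\<close> may be a whole component of the surface.\<close>

definition piecewise_smooth_boundary :: "'m::topological_space chart set \<Rightarrow> 'm set \<Rightarrow> bool" where
  "piecewise_smooth_boundary A M \<longleftrightarrow>
     M = closure (interior M) \<and>
     (\<exists>\<Gamma>. finite \<Gamma> \<and> (\<forall>\<gamma>\<in>\<Gamma>. piecewise_smooth_loop A \<gamma>) \<and>
        disjoint_family_on path_image \<Gamma> \<and> frontier M = (\<Union>\<gamma>\<in>\<Gamma>. path_image \<gamma>))"

definition orthonormal_frame :: "real^2^2 \<Rightarrow> (real^2) \<times> (real^2) \<Rightarrow> bool" where
  "orthonormal_frame G = (\<lambda>(e1, e2). e1 \<bullet> (G *v e1) = 1 \<and> e2 \<bullet> (G *v e2) = 1 \<and> e1 \<bullet> (G *v e2) = 0)"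

text \<open>The interior angle of \<open>M\<close> at a boundary point \<open>y\<close> is the length of the arc formed by the
  \<open>g\<close>-unit tangent vectors at \<open>y\<close> that point into \<open>M\<close>. It distinguishes the angle \<open>0\<close> from \<open>2\<pi>\<close> and
  does not depend on the choice of the orthonormal frame; at smooth boundary points it is \<open>\<pi>\<close>.
  The (at most two) directions tangent to the boundary do not contribute.\<close>

definition interior_angle ::
    "('m chart \<Rightarrow> 'm \<Rightarrow> real^2^2) \<Rightarrow> 'm set \<Rightarrow> 'm chart \<Rightarrow> 'm \<Rightarrow> real" where
  "interior_angle g M c y =
     (let (e1, e2) = (SOME e. orthonormal_frame (g c y) e)
      in measure lebesgue {\<theta>\<in>{0..<2*pi}. \<exists>\<epsilon>>0. \<forall>t\<in>{0<..<\<epsilon>}.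
           snd c y + t *\<^sub>R (cos \<theta> *\<^sub>R e1 + sin \<theta> *\<^sub>R e2) \<in> snd c ` (fst c \<inter> M)})"

definition nonzero_angles ::
    "'m::topological_space chart set \<Rightarrow> ('m chart \<Rightarrow> 'm \<Rightarrow> real^2^2) \<Rightarrow> 'm set \<Rightarrow> bool" where
  "nonzero_angles A g M \<longleftrightarrow>
     (\<forall>y\<in>frontier M. \<forall>c\<in>A. y \<in> fst c \<longrightarrow> interior_angle g M c y \<noteq> 0)"


section \<open>The gradient flow stopped at the boundary\<close>

text \<open>In this and the following section \<open>F\<close> is a Morse extension of \<open>f\<close> to the open set \<open>U \<supseteq> M\<close>.
  \<open>U = UNIV\<close> is the case of an extension to the whole surface, for which the flow is complete; for
  smaller \<open>U\<close> the flow of \<open>-\<nabla>F\<close> on \<open>U\<close> is only partially defined.\<close>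

definition neg_gradient_curve ::
    "'m::topological_space chart set \<Rightarrow> ('m chart \<Rightarrow> 'm \<Rightarrow> real^2^2) \<Rightarrow> 'm set \<Rightarrow> ('m \<Rightarrow> real)
     \<Rightarrow> real set \<Rightarrow> (real \<Rightarrow> 'm) \<Rightarrow> bool" where
  "neg_gradient_curve A g U F I \<gamma> \<longleftrightarrow>
     continuous_on I \<gamma> \<and> \<gamma> ` I \<subseteq> U \<and>
     (\<forall>s\<in>I. \<forall>c\<in>A. \<gamma> s \<in> fst c \<longrightarrow>
        ((snd c \<circ> \<gamma>) has_vector_derivative - gradient g c F (\<gamma> s)) (at s within I))"

definition flow_defined ::
    "'m::topological_space chart set \<Rightarrow> ('m chart \<Rightarrow> 'm \<Rightarrow> real^2^2) \<Rightarrow> 'm set \<Rightarrow> ('m \<Rightarrow> real)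
     \<Rightarrow> real \<Rightarrow> 'm \<Rightarrow> bool" where
  "flow_defined A g U F t x \<longleftrightarrow>
     (\<exists>\<gamma>. neg_gradient_curve A g U F (closed_segment 0 t) \<gamma> \<and> \<gamma> 0 = x)"

definition flow ::
    "'m::topological_space chart set \<Rightarrow> ('m chart \<Rightarrow> 'm \<Rightarrow> real^2^2) \<Rightarrow> 'm set \<Rightarrow> ('m \<Rightarrow> real)
     \<Rightarrow> real \<Rightarrow> 'm \<Rightarrow> 'm" where
  "flow A g U F t x =
     (THE y. \<exists>\<gamma>. neg_gradient_curve A g U F (closed_segment 0 t) \<gamma> \<and> \<gamma> 0 = x \<and> \<gamma> t = y)"

definition flow_in ::
    "'m::topological_space chart set \<Rightarrow> ('m chart \<Rightarrow> 'm \<Rightarrow> real^2^2) \<Rightarrow> 'm set \<Rightarrow> ('m \<Rightarrow> real)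
     \<Rightarrow> 'm set \<Rightarrow> real \<Rightarrow> 'm \<Rightarrow> bool" where
  "flow_in A g U F S t x \<longleftrightarrow> flow_defined A g U F t x \<and> flow A g U F t x \<in> S"

definition stopped_flow ::
    "'m::topological_space chart set \<Rightarrow> ('m chart \<Rightarrow> 'm \<Rightarrow> real^2^2) \<Rightarrow> 'm set \<Rightarrow> 'm set \<Rightarrow> ('m \<Rightarrow> real)
     \<Rightarrow> real \<Rightarrow> 'm \<Rightarrow> 'm" where
  "stopped_flow A g M U F t x =
     (if t \<ge> 0
      then if \<forall>s\<in>{0..t}. flow_in A g U F M s x then flow A g U F t x
           else flow A g U F (LEAST s. s \<in> {0..t} \<and> flow_in A g U F (frontier M) s x) x
      else if \<forall>s\<in>{t..0}. flow_in A g U F M s x then flow A g U F t x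
           else flow A g U F (GREATEST s. s \<in> {t..0} \<and> flow_in A g U F (frontier M) s x) x)"

definition stable_set ::
    "'m::topological_space chart set \<Rightarrow> ('m chart \<Rightarrow> 'm \<Rightarrow> real^2^2) \<Rightarrow> 'm set \<Rightarrow> 'm set \<Rightarrow> ('m \<Rightarrow> real)
     \<Rightarrow> 'm \<Rightarrow> 'm set" where
  "stable_set A g M U F x = {y\<in>M. ((\<lambda>t. stopped_flow A g M U F t y) \<longlongrightarrow> x) at_top}"

definition unstable_set ::
    "'m::topological_space chart set \<Rightarrow> ('m chart \<Rightarrow> 'm \<Rightarrow> real^2^2) \<Rightarrow> 'm set \<Rightarrow> 'm set \<Rightarrow> ('m \<Rightarrow> real)
     \<Rightarrow> 'm \<Rightarrow> 'm set" where
  "unstable_set A g M U F x = {y\<in>M. ((\<lambda>t. stopped_flow A g M U F t y) \<longlongrightarrow> x) at_bot}"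


section \<open>The partition\<close>

text \<open>Extrema and saddle points in \<open>M\<close> are classified by \<open>F\<close>, so that on the boundary of \<open>M\<close> the type
  of a critical point is that of its Hessian. (Relative to \<open>M\<close> alone, all boundary points of a
  domain with \<open>f > 0\<close> inside and \<open>f = 0\<close> on the boundary would be local minima.)\<close>

definition minima :: "'m::topological_space set \<Rightarrow> ('m \<Rightarrow> real) \<Rightarrow> 'm set" where
  "minima M F = {x\<in>M. eventually (\<lambda>y. F x \<le> F y) (nhds x)}"

definition maxima :: "'m::topological_space set \<Rightarrow> ('m \<Rightarrow> real) \<Rightarrow> 'm set" where
  "maxima M F = {x\<in>M. eventually (\<lambda>y. F y \<le> F x) (nhds x)}"

definition saddles ::
    "'m::topological_space chart set \<Rightarrow> 'm set \<Rightarrow> ('m \<Rightarrow> real) \<Rightarrow> 'm set" where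
  "saddles A M F = {x\<in>M. critical_point A F x} - minima M F - maxima M F"

definition Omega ::
    "'m::topological_space chart set \<Rightarrow> ('m chart \<Rightarrow> 'm \<Rightarrow> real^2^2) \<Rightarrow> 'm set \<Rightarrow> 'm set \<Rightarrow> ('m \<Rightarrow> real)
     \<Rightarrow> 'm \<Rightarrow> 'm \<Rightarrow> 'm set" where
  "Omega A g M U F p q = stable_set A g M U F p \<inter> unstable_set A g M U F q"

definition Omega_min ::
    "'m::topological_space chart set \<Rightarrow> ('m chart \<Rightarrow> 'm \<Rightarrow> real^2^2) \<Rightarrow> 'm set \<Rightarrow> 'm set \<Rightarrow> ('m \<Rightarrow> real)
     \<Rightarrow> 'm \<Rightarrow> 'm set" where
  "Omega_min A g M U F p =
     stable_set A g M U F p \<inter> (\<Union>y\<in>frontier M - saddles A M F. unstable_set A g M U F y)"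

definition Omega_max ::
    "'m::topological_space chart set \<Rightarrow> ('m chart \<Rightarrow> 'm \<Rightarrow> real^2^2) \<Rightarrow> 'm set \<Rightarrow> 'm set \<Rightarrow> ('m \<Rightarrow> real)
     \<Rightarrow> 'm \<Rightarrow> 'm set" where
  "Omega_max A g M U F q =
     (\<Union>y\<in>frontier M - saddles A M F. stable_set A g M U F y) \<inter> unstable_set A g M U F q"

definition neumann_line_set ::
    "'m::topological_space chart set \<Rightarrow> ('m chart \<Rightarrow> 'm \<Rightarrow> real^2^2) \<Rightarrow> 'm set \<Rightarrow> 'm set \<Rightarrow> ('m \<Rightarrow> real)
     \<Rightarrow> 'm set" where
  "neumann_line_set A g M U F =
     closure (\<Union>r\<in>saddles A M F. stable_set A g M U F r \<union> unstable_set A g M U F r)"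

end

theory Submission
  imports Defs
begin

text \<open>
  Along the flow of \<open>-\<nabla>F\<close> the function \<open>F\<close> decreases, so a trajectory of \<open>M\<close> either converges to a
  critical point or leaves \<open>M\<close> at a noncritical boundary point. Since \<open>F = 0\<close> on \<open>\<partial>M\<close>, a trajectory cannot
  both enter and leave through \<open>\<partial>M\<close>, and near a noncritical boundary point \<open>M\<close> is one of the sets \<open>{F \<ge> 0}\<close>,
  \<open>{F \<le> 0}\<close>. Therefore the basins of the extrema and the sets of exiting points are open in \<open>M\<close>, which
  keeps them away from the closure \<open>N(f)\<close> of the saddle trajectories.

  It remains to see that the extrema lie in \<open>N(f)\<close>. If a maximum \<open>q\<close> does not, then all trajectories that start
  near \<open>q\<close> leave \<open>M\<close> or end in minima; by compactness they do so uniformly, so that the closure of the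
  unstable set of \<open>q\<close> adds nothing but minima to it. This closure is open in \<open>M\<close>, because a punctured
  disc around a minimum is connected. As \<open>M\<close> is connected, it is the whole of \<open>M\<close>, and there is no saddle.

  The flow is handled as a relation \<open>R t x y\<close> (for \<open>t \<ge> 0\<close>, the solution from \<open>x\<close> exists up to time \<open>t\<close> and
  arrives at \<open>y\<close>); reversing time turns \<open>(R, F)\<close> into \<open>(R\<inverse>, -F)\<close>, so that every statement about
  stable sets and minima has a mirror image for unstable sets and maxima.
\<close>

section \<open>Abstract gradient-like flows\<close>

text \<open>The extrema need separate treatment because they are rest points: the trajectory of a
  maximum q tends to q in both time directions, so q belongs to none of the sets Omega. This is
  where a saddle must exist; for the height function on a sphere the two poles would be left over.
  The obstacle is the frontier of \<open>M\<close>, which has corners and may carry saddles. A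
  nonconstant trajectory meets it at most once, since \<open>F\<close> vanishes there and decreases
  strictly along the trajectory. The frontier has no isolated points, which keeps the extrema, being
  strict, in the interior. Nondegeneracy enters as isolation of the critical points: it turns
  accumulation points of trajectories into limits and makes extrema strict. On a proper subset
  \<open>U\<close> the flow is only partial, but compactness of \<open>M\<close> gives a uniform
  existence time, so no solution breaks down while it is in \<open>M\<close>.\<close>

text \<open>Connectedness of the interval, as an induction over real time. The step at
  \<open>s\<close> carries \<open>P\<close> from any \<open>a\<close> to any later \<open>b\<close>
  near \<open>s\<close>, on either side of \<open>s\<close>; thus the supremum of the good times is
  crossed from a slightly earlier good time.\<close>

lemma real_chain_induct:
  fixes t :: real
  assumes "0 \<le> t" "P 0"
    and step: "\<And>s. 0 \<le> s \<Longrightarrow> s \<le> t \<Longrightarrow>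
      \<exists>d>0. \<forall>a b. 0 \<le> a \<and> a \<le> b \<and> b \<le> t \<and> \<bar>a - s\<bar> < d \<and> \<bar>b - s\<bar> < d \<and> P a \<longrightarrow> P b"
  shows "P t"
proof -
  define S where "S = {s\<in>{0..t}. P s}"
  have S0: "0 \<in> S" and bdd: "bdd_above S" using assms by (auto simp: S_def)
  define s0 where "s0 = Sup S"
  have s0: "0 \<le> s0" "s0 \<le> t"
    using S0 bdd unfolding s0_def by (auto intro: cSup_upper cSup_least simp: S_def)
  then obtain d where d: "d > 0" "\<And>a b. 0 \<le> a \<Longrightarrow> a \<le> b \<Longrightarrow> b \<le> t \<Longrightarrow> \<bar>a - s0\<bar> < d
      \<Longrightarrow> \<bar>b - s0\<bar> < d \<Longrightarrow> P a \<Longrightarrow> P b" using step by meson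
  obtain a where a: "a \<in> S" "s0 - d < a"
    using less_cSup_iff[of S "s0 - d"] S0 bdd d(1) unfolding s0_def by auto
  have "a \<le> s0" using a bdd unfolding s0_def by (auto intro: cSup_upper)
  define b where "b = min (s0 + d/2) t"
  have "P b" using d(2)[of a b] a \<open>a \<le> s0\<close> s0 d(1) by (auto simp: S_def b_def min_def)
  then have "b \<in> S" using s0 d(1) by (auto simp: S_def b_def)
  then have "b \<le> s0" using bdd unfolding s0_def by (auto intro: cSup_upper)
  then have "b = t" using d(1) by (auto simp: b_def min_def split: if_splits)
  then show ?thesis using \<open>P b\<close> by simp
qed

text \<open>The axioms are closed under time reversal: one-sided statements about \<open>R\<close>
  come with their reverse, and the others are symmetric under replacing \<open>F\<close> by
  \<open>- F\<close>. Continuity is demanded for short times; longer times follow by composition.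
  \<open>frontier_perfect\<close> keeps strict extrema off the frontier, and the connected punctured
  neighbourhoods of \<open>nbhd_base\<close> express that the dimension is at least two.\<close>

locale gradient_semiflow =
  fixes U M :: "'m::t2_space set" and F :: "'m \<Rightarrow> real"
    and R :: "real \<Rightarrow> 'm \<Rightarrow> 'm \<Rightarrow> bool" and crit :: "'m set"
  assumes open_U: "open U" and M_sub: "M \<subseteq> U" and compact_M: "compact M"
    and connected_M: "connected M"
    and R_dom: "R t x y \<Longrightarrow> 0 \<le> t \<and> x \<in> U \<and> y \<in> U"
    and R_0: "x \<in> U \<Longrightarrow> R 0 x x"
    and R_det: "R t x y \<Longrightarrow> R t x z \<Longrightarrow> y = z"
    and R_inj: "R t x z \<Longrightarrow> R t y z \<Longrightarrow> x = y"
    and R_trans: "R s x y \<Longrightarrow> R t y z \<Longrightarrow> R (s + t) x z"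
    and R_split: "R (s + t) x z \<Longrightarrow> 0 \<le> s \<Longrightarrow> 0 \<le> t \<Longrightarrow> \<exists>y. R s x y \<and> R t y z"
    and R_local: "x \<in> U \<Longrightarrow> open B \<Longrightarrow> x \<in> B \<Longrightarrow>
      \<exists>W \<tau>. open W \<and> x \<in> W \<and> 0 < \<tau> \<and> (\<forall>y\<in>W. \<forall>t\<in>{0..\<tau>}. \<exists>z\<in>B. R t y z)"
    and R_local_rev: "x \<in> U \<Longrightarrow> open B \<Longrightarrow> x \<in> B \<Longrightarrow>
      \<exists>W \<tau>. open W \<and> x \<in> W \<and> 0 < \<tau> \<and> (\<forall>y\<in>W. \<forall>t\<in>{0..\<tau>}. \<exists>z\<in>B. R t z y)"
    and R_cont: "x \<in> U \<Longrightarrow> \<exists>W \<tau>. open W \<and> x \<in> W \<and> 0 < \<tau> \<and>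
      (\<forall>t\<in>{0..\<tau>}. \<forall>y\<in>W. \<forall>z B. R t y z \<and> open B \<and> z \<in> B \<longrightarrow>
         (\<exists>W'. open W' \<and> y \<in> W' \<and> (\<forall>y'\<in>W'. \<exists>z'\<in>B. R t y' z')))"
    and R_cont_rev: "x \<in> U \<Longrightarrow> \<exists>W \<tau>. open W \<and> x \<in> W \<and> 0 < \<tau> \<and>
      (\<forall>t\<in>{0..\<tau>}. \<forall>y\<in>W. \<forall>z B. R t z y \<and> open B \<and> z \<in> B \<longrightarrow>
         (\<exists>W'. open W' \<and> y \<in> W' \<and> (\<forall>y'\<in>W'. \<exists>z'\<in>B. R t z' y')))"
    and continuous_F: "continuous_on U F"
    and F_less: "R t x y \<Longrightarrow> 0 < t \<Longrightarrow> x \<notin> crit \<Longrightarrow> F y < F x"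
    and crit_sub: "crit \<subseteq> U"
    and crit_fixed: "x \<in> crit \<Longrightarrow> 0 \<le> t \<Longrightarrow> R t x x"
    and crit_isolated: "x \<in> U \<Longrightarrow> \<exists>W. open W \<and> x \<in> W \<and> W \<inter> crit \<subseteq> {x}"
    and local_min_crit: "x \<in> U \<Longrightarrow> eventually (\<lambda>y. F x \<le> F y) (nhds x) \<Longrightarrow> x \<in> crit"
    and local_max_crit: "x \<in> U \<Longrightarrow> eventually (\<lambda>y. F y \<le> F x) (nhds x) \<Longrightarrow> x \<in> crit"
    and frontier_zero: "x \<in> frontier M \<Longrightarrow> F x = 0"
    and frontier_perfect: "x \<in> frontier M \<Longrightarrow> x islimpt frontier M"
    and one_sided: "x \<in> frontier M \<Longrightarrow> x \<notin> crit \<Longrightarrow>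
      \<exists>Q. open Q \<and> x \<in> Q \<and> ((\<forall>z\<in>Q. z \<in> M \<longleftrightarrow> 0 \<le> F z) \<or> (\<forall>z\<in>Q. z \<in> M \<longleftrightarrow> F z \<le> 0))"
    and nbhd_base: "x \<in> U \<Longrightarrow> open B \<Longrightarrow> x \<in> B \<Longrightarrow>
      \<exists>W. open W \<and> x \<in> W \<and> compact (closure W) \<and> closure W \<subseteq> B \<and> connected (W - {x})"
begin

lemma closed_M: "closed M"
  by (rule compact_imp_closed[OF compact_M])

definition fl :: "real \<Rightarrow> 'm \<Rightarrow> 'm" where
  "fl t x = (THE y. R t x y)"

definition in_upto :: "'m \<Rightarrow> real \<Rightarrow> bool" where
  "in_upto x t \<longleftrightarrow> (\<forall>s\<in>{0..t}. \<exists>z\<in>M. R s x z)"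

definition stays :: "'m \<Rightarrow> bool" where
  "stays x \<longleftrightarrow> (\<forall>t\<ge>0. in_upto x t)"

definition exits :: "'m \<Rightarrow> real \<Rightarrow> 'm \<Rightarrow> bool" where
  "exits x s y \<longleftrightarrow> R s x y \<and> in_upto x s \<and> y \<in> frontier M - crit \<and> (\<forall>t>s. \<not> in_upto x t)"

text \<open>The clause of \<open>stopped_flow\<close> for nonnegative times, with \<open>R\<close>
  in place of solution curves. Negative times are covered by the same definition in the reversed
  flow.\<close>

definition sflow :: "real \<Rightarrow> 'm \<Rightarrow> 'm" where
  "sflow t x = (if in_upto x t then fl t x
     else fl (LEAST s. s \<in> {0..t} \<and> (\<exists>z\<in>frontier M. R s x z)) x)"

abbreviation converges :: "'m \<Rightarrow> 'm \<Rightarrow> bool" where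
  "converges x y \<equiv> ((\<lambda>t. sflow t x) \<longlongrightarrow> y) at_top"

definition Ws :: "'m \<Rightarrow> 'm set" where
  "Ws y = {x\<in>M. converges x y}"

lemma fl_eq: "R t x y \<Longrightarrow> fl t x = y"
  unfolding fl_def by (rule the_equality) (auto intro: R_det)

lemma R_fl: "R t x y \<Longrightarrow> R t x (fl t x)"
  by (simp add: fl_eq)

lemma reverse_gradient_semiflow:
  "gradient_semiflow U M (\<lambda>x. - F x) (\<lambda>t x y. R t y x) crit"
proof
  show "continuous_on U (\<lambda>x. - F x)"
    using continuous_F by (rule continuous_on_minus)
  show "- F y < - F x" if "R t y x" "0 < t" "x \<notin> crit" for t x y
  proof -
    \<comment> \<open>A critical \<open>y\<close> rests and reaches only itself, so \<open>x\<close>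
      would be critical too.\<close>
    have "y \<notin> crit" using that crit_fixed[of y t] R_det[of t y x y] by auto
    then show ?thesis using F_less that by force
  qed
  show "\<exists>Q. open Q \<and> x \<in> Q \<and> ((\<forall>z\<in>Q. z \<in> M \<longleftrightarrow> 0 \<le> - F z) \<or> (\<forall>z\<in>Q. z \<in> M \<longleftrightarrow> - F z \<le> 0))"
    if "x \<in> frontier M" "x \<notin> crit" for x using one_sided[OF that] by simp blast
  show "R (s + t) z x" if "R s y x" "R t z y" for s x y t z
    using R_trans[OF that(2,1)] by (simp add: add.commute)
  show "\<exists>y. R s y x \<and> R t z y" if "R (s + t) z x" "0 \<le> s" "0 \<le> t" for s t x z
    using R_split[of t s z x] that by (auto simp: add.commute)
qed (use open_U M_sub compact_M connected_M R_dom R_0 R_det R_inj R_local R_local_rev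
       R_cont R_cont_rev crit_sub crit_fixed crit_isolated local_min_crit local_max_crit frontier_zero
       frontier_perfect nbhd_base in \<open>auto 0 3\<close>)

end


section \<open>Trajectories stopped at the boundary\<close>

context gradient_semiflow begin

section \<open>Continuity along trajectories and in the initial point\<close>

lemma R_between:
  assumes "R T x z" "0 \<le> a" "a \<le> b" "b \<le> T"
  shows "R (b - a) (fl a x) (fl b x)"
proof -
  obtain y where y: "R b x y" using R_split[of b "T - b" x z] assms by auto
  then obtain w where "R a x w" "R (b - a) w y" using R_split[of a "b - a" x y] assms by auto
  then show ?thesis using y by (simp add: fl_eq)
qed

lemma R_restrict:
  assumes "R T x z" "0 \<le> s" "s \<le> T"
  shows "R s x (fl s x)"
proof -
  have "fl 0 x = x" using R_0 R_dom[OF assms(1)] by (simp add: fl_eq)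
  then show ?thesis using R_between[OF assms(1) order_refl assms(2,3)] by simp
qed

text \<open>After \<open>s\<close> the local flow from \<open>fl s x\<close> applies. Before
  \<open>s\<close> the local reversed flow at \<open>fl s x\<close> does: its backward points lie on
  the given trajectory because \<open>R\<close> is injective.\<close>

lemma path_continuous:
  assumes R: "R T x z" and s: "0 \<le> s" "s \<le> T" and B: "open B" "fl s x \<in> B"
  shows "\<exists>d>0. \<forall>s'. 0 \<le> s' \<and> s' \<le> T \<and> \<bar>s' - s\<bar> < d \<longrightarrow> fl s' x \<in> B"
proof -
  define y where "y = fl s x"
  have y: "y \<in> U" "y \<in> B" using R_restrict[OF R s] R_dom B y_def by auto
  obtain a where a: "0 < a" "\<And>t. t \<in> {0..a} \<Longrightarrow> \<exists>z\<in>B. R t y z"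
    using R_local[OF y(1) B(1) y(2)] by blast
  obtain b where b: "0 < b" "\<And>t. t \<in> {0..b} \<Longrightarrow> \<exists>z\<in>B. R t z y"
    using R_local_rev[OF y(1) B(1) y(2)] by blast
  have "fl s' x \<in> B" if "0 \<le> s'" "s' \<le> T" "\<bar>s' - s\<bar> < min a b" for s'
  proof (cases "s \<le> s'")
    case True
    then show ?thesis using R_between[OF R s(1) True that(2)] a(2)[of "s' - s"] that R_det
      unfolding y_def by fastforce
  next
    case False
    then show ?thesis using R_between[OF R that(1) _ s(2)] b(2)[of "s - s'"] that R_inj
      unfolding y_def by fastforce
  qed
  then show ?thesis using a b by (intro exI[of _ "min a b"]) auto
qed

lemma path_continuous_on:
  assumes R: "R T x z"
  shows "continuous_on {0..T} (\<lambda>s. fl s x)"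
  unfolding continuous_on_def
proof (intro ballI topological_tendstoI)
  fix s B assume "s \<in> {0..T}" "open B" "fl s x \<in> B"
  then obtain d where "d > 0" "\<forall>s'. 0 \<le> s' \<and> s' \<le> T \<and> \<bar>s' - s\<bar> < d \<longrightarrow> fl s' x \<in> B"
    using path_continuous[OF R, of s B] by auto
  then show "\<forall>\<^sub>F s' in at s within {0..T}. fl s' x \<in> B"
    unfolding eventually_at by (intro exI[of _ d]) (auto simp: dist_real_def)
qed

text \<open>Short-time continuity is composed along the trajectory of \<open>x\<close>. The
  invariant quantifies over all targets because the induction step pulls the target back from time
  \<open>b\<close> to time \<open>a\<close>.\<close>

lemma R_open:
  assumes R: "R t x y" and "open B" "y \<in> B"
  shows "\<exists>W. open W \<and> x \<in> W \<and> (\<forall>x'\<in>W. \<exists>z\<in>B. R t x' z)"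
proof -
  define P where "P s \<longleftrightarrow> (\<forall>B. open B \<and> fl s x \<in> B \<longrightarrow>
    (\<exists>W. open W \<and> x \<in> W \<and> (\<forall>x'\<in>W. \<exists>z\<in>B. R s x' z)))" for s
  have t: "0 \<le> t" "x \<in> U" using R_dom[OF R] by auto
  have "P t"
  proof (rule real_chain_induct[OF t(1)])
    show "P 0" unfolding P_def
    proof (intro allI impI)
      fix B assume B: "open B \<and> fl 0 x \<in> B"
      have "fl 0 x = x" using R_0[OF t(2)] by (rule fl_eq)
      then show "\<exists>W. open W \<and> x \<in> W \<and> (\<forall>x'\<in>W. \<exists>z\<in>B. R 0 x' z)"
        using B t(2) open_U R_0 by (intro exI[of _ "B \<inter> U"]) auto
    qed
  next
    fix s assume s: "0 \<le> s" "s \<le> t"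
    have "fl s x \<in> U" using R_restrict[OF R s] R_dom by blast
    then obtain W \<tau> where W: "open W" "fl s x \<in> W" "0 < \<tau>"
      and cont: "\<forall>t\<in>{0..\<tau>}. \<forall>y\<in>W. \<forall>z B. R t y z \<and> open B \<and> z \<in> B \<longrightarrow>
         (\<exists>W'. open W' \<and> y \<in> W' \<and> (\<forall>y'\<in>W'. \<exists>z'\<in>B. R t y' z'))"
      using R_cont[of "fl s x"] by (metis (lifting))
    obtain d where d: "d > 0" "\<And>s'. 0 \<le> s' \<Longrightarrow> s' \<le> t \<Longrightarrow> \<bar>s' - s\<bar> < d \<Longrightarrow> fl s' x \<in> W"
      using path_continuous[OF R s W(1,2)] by blast
    \<comment> \<open>The radius \<tau>/2 around \<open>s\<close> bounds \<open>b - a\<close> by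
      \<tau>, the range of short-time continuity near \<open>fl s x\<close>.\<close>
    have "P b" if ab: "0 \<le> a" "a \<le> b" "b \<le> t" "\<bar>a - s\<bar> < min d (\<tau>/2)" "\<bar>b - s\<bar> < min d (\<tau>/2)" "P a"
      for a b
      unfolding P_def
    proof (intro allI impI)
      fix B assume B: "open B \<and> fl b x \<in> B"
      have "fl a x \<in> W" using d(2)[of a] ab by auto
      moreover have "b - a \<in> {0..\<tau>}"
        using ab(2,4,5) abs_triangle_ineq4[of "b - s" "a - s"] by auto
      ultimately obtain W' where W': "open W'" "fl a x \<in> W'" "\<forall>y'\<in>W'. \<exists>z'\<in>B. R (b - a) y' z'"
        using cont[THEN bspec, THEN bspec, of "b - a" "fl a x"] R_between[OF R ab(1-3)] B by blast
      then obtain V where V: "open V" "x \<in> V" "\<forall>x'\<in>V. \<exists>z\<in>W'. R a x' z"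
        using ab(6) unfolding P_def by blast
      have "\<exists>z\<in>B. R b x' z" if x': "x' \<in> V" for x'
      proof -
        obtain w where w: "w \<in> W'" "R a x' w" using V(3) x' by blast
        obtain z where "z \<in> B" "R (b - a) w z" using W'(3) w(1) by blast
        then show ?thesis using R_trans[OF w(2), of "b - a" z] by auto
      qed
      then show "\<exists>W. open W \<and> x \<in> W \<and> (\<forall>x'\<in>W. \<exists>z\<in>B. R b x' z)" using V by blast
    qed
    then show "\<exists>d>0. \<forall>a b. 0 \<le> a \<and> a \<le> b \<and> b \<le> t \<and> \<bar>a - s\<bar> < d \<and> \<bar>b - s\<bar> < d \<and> P a \<longrightarrow> P b"
      using d(1) W(3) by (intro exI[of _ "min d (\<tau>/2)"]) auto
  qed
  then show ?thesis using assms unfolding P_def by (simp add: fl_eq)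
qed

text \<open>Continuity in time and initial point together. Up to a fixed time \<open>t0\<close>
  slightly before \<open>t\<close>, continuity in the initial point suffices; the local flow near
  \<open>y\<close> absorbs the remaining variable time. For \<open>t = 0\<close> there is no earlier
  time and the local flow acts alone.\<close>

lemma R_open_joint:
  assumes R: "R t x y" and B: "open B" "y \<in> B"
  shows "\<exists>W d. open W \<and> x \<in> W \<and> 0 < d \<and>
    (\<forall>x'\<in>W. \<forall>s\<ge>0. \<bar>s - t\<bar> < d \<longrightarrow> (\<exists>z\<in>B. R s x' z))"
proof -
  have dom: "0 \<le> t" "x \<in> U" "y \<in> U" using R_dom[OF R] by auto
  obtain V \<tau> where V: "open V" "y \<in> V" "0 < \<tau>" "\<And>y' s. y' \<in> V \<Longrightarrow> s \<in> {0..\<tau>} \<Longrightarrow> \<exists>z\<in>B. R s y' z"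
    using R_local[OF dom(3) B] by blast
  show ?thesis
  proof (cases "t = 0")
    case True
    then have "x = y" using R R_0[OF dom(2)] R_det by blast
    then show ?thesis using V True by (intro exI[of _ V] exI[of _ \<tau>]) auto
  next
    case False
    obtain d where d: "d > 0" "\<And>s. 0 \<le> s \<Longrightarrow> s \<le> t \<Longrightarrow> \<bar>s - t\<bar> < d \<Longrightarrow> fl s x \<in> V"
      using path_continuous[OF R dom(1) order_refl V(1)] V(2) R by (auto simp: fl_eq)
    define t0 where "t0 = max 0 (t - min d \<tau> / 2)"
    have t0: "0 \<le> t0" "t0 < t" "t < t0 + \<tau>" "fl t0 x \<in> V"
      using False dom(1) d(1) V(3) d(2)[of t0] by (auto simp: t0_def max_def min_def field_simps)
    obtain W where W: "open W" "x \<in> W" "\<forall>x'\<in>W. \<exists>z\<in>V. R t0 x' z"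
      using R_open[OF R_restrict[OF R t0(1)] V(1) t0(4)] t0(2) by auto
    have "\<exists>z\<in>B. R s x' z" if x': "x' \<in> W" and s: "\<bar>s - t\<bar> < min (t - t0) (t0 + \<tau> - t)" for x' and s :: real
    proof -
      obtain w where w: "w \<in> V" "R t0 x' w" using W(3) x' by blast
      obtain z where "z \<in> B" "R (s - t0) w z" using V(4)[OF w(1), of "s - t0"] s by (auto simp: abs_less_iff)
      then show ?thesis using R_trans[OF w(2), of "s - t0" z] by auto
    qed
    then show ?thesis using W t0 by (intro exI[of _ W] exI[of _ "min (t - t0) (t0 + \<tau> - t)"]) auto
  qed
qed

lemma crit_eq: "R t x y \<Longrightarrow> x \<in> crit \<Longrightarrow> y = x"
  using crit_fixed[of x t] R_det[of t x x y] R_dom[of t x y] by auto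

lemma crit_eq': "R t x y \<Longrightarrow> y \<in> crit \<Longrightarrow> y = x"
  using crit_fixed[of y t] R_inj[of t x y y] R_dom[of t x y] by auto

lemma F_le: "R t x y \<Longrightarrow> F y \<le> F x"
proof -
  assume R: "R t x y"
  consider "t = 0" | "x \<in> crit" | "0 < t" "x \<notin> crit" using R_dom[OF R] by fastforce
  then show ?thesis
  proof cases
    case 1
    then show ?thesis using R R_0 R_dom R_det by (metis order_refl)
  qed (use R F_less crit_eq in \<open>force+\<close>)
qed

section \<open>Staying in M or leaving it\<close>

text \<open>Solutions can be prolonged by a fixed time from every point of \<open>M\<close>, so a
  trajectory cannot cease to exist before it has left \<open>M\<close>.\<close>

lemma uniform_time: "\<exists>\<tau>>0. \<forall>z\<in>M. \<forall>t\<in>{0..\<tau>}. \<exists>y. R t z y"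
proof -
  have "\<forall>x\<in>M. \<exists>W \<tau>. open W \<and> x \<in> W \<and> 0 < \<tau> \<and> (\<forall>y\<in>W. \<forall>t\<in>{0..\<tau>}. \<exists>z. R t y z)"
    using R_local[OF _ open_U] M_sub by (meson subsetD)
  then obtain W \<tau> where W: "\<And>x. x \<in> M \<Longrightarrow> open (W x) \<and> x \<in> W x \<and> 0 < \<tau> x
      \<and> (\<forall>y\<in>W x. \<forall>t\<in>{0..\<tau> x}. \<exists>z. R t y z)" by metis
  obtain C where C: "C \<subseteq> M" "finite C" "M \<subseteq> (\<Union>c\<in>C. W c)"
    using compactE_image[OF compact_M, of M W] W by blast
  define r where "r = Min (insert (1::real) (\<tau> ` C))"
  have "r > 0" using C W by (auto simp: r_def)
  moreover have "\<exists>y. R t z y" if z: "z \<in> M" and t: "t \<in> {0..r}" for z t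
  proof -
    obtain c where c: "c \<in> C" "z \<in> W c" using z C(3) by auto
    have "r \<le> \<tau> c" using C c by (auto simp: r_def)
    then show ?thesis using W[of c] c C t by (meson atLeastAtMost_iff order_trans subsetD)
  qed
  ultimately show ?thesis by blast
qed

lemma in_upto_fl: "in_upto x t \<Longrightarrow> 0 \<le> s \<Longrightarrow> s \<le> t \<Longrightarrow> R s x (fl s x) \<and> fl s x \<in> M"
  unfolding in_upto_def by (metis atLeastAtMost_iff fl_eq)

lemma in_upto_mono: "in_upto x t \<Longrightarrow> s \<le> t \<Longrightarrow> in_upto x s"
  unfolding in_upto_def by auto

lemma in_upto_shift:
  assumes "in_upto x s" "R s x y" "in_upto y t"
  shows "in_upto x (s + t)"
  unfolding in_upto_def
proof
  fix r assume r: "r \<in> {0..s + t}"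
  show "\<exists>z\<in>M. R r x z"
  proof (cases "r \<le> s")
    case True
    then show ?thesis using assms(1) r by (auto simp: in_upto_def)
  next
    case False
    then obtain z where "z \<in> M" "R (r - s) y z" using assms(3) r unfolding in_upto_def by force
    then show ?thesis using R_trans[OF assms(2), of "r - s" z] by auto
  qed
qed

lemma in_upto_unshift:
  assumes "in_upto x (s + t)" "R s x y"
  shows "in_upto y t"
  unfolding in_upto_def
proof
  fix r assume r: "r \<in> {0..t}"
  have s: "0 \<le> s" using R_dom[OF assms(2)] by simp
  have "R (s + r - s) (fl s x) (fl (s + r) x)"
    using in_upto_fl[OF assms(1), of "s + r"] R_between[of "s + r" x _ s "s + r"] r s by auto
  then show "\<exists>z\<in>M. R r y z"
    using in_upto_fl[OF assms(1), of "s + r"] r s assms(2) by (auto simp: fl_eq)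
qed

lemma in_upto_extend:
  assumes "x \<in> interior M"
  shows "\<exists>\<tau>>0. in_upto x \<tau>"
proof -
  have "x \<in> U" using assms interior_subset M_sub by blast
  then show ?thesis using R_local[of x "interior M"] assms interior_subset unfolding in_upto_def
    by (metis (no_types, lifting) open_interior subsetD)
qed

lemma crit_stays: "x \<in> crit \<Longrightarrow> x \<in> M \<Longrightarrow> stays x"
  unfolding stays_def in_upto_def using crit_fixed[of x] by (auto intro!: bexI[of _ x])

text \<open>At the supremum \<open>s0\<close> of the times spent in \<open>M\<close> the solution
  still exists, by the uniform existence time, and lies in the closed set \<open>M\<close>. It is
  not in the interior, where it could continue, and not critical, since a critical point is reached
  only from itself.\<close>

lemma stays_or_exits:
  assumes x: "x \<in> M"
  shows "stays x \<or> (\<exists>s y. exits x s y)"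
proof (rule disjCI)
  assume *: "\<nexists>s y. exits x s y"
  define S where "S = {s. 0 \<le> s \<and> in_upto x s}"
  show "stays x"
  proof (rule ccontr)
    assume ns: "\<not> stays x"
    then obtain t where t: "0 \<le> t" "\<not> in_upto x t" by (auto simp: stays_def)
    have bdd: "bdd_above S"
      by (rule bdd_aboveI[of _ t]) (use t in_upto_mono[of x _ t] linear in \<open>auto simp: S_def\<close>)
    have xU: "x \<in> U" using x M_sub by blast
    have "in_upto x 0" using x R_0[OF xU] by (auto simp: in_upto_def)
    then have S0: "0 \<in> S" by (simp add: S_def)
    define s0 where "s0 = Sup S"
    have s0: "0 \<le> s0" using S0 bdd unfolding s0_def by (auto intro: cSup_upper)
    have less: "in_upto x s" if "s < s0" for s
      using less_cSup_iff[of S s] S0 bdd that in_upto_mono unfolding s0_def S_def by force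
    have notS: "\<not> in_upto x s" if "s > s0" for s
      using cSup_upper[of s S] bdd that s0 unfolding s0_def S_def by force
    obtain \<tau> where \<tau>: "0 < \<tau>" "\<And>z t. z \<in> M \<Longrightarrow> t \<in> {0..\<tau>} \<Longrightarrow> \<exists>y. R t z y"
      using uniform_time by blast
    \<comment> \<open>The solution is known only before time \<open>s0\<close>; it is extended to
      \<open>s0\<close> from a time at most \<tau> earlier.\<close>
    obtain s1 where s1: "0 \<le> s1" "s1 \<le> s0" "s0 \<le> s1 + \<tau>" "in_upto x s1"
    proof (cases "s0 = 0")
      case True then show ?thesis using that[of 0] \<open>in_upto x 0\<close> \<tau> by auto
    next
      case False
      then show ?thesis using that[of "max 0 (s0 - \<tau>)"] less[of "max 0 (s0 - \<tau>)"] s0 \<tau> by auto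
    qed
    obtain y where y: "R s0 x y"
      using in_upto_fl[OF s1(4,1)] \<tau>(2)[of "fl s1 x" "s0 - s1"] R_trans[of s1 x "fl s1 x" "s0 - s1"] s1
      by auto
    have yM: "y \<in> M"
    proof (rule ccontr)
      assume "y \<notin> M"
      then obtain d where d: "d > 0" "\<And>s. 0 \<le> s \<Longrightarrow> s \<le> s0 \<Longrightarrow> \<bar>s - s0\<bar> < d \<Longrightarrow> fl s x \<in> - M"
        using path_continuous[OF y s0 order_refl, of "- M"] closed_M fl_eq[OF y] by (auto simp: open_Compl)
      define s where "s = max 0 (s0 - d/2)"
      have "fl s x \<in> - M" using d s0 by (auto simp: s_def)
      moreover have "in_upto x s"
        using less[of s] \<open>in_upto x 0\<close> s0 d(1) by (cases "s0 = 0") (auto simp: s_def max_def)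
      ultimately show False using in_upto_fl[of x s s] by (auto simp: s_def)
    qed
    have in0: "in_upto x s0"
      unfolding in_upto_def
    proof
      fix s assume "s \<in> {0..s0}"
      then show "\<exists>z\<in>M. R s x z"
        using y yM less[of s] in_upto_fl[of x s s] by (cases "s = s0") auto
    qed
    have "y \<notin> interior M"
      using in_upto_extend[of y] in_upto_shift[OF in0 y] notS by force
    moreover have "y \<notin> crit"
      using crit_eq'[OF y] crit_stays[of x] x ns by auto
    ultimately have "exits x s0 y"
      unfolding exits_def frontier_def using y in0 notS yM closure_subset by auto
    then show False using * by blast
  qed
qed

lemma exits_not_crit: "exits x s y \<Longrightarrow> x \<notin> crit"
  unfolding exits_def using crit_eq[of s x y] by auto

text \<open>\<open>F\<close> vanishes at both frontier points and would decrease strictly from one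
  to the other. This identifies the exit time with the least hitting time that occurs in
  \<open>sflow\<close>.\<close>

lemma exits_first:
  assumes e: "exits x s y" and z: "R r x z" "z \<in> frontier M"
  shows "s \<le> r"
proof (rule ccontr)
  assume less: "\<not> s \<le> r"
  have R: "R s x y" and y: "y \<in> frontier M" using e by (auto simp: exits_def)
  have "R (s - r) z y"
    using R_between[OF R, of r s] R_dom[OF z(1)] less fl_eq[OF z(1)] fl_eq[OF R] by auto
  moreover have "z \<notin> crit" using crit_eq'[OF z(1)] exits_not_crit[OF e] by auto
  ultimately show False using F_less[of "s - r" z y] less frontier_zero z y by auto
qed

lemma exits_sflow:
  assumes e: "exits x s y" and t: "t > s"
  shows "sflow t x = y"
proof -
  have R: "R s x y" and y: "y \<in> frontier M" using e by (auto simp: exits_def)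
  have s: "0 \<le> s" using R_dom[OF R] by simp
  have "(LEAST r. r \<in> {0..t} \<and> (\<exists>z\<in>frontier M. R r x z)) = s"
    by (rule Least_equality) (use R y s t exits_first[OF e] in auto)
  then show ?thesis using e t fl_eq[OF R] by (simp add: sflow_def exits_def)
qed

lemma exits_limit: "exits x s y \<Longrightarrow> converges x y"
  by (rule tendsto_eventually, rule eventually_mono[OF eventually_gt_at_top[of s]]) (rule exits_sflow)

lemma stays_sflow: "stays x \<Longrightarrow> 0 \<le> t \<Longrightarrow> R t x (sflow t x) \<and> sflow t x \<in> M \<and> sflow t x = fl t x"
  using in_upto_fl[of x t t] by (auto simp: stays_def sflow_def)

lemma stays_between: "stays x \<Longrightarrow> 0 \<le> s \<Longrightarrow> s \<le> t \<Longrightarrow> R (t - s) (sflow s x) (sflow t x)"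
  using R_between[of t x _ s t] stays_sflow[of x t] stays_sflow[of x s] by auto

lemma stays_continuous_on: "stays x \<Longrightarrow> continuous_on {a..b} (\<lambda>t. sflow t x)" if "0 \<le> a"
proof -
  assume x: "stays x"
  show ?thesis
  proof (cases "a \<le> b")
    case True
    then have "continuous_on {0..b} (\<lambda>t. fl t x)"
      using path_continuous_on[of b x] stays_sflow[OF x, of b] that by auto
    then have "continuous_on {0..b} (\<lambda>t. sflow t x)"
      by (rule continuous_on_eq) (use stays_sflow[OF x] in auto)
    then show ?thesis by (rule continuous_on_subset) (use that in auto)
  qed auto
qed

section \<open>Limits of trajectories that stay in M\<close>

text \<open>\<open>F\<close> is a strict Lyapunov function: on a neighbourhood of \<open>z\<close>
  it exceeds \<open>m\<close>, and after a fixed time it has fallen below \<open>m\<close>. After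
  one visit the values are too small for a later return.\<close>

lemma eventually_avoids_noncrit:
  assumes x: "stays x" and z: "z \<in> U" "z \<notin> crit"
  shows "\<exists>W. open W \<and> z \<in> W \<and> eventually (\<lambda>t. sflow t x \<notin> W) at_top"
proof -
  obtain \<tau> w where w: "0 < \<tau>" "R \<tau> z w" using R_local[OF z(1) open_U z(1)] by force
  have w_U: "w \<in> U" using R_dom[OF w(2)] by simp
  define m where "m = (F z + F w) / 2"
  have m: "F w < m" "m < F z" using F_less[OF w(2,1) z(2)] by (auto simp: m_def)
  have "openin (top_of_set U) (U \<inter> F -` {..<m})" "openin (top_of_set U) (U \<inter> F -` {m<..})"
    using continuous_F continuous_openin_preimage_gen open_lessThan open_greaterThan by blast+
  then have o: "open (U \<inter> F -` {..<m})" "open (U \<inter> F -` {m<..})"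
    using open_U openin_open_eq by auto
  obtain W where W: "open W" "z \<in> W" "\<And>x'. x' \<in> W \<Longrightarrow> \<exists>y\<in>U \<inter> F -` {..<m}. R \<tau> x' y"
    using R_open[OF w(2) o(1)] m w_U by auto
  define V where "V = W \<inter> (U \<inter> F -` {m<..})"
  have "eventually (\<lambda>t. sflow t x \<notin> V) at_top"
  proof (cases "\<exists>t\<ge>0. sflow t x \<in> V")
    case True
    then obtain t where t: "t \<ge> 0" "sflow t x \<in> V" by blast
    then obtain y where y: "F y < m" "R \<tau> (sflow t x) y" using W(3) by (auto simp: V_def)
    have "sflow s x \<notin> V" if "s \<ge> t + \<tau>" for s
    proof -
      have "R \<tau> (sflow t x) (sflow (t + \<tau>) x)"
        using stays_between[OF x t(1), of "t + \<tau>"] w(1) by simp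
      then have "y = sflow (t + \<tau>) x" using y R_det by blast
      moreover have "F (sflow s x) \<le> F (sflow (t + \<tau>) x)"
        using F_le[OF stays_between[OF x _ that]] t w by auto
      ultimately show ?thesis using y by (auto simp: V_def)
    qed
    then show ?thesis unfolding eventually_at_top_linorder by blast
  next
    case False
    then show ?thesis unfolding eventually_at_top_linorder by blast
  qed
  then show ?thesis using W o z m by (intro exI[of _ V]) (auto simp: V_def intro: open_Int)
qed

lemma eventually_avoids_compact:
  assumes "compact Q" and "\<And>z. z \<in> Q \<Longrightarrow> \<exists>W. open W \<and> z \<in> W \<and> eventually (\<lambda>t. p t \<notin> W) at_top"
  shows "eventually (\<lambda>t::real. p t \<notin> Q) at_top"
proof -
  obtain W where W: "\<And>z. z \<in> Q \<Longrightarrow> open (W z) \<and> z \<in> W z \<and> eventually (\<lambda>t. p t \<notin> W z) at_top"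
    using assms(2) by metis
  obtain C where C: "C \<subseteq> Q" "finite C" "Q \<subseteq> (\<Union>c\<in>C. W c)"
    using compactE_image[OF assms(1), of Q W] W by blast
  have "eventually (\<lambda>t. \<forall>c\<in>C. p t \<notin> W c) at_top"
    using C W by (intro eventually_ball_finite) auto
  then show ?thesis by eventually_elim (use C in blast)
qed

text \<open>Compactness of \<open>M\<close> yields an accumulation point, which cannot be
  noncritical. A small neighbourhood of it has a compact frontier without critical points; the
  trajectory eventually avoids this frontier and, being connected, is confined to the
  neighbourhood.\<close>

lemma stays_limit:
  assumes x: "stays x"
  shows "\<exists>z\<in>crit \<inter> M. converges x z"
proof -
  let ?p = "\<lambda>t. sflow t x"
  have pM: "?p t \<in> M" if "t \<ge> 0" for t using stays_sflow[OF x that] by blast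
  have "\<not> eventually (\<lambda>t. ?p t \<notin> M) at_top"
  proof
    assume "eventually (\<lambda>t. ?p t \<notin> M) at_top"
    then have "eventually (\<lambda>t::real. False) at_top"
      using eventually_ge_at_top[of 0] by eventually_elim (use pM in auto)
    then show False by simp
  qed
  then obtain z where z: "z \<in> M" "\<And>W. open W \<Longrightarrow> z \<in> W \<Longrightarrow> \<not> eventually (\<lambda>t. ?p t \<notin> W) at_top"
    using eventually_avoids_compact[OF compact_M, of ?p] by metis
  have zU: "z \<in> U" using z M_sub by blast
  then have zc: "z \<in> crit" using eventually_avoids_noncrit[OF x] z(2) by blast
  have "(?p \<longlongrightarrow> z) at_top"
  proof (rule topological_tendstoI)
    fix B assume B: "open B" "z \<in> B"
    obtain V where V: "open V" "z \<in> V" "V \<inter> crit \<subseteq> {z}" using crit_isolated[OF zU] by blast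
    obtain W where W: "open W" "z \<in> W" "compact (closure W)" "closure W \<subseteq> B \<inter> V \<inter> U"
      using nbhd_base[OF zU, of "B \<inter> V \<inter> U"] B V open_U zU by auto
    have "compact (frontier W)"
      using compact_Int_closed[OF W(3), of "- interior W"] unfolding frontier_def by (simp add: Diff_eq closed_Compl)
    moreover have "\<exists>N. open N \<and> y \<in> N \<and> eventually (\<lambda>t. ?p t \<notin> N) at_top" if "y \<in> frontier W" for y
    proof -
      have "y \<in> closure W" "y \<noteq> z"
        using that W(1,2) by (auto simp: frontier_def interior_open)
      then have "y \<in> U" "y \<notin> crit" using W(4) V(3) by auto
      then show ?thesis by (rule eventually_avoids_noncrit[OF x])
    qed
    ultimately have "eventually (\<lambda>t. ?p t \<notin> frontier W) at_top"
      by (rule eventually_avoids_compact)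
    then obtain T where T: "\<And>t. t \<ge> T \<Longrightarrow> ?p t \<notin> frontier W"
      unfolding eventually_at_top_linorder by blast
    obtain t0 where t0: "t0 \<ge> max 0 T" "?p t0 \<in> W"
      using z(2)[OF W(1,2)] unfolding eventually_at_top_linorder by blast
    have "?p t \<in> W" if t: "t \<ge> t0" for t
    proof (rule ccontr)
      assume "?p t \<notin> W"
      moreover have "connected (?p ` {t0..t})"
        using stays_continuous_on[OF _ x, of t0 t] t0 by (intro connected_continuous_image) auto
      moreover have "?p t0 \<in> ?p ` {t0..t}" "?p t \<in> ?p ` {t0..t}" using t by auto
      ultimately have "?p ` {t0..t} \<inter> frontier W \<noteq> {}"
        using connected_Int_frontier[of "?p ` {t0..t}" W] t0(2) by blast
      then show False using T t0 by auto
    qed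
    then show "eventually (\<lambda>t. ?p t \<in> B) at_top"
      unfolding eventually_at_top_linorder using W(4) closure_subset by blast
  qed
  then show ?thesis using zc z by blast
qed

end


section \<open>Basins of attraction\<close>

context gradient_semiflow begin

lemma limit_unique:
  "converges x y \<Longrightarrow> converges x z \<Longrightarrow> y = z"
  by (rule tendsto_unique[OF trivial_limit_at_top_linorder])

lemma Ws_exits: "exits x s z \<Longrightarrow> x \<in> Ws y \<Longrightarrow> y \<in> frontier M - crit"
  using limit_unique[OF exits_limit] unfolding Ws_def exits_def by blast

lemma Ws_stays: "stays x \<Longrightarrow> x \<in> Ws y \<Longrightarrow> y \<in> crit \<inter> M"
  using limit_unique stays_limit unfolding Ws_def by blast

lemma limit_hits:
  assumes "converges x p" "open B" "p \<in> B"
  obtains t where "0 \<le> t" "sflow t x \<in> B"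
proof -
  have "eventually (\<lambda>t. 0 \<le> t \<and> sflow t x \<in> B) at_top"
    using topological_tendstoD[OF assms] eventually_ge_at_top[of 0] by eventually_elim auto
  then show ?thesis using that unfolding eventually_at_top_linorder by blast
qed

lemma crit_Ws: "x \<in> crit \<Longrightarrow> x \<in> Ws y \<Longrightarrow> y = x"
proof -
  assume x: "x \<in> crit" "x \<in> Ws y"
  then have st: "stays x" using crit_stays by (simp add: Ws_def)
  have "eventually (\<lambda>t. sflow t x = x) at_top"
    by (rule eventually_mono[OF eventually_ge_at_top[of 0]])
      (use stays_sflow[OF st] crit_eq[OF _ x(1)] in blast)
  then have "converges x x" by (rule tendsto_eventually)
  then show "y = x" using limit_unique x(2) by (auto simp: Ws_def)
qed

section \<open>Strict minima and their invariant neighbourhoods\<close>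

text \<open>A nearby point with a value no larger would itself be a local minimum, hence a second
  critical point in a neighbourhood that isolates \<open>x\<close>.\<close>

lemma strict_minimum:
  assumes x: "x \<in> U" "eventually (\<lambda>y. F x \<le> F y) (nhds x)"
  shows "\<exists>W. open W \<and> x \<in> W \<and> W \<subseteq> U \<and> W \<inter> crit \<subseteq> {x} \<and> (\<forall>y\<in>W. y \<noteq> x \<longrightarrow> F x < F y)"
proof -
  obtain V where V: "open V" "x \<in> V" "\<forall>y\<in>V. F x \<le> F y" using x(2) unfolding eventually_nhds by blast
  obtain V' where V': "open V'" "x \<in> V'" "V' \<inter> crit \<subseteq> {x}" using crit_isolated[OF x(1)] by blast
  define W where "W = V \<inter> V' \<inter> U"
  have W: "open W" "x \<in> W" using V V' x open_U by (auto simp: W_def)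
  have "F x < F y" if "y \<in> W" "y \<noteq> x" for y
  proof (rule ccontr)
    assume "\<not> F x < F y"
    then have "\<forall>z\<in>W. F y \<le> F z" using V that by (force simp: W_def)
    then have "eventually (\<lambda>z. F y \<le> F z) (nhds y)" using W that unfolding eventually_nhds by blast
    then have "y \<in> crit" using local_min_crit that by (auto simp: W_def)
    then show False using V' that by (auto simp: W_def)
  qed
  then show ?thesis using W V' by (intro exI[of _ W]) (auto simp: W_def)
qed

lemma minima_strict:
  assumes "p \<in> minima M F"
  shows "\<exists>W. open W \<and> p \<in> W \<and> W \<subseteq> U \<and> W \<inter> crit \<subseteq> {p} \<and> (\<forall>y\<in>W. y \<noteq> p \<longrightarrow> F p < F y)"
  using strict_minimum[of p] assms M_sub by (auto simp: minima_def)

lemma minima_crit: "p \<in> minima M F \<Longrightarrow> p \<in> crit"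
  using local_min_crit[of p] M_sub by (auto simp: minima_def)

text \<open>\<open>F\<close> is constant on the frontier, which has no isolated points, whereas
  minima are strict.\<close>

lemma minima_interior:
  assumes "p \<in> minima M F"
  shows "p \<in> interior M"
proof (rule ccontr)
  assume "p \<notin> interior M"
  then have p: "p \<in> frontier M"
    using assms closure_subset by (auto simp: frontier_def minima_def)
  obtain W where W: "open W" "p \<in> W" "\<forall>y\<in>W. y \<noteq> p \<longrightarrow> F p < F y" using minima_strict[OF assms] by blast
  then obtain y where "y \<in> frontier M" "y \<in> W" "y \<noteq> p"
    using frontier_perfect[OF p] unfolding islimpt_def by blast
  then show False using W frontier_zero p by force
qed

lemma frontier_interior: "x \<in> frontier M \<Longrightarrow> x \<notin> interior M"
  by (simp add: frontier_def)

lemma Ws_minima_stays: "p \<in> minima M F \<Longrightarrow> x \<in> Ws p \<Longrightarrow> stays x"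
  using stays_or_exits[of x] Ws_exits minima_crit unfolding Ws_def by blast

text \<open>\<open>D\<close> is the part of a sublevel set of \<open>F\<close> inside a small
  neighbourhood \<open>W\<close> of \<open>p\<close>, at a level \<open>m\<close> below all values
  on the frontier of \<open>W\<close>; hence it is forward invariant. \<open>K\<close> is the level
  set of \<open>m\<close> in it, a compact gate through which every trajectory tending to
  \<open>p\<close> from outside \<open>D\<close> has to pass. It omits \<open>p\<close>, so its
  points are not at rest.\<close>

lemma min_basin:
  assumes p: "p \<in> minima M F" and B: "open B" "p \<in> B"
  obtains D K where "compact D" "D \<subseteq> B" "D \<subseteq> interior M" "p \<in> interior D" "compact K" "K \<subseteq> D - {p}"
    "\<And>y. y \<in> D \<Longrightarrow> stays y \<and> y \<in> Ws p \<and> (\<forall>t\<ge>0. sflow t y \<in> D)"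
    "\<And>x. x \<in> Ws p \<Longrightarrow> x \<notin> D \<Longrightarrow> \<exists>t\<ge>0. sflow t x \<in> K"
proof -
  obtain V where V: "open V" "p \<in> V" "V \<subseteq> U" "V \<inter> crit \<subseteq> {p}" "\<forall>y\<in>V. y \<noteq> p \<longrightarrow> F p < F y"
    using minima_strict[OF p] by blast
  have pM: "p \<in> interior M" by (rule minima_interior[OF p])
  have "p \<in> U" using V by blast
  then obtain W where W: "open W" "p \<in> W" "compact (closure W)" "closure W \<subseteq> B \<inter> V \<inter> interior M"
    using nbhd_base[of p "B \<inter> V \<inter> interior M"] B V pM by auto
  have WU: "closure W \<subseteq> U" using W V by blast
  have WW: "W \<subseteq> closure W" by (rule closure_subset)
  have cF: "continuous_on (closure W) F" using continuous_F WU continuous_on_subset by blast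
  have cl: "closed (closure W)" by simp
  have "compact (frontier W)"
    using compact_Int_closed[OF W(3), of "- interior W"] unfolding frontier_def by (simp add: Diff_eq closed_Compl)
  have fr: "y \<in> closure W \<and> y \<noteq> p" if "y \<in> frontier W" for y
    using that W by (auto simp: frontier_def interior_open)
  obtain m where m: "F p < m" "\<forall>y\<in>frontier W. m < F y"
  proof (cases "frontier W = {}")
    \<comment> \<open>Without a frontier nothing bounds the level from above, so any number beyond
      \<open>F p\<close> serves.\<close>
    case True then show ?thesis using that[of "F p + 1"] by auto
  next
    case False
    have "continuous_on (frontier W) F" using cF fr continuous_on_subset by blast
    then obtain y where y: "y \<in> frontier W" "\<forall>z\<in>frontier W. F y \<le> F z"
      using continuous_attains_inf[OF \<open>compact (frontier W)\<close> False] by blast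
    have "F p < F y" using fr[OF y(1)] V W by blast
    then show ?thesis using y that[of "(F p + F y) / 2"] by force
  qed
  define D where "D = closure W \<inter> F -` {..m}"
  define K where "K = closure W \<inter> F -` {m}"
  have "closed D" "closed K"
    unfolding D_def K_def by (rule continuous_closed_preimage[OF cF cl]; simp)+
  then have "compact (closure W \<inter> D)" "compact (closure W \<inter> K)"
    using W(3) compact_Int_closed by blast+
  then have comp: "compact D" "compact K" by (simp_all add: D_def K_def Int_assoc[symmetric])
  have DW: "D \<subseteq> W"
    using m fr closure_Un_frontier[of W] by (force simp: D_def)
  have o: "open (W \<inter> F -` {..<m})"
  proof -
    have "openin (top_of_set U) (U \<inter> F -` {..<m})"
      using continuous_F continuous_openin_preimage_gen open_lessThan by blast
    then have "open (U \<inter> F -` {..<m})" using open_U openin_open_eq by auto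
    moreover have "W \<inter> F -` {..<m} = W \<inter> (U \<inter> F -` {..<m})" using WU WW by auto
    ultimately show ?thesis using W(1) by (simp add: open_Int)
  qed
  have sub: "W \<inter> F -` {..<m} \<subseteq> interior D"
    by (rule interior_maximal[OF _ o]) (use WW in \<open>auto simp: D_def\<close>)
  have path: "fl t y \<in> D" if y: "y \<in> D" and t: "in_upto y t" "0 \<le> t" for y t
  proof -
    have R: "R t y (fl t y)" using in_upto_fl[OF t(1,2)] by simp
    have le: "F (fl s y) \<le> m" if "0 \<le> s" "s \<le> t" for s
      using F_le[OF R_restrict[OF R that]] y by (auto simp: D_def)
    \<comment> \<open>Along the trajectory \<open>F\<close> is at most \<open>m\<close>, on the
      frontier of \<open>W\<close> it exceeds \<open>m\<close>; so the trajectory cannot leave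
      \<open>W\<close>.\<close>
    have "(\<lambda>s. fl s y) ` {0..t} \<inter> frontier W = {}"
      using le m by fastforce
    moreover have "connected ((\<lambda>s. fl s y) ` {0..t})"
      using path_continuous_on[OF R] by (intro connected_continuous_image) auto
    moreover have "fl 0 y = y" using R_0 R_dom[OF R] fl_eq by blast
    then have "y \<in> (\<lambda>s. fl s y) ` {0..t}" using t by (metis atLeastAtMost_iff imageI order_refl)
    ultimately have "(\<lambda>s. fl s y) ` {0..t} \<subseteq> W"
      using connected_Int_frontier[of "(\<lambda>s. fl s y) ` {0..t}" W] DW y by blast
    then have "fl t y \<in> W" using t by auto
    then show ?thesis using le[of t] t WW by (auto simp: D_def)
  qed
  have DM: "D \<subseteq> interior M" using DW W WW by blast
  have basin: "stays y \<and> y \<in> Ws p \<and> (\<forall>t\<ge>0. sflow t y \<in> D)" if y: "y \<in> D" for y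
  proof -
    have yM: "y \<in> M" using DM y interior_subset by blast
    have "\<not> exits y s z" for s z
    proof
      assume e: "exits y s z"
      then have "R s y z" "in_upto y s" "z \<in> frontier M" by (auto simp: exits_def)
      then have "z \<in> D" using path[OF y, of s] R_dom fl_eq by auto
      then show False using DM frontier_interior \<open>z \<in> frontier M\<close> by blast
    qed
    then have st: "stays y" using stays_or_exits[OF yM] by blast
    have inD: "\<forall>t\<ge>0. sflow t y \<in> D"
      using path[OF y] stays_sflow[OF st] st by (auto simp: stays_def)
    obtain z where z: "z \<in> crit" "converges y z" using stays_limit[OF st] by blast
    have "eventually (\<lambda>t. sflow t y \<in> D) at_top"
      using eventually_ge_at_top[of 0] by eventually_elim (use inD in auto)
    then have "z \<in> D" using Lim_in_closed_set[OF compact_imp_closed[OF comp(1)] _ _ z(2)] by simp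
    then have "z = p" using z V DW W WW by blast
    then show ?thesis using st inD z yM by (auto simp: Ws_def)
  qed
  show ?thesis
  proof (rule that[of D K])
    show "compact D" "compact K" by (fact comp)+
    show "D \<subseteq> B" "D \<subseteq> interior M" using DW W WW by blast+
    show "p \<in> interior D" using sub W m by auto
    show "K \<subseteq> D - {p}" using m by (auto simp: D_def K_def)
    show "stays y \<and> y \<in> Ws p \<and> (\<forall>t\<ge>0. sflow t y \<in> D)" if "y \<in> D" for y by (rule basin[OF that])
    show "\<exists>t\<ge>0. sflow t x \<in> K" if x: "x \<in> Ws p" "x \<notin> D" for x
    proof -
      have st: "stays x" by (rule Ws_minima_stays[OF p x(1)])
      obtain t where t: "0 \<le> t" "sflow t x \<in> interior D"
        by (rule limit_hits[of x p "interior D"]) (use x(1) sub W m in \<open>auto simp: Ws_def\<close>)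
      have "sflow 0 x = x" using stays_sflow[OF st, of 0] R_0 R_dom R_det by (metis order_refl)
      then have "x \<in> (\<lambda>s. sflow s x) ` {0..t}" using t by (metis atLeastAtMost_iff imageI order_refl)
      moreover have "sflow t x \<in> (\<lambda>s. sflow s x) ` {0..t}" using t by auto
      moreover have "connected ((\<lambda>s. sflow s x) ` {0..t})"
        using stays_continuous_on[OF _ st] by (intro connected_continuous_image) auto
      ultimately obtain s where s: "s \<in> {0..t}" "sflow s x \<in> frontier D"
        using connected_Int_frontier[of "(\<lambda>s. sflow s x) ` {0..t}" D] t(2) x(2) interior_subset by blast
      then have "sflow s x \<in> D" "sflow s x \<notin> interior D"
        using frontier_subset_closed[OF compact_imp_closed[OF comp(1)]] by (auto simp: frontier_def)
      \<comment> \<open>Points of \<open>D\<close> with a value below \<open>m\<close> are interior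
        to \<open>D\<close>, so the crossing point has the value \<open>m\<close>.\<close>
      then have "sflow s x \<in> K" using sub DW by (force simp: D_def K_def)
      then show ?thesis using s by auto
    qed
  qed
qed

section \<open>Openness of basins and of leaving M\<close>

text \<open>The trajectory may start on the frontier and enter \<open>M\<close> there, so only
  starting points in \<open>M\<close> are compared. Near each point of the trajectory, passing from
  a point of \<open>M\<close> to a point of no larger \<open>F\<close> does not lead out of
  \<open>M\<close>; this prolongs the stay of nearby trajectories step by step.\<close>

lemma in_upto_open:
  assumes T: "in_upto x T" "0 \<le> T" and int: "fl T x \<in> interior M"
  shows "\<exists>W. open W \<and> x \<in> W \<and> (\<forall>x'\<in>W \<inter> M. in_upto x' T)"
proof (rule real_chain_induct[OF T(2), where P = "\<lambda>s. \<exists>W. open W \<and> x \<in> W \<and> (\<forall>x'\<in>W \<inter> M. in_upto x' s)"])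
  show "\<exists>W. open W \<and> x \<in> W \<and> (\<forall>x'\<in>W \<inter> M. in_upto x' 0)"
    using M_sub R_0 by (intro exI[of _ UNIV]) (auto simp: in_upto_def)
next
  fix s assume s: "0 \<le> s" "s \<le> T"
  define y where "y = fl s x"
  have y: "R s x y" "y \<in> M" using in_upto_fl[OF T(1) s] by (auto simp: y_def)
  have RT: "R T x (fl T x)" using in_upto_fl[OF T(1,2)] by simp
  have "\<exists>Q. open Q \<and> y \<in> Q \<and> (\<forall>z\<in>Q \<inter> M. \<forall>w\<in>Q. F w \<le> F z \<longrightarrow> w \<in> M)"
  proof (cases "y \<in> interior M")
    case True
    then show ?thesis using interior_subset by (intro exI[of _ "interior M"]) auto
  next
    case False
    then have fr: "y \<in> frontier M" using y closure_subset by (auto simp: frontier_def)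
    \<comment> \<open>If \<open>y\<close> were critical, the trajectory would rest at
      \<open>y\<close> and its end point would not be interior.\<close>
    have yc: "y \<notin> crit"
      using crit_eq'[OF y(1)] crit_eq[OF RT] int False by auto
    obtain Q where Q: "open Q" "y \<in> Q" "(\<forall>z\<in>Q. z \<in> M \<longleftrightarrow> 0 \<le> F z) \<or> (\<forall>z\<in>Q. z \<in> M \<longleftrightarrow> F z \<le> 0)"
      using one_sided[OF fr yc] by blast
    \<comment> \<open>If \<open>M\<close> were given by \<open>F\<close> nonnegative near
      \<open>y\<close>, the trajectory would be outside \<open>M\<close> right after
      \<open>s\<close>, although it remains in \<open>M\<close> up to the later time
      \<open>T\<close>.\<close>
    have "\<not> (\<forall>z\<in>Q. z \<in> M \<longleftrightarrow> 0 \<le> F z)"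
    proof
      assume *: "\<forall>z\<in>Q. z \<in> M \<longleftrightarrow> 0 \<le> F z"
      have "s \<noteq> T" using False int y_def by auto
      then have "s < T" using s by simp
      obtain d where d: "d > 0" "\<And>r. 0 \<le> r \<Longrightarrow> r \<le> T \<Longrightarrow> \<bar>r - s\<bar> < d \<Longrightarrow> fl r x \<in> Q"
        using path_continuous[OF RT s Q(1)] Q(2) y_def by blast
      define r where "r = min T (s + d/2)"
      have r: "s < r" "r \<le> T" "fl r x \<in> Q" using \<open>s < T\<close> d s by (auto simp: r_def min_def)
      have "R (r - s) y (fl r x)" using R_between[OF RT s(1), of r] r by (simp add: y_def)
      then have "F (fl r x) < F y" using F_less yc r by auto
      moreover have "fl r x \<in> M" using in_upto_fl[OF T(1), of r] r s by auto
      ultimately show False using * r(3) frontier_zero[OF fr] by auto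
    qed
    then show ?thesis using Q by (intro exI[of _ Q]) force
  qed
  then obtain Q where Q: "open Q" "y \<in> Q" "\<And>z w. z \<in> Q \<Longrightarrow> z \<in> M \<Longrightarrow> w \<in> Q \<Longrightarrow> F w \<le> F z \<Longrightarrow> w \<in> M"
    by blast
  obtain W d where W: "open W" "x \<in> W" "0 < d"
    "\<And>x' r. x' \<in> W \<Longrightarrow> 0 \<le> r \<Longrightarrow> \<bar>r - s\<bar> < d \<Longrightarrow> \<exists>z\<in>Q. R r x' z"
    using R_open_joint[OF y(1) Q(1,2)] by blast
  have "\<exists>V. open V \<and> x \<in> V \<and> (\<forall>x'\<in>V \<inter> M. in_upto x' b)"
    if ab: "0 \<le> a" "a \<le> b" "b \<le> T" "\<bar>a - s\<bar> < d" "\<bar>b - s\<bar> < d"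
      and Pa: "\<exists>W. open W \<and> x \<in> W \<and> (\<forall>x'\<in>W \<inter> M. in_upto x' a)" for a b
  proof -
    obtain V where V: "open V" "x \<in> V" "\<forall>x'\<in>V \<inter> M. in_upto x' a" using Pa by blast
    have "in_upto x' b" if x': "x' \<in> W \<inter> V" "x' \<in> M" for x'
      unfolding in_upto_def
    proof
      fix r assume r: "r \<in> {0..b}"
      have ina: "in_upto x' a" using V x' by blast
      show "\<exists>z\<in>M. R r x' z"
      proof (cases "r \<le> a")
        case True
        then show ?thesis using ina r by (auto simp: in_upto_def)
      next
        case False
        obtain z where z: "z \<in> Q" "R a x' z" using W(4)[of x' a] x' ab by blast
        obtain w where w: "w \<in> Q" "R r x' w" using W(4)[of x' r] x' ab False r by force
        have "z \<in> M" using in_upto_fl[OF ina ab(1) order_refl] z(2) by (simp add: fl_eq)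
        moreover have "R (r - a) z w"
          using R_between[OF w(2) ab(1), of r] False z w by (auto simp: fl_eq)
        ultimately have "w \<in> M" using Q(3)[OF z(1) _ w(1)] F_le by blast
        then show ?thesis using w by blast
      qed
    qed
    then show ?thesis using W V by (intro exI[of _ "W \<inter> V"]) auto
  qed
  then show "\<exists>d>0. \<forall>a b. 0 \<le> a \<and> a \<le> b \<and> b \<le> T \<and> \<bar>a - s\<bar> < d \<and> \<bar>b - s\<bar> < d \<and>
     (\<exists>W. open W \<and> x \<in> W \<and> (\<forall>x'\<in>W \<inter> M. in_upto x' a)) \<longrightarrow>
     (\<exists>W. open W \<and> x \<in> W \<and> (\<forall>x'\<in>W \<inter> M. in_upto x' b))"
    using W(3) by (intro exI[of _ d]) blast
qed

lemma stays_shift: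
  assumes "in_upto x T" "R T x z" "stays z"
  shows "stays x"
  unfolding stays_def
proof (intro allI impI)
  fix t :: real assume "0 \<le> t"
  then have "in_upto x (T + t)" using in_upto_shift[OF assms(1,2)] assms(3) by (simp add: stays_def)
  then show "in_upto x t" by (rule in_upto_mono) (use R_dom[OF assms(2)] in auto)
qed

lemma sflow_shift:
  assumes x: "stays x" and z: "R T x z"
  shows "stays z" "0 \<le> t \<Longrightarrow> sflow (T + t) x = sflow t z"
proof -
  have T: "0 \<le> T" using R_dom[OF z] by simp
  show st: "stays z" unfolding stays_def
    using x T in_upto_unshift[OF _ z] by (auto simp: stays_def)
  have "z = sflow T x" using stays_sflow[OF x T] z R_det by blast
  then show "sflow (T + t) x = sflow t z" if "0 \<le> t"
    using stays_between[OF x T, of "T + t"] stays_sflow[OF st that] that R_det by auto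
qed

lemma Ws_shift:
  assumes x: "stays x" and z: "R T x z"
  shows "x \<in> Ws y \<longleftrightarrow> z \<in> Ws y"
proof -
  have T: "0 \<le> T" using R_dom[OF z] by simp
  have M: "x \<in> M" "z \<in> M"
    using stays_sflow[OF x, of 0] stays_sflow[OF sflow_shift(1)[OF x z], of 0] R_0 R_det R_dom
    by (metis order_refl)+
  have "converges x y \<longleftrightarrow> converges z y"
  proof
    assume "converges x y"
    then have "((\<lambda>t. sflow (T + t) x) \<longlongrightarrow> y) at_top"
      by (rule filterlim_compose) (rule filterlim_tendsto_add_at_top[OF tendsto_const filterlim_ident])
    then show "converges z y"
      by (rule Lim_transform_eventually)
        (rule eventually_mono[OF eventually_ge_at_top[of 0]], rule sflow_shift(2)[OF x z])
  next
    assume "converges z y"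
    then have "((\<lambda>t. sflow (- T + t) z) \<longlongrightarrow> y) at_top"
      by (rule filterlim_compose) (rule filterlim_tendsto_add_at_top[OF tendsto_const filterlim_ident])
    moreover have "eventually (\<lambda>t. sflow (- T + t) z = sflow t x) at_top"
      using eventually_ge_at_top[of T]
      by eventually_elim (use sflow_shift(2)[OF x z, of "- T + t" for t] in force)
    ultimately show "converges x y"
      by (rule Lim_transform_eventually)
  qed
  then show ?thesis using M by (simp add: Ws_def)
qed

text \<open>At some time \<open>T\<close> the trajectory is in the interior of an invariant set
  \<open>D\<close> of basin points. Nearby trajectories starting in \<open>M\<close> are still in
  \<open>M\<close> up to \<open>T\<close> and are then in \<open>D\<close> as well.\<close>

lemma Ws_minima_open:
  assumes p: "p \<in> minima M F" and x: "x \<in> Ws p"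
  shows "\<exists>W. open W \<and> x \<in> W \<and> W \<inter> M \<subseteq> Ws p"
proof -
  obtain D where D: "D \<subseteq> interior M" "p \<in> interior D" "\<And>y. y \<in> D \<Longrightarrow> stays y \<and> y \<in> Ws p"
    using min_basin[OF p open_UNIV] by (metis UNIV_I)
  have st: "stays x" by (rule Ws_minima_stays[OF p x])
  obtain T where T: "0 \<le> T" "sflow T x \<in> interior D"
    by (rule limit_hits[of x p "interior D"]) (use x D in \<open>auto simp: Ws_def\<close>)
  have RT: "R T x (sflow T x)" "sflow T x = fl T x" using stays_sflow[OF st T(1)] by auto
  obtain W1 where W1: "open W1" "x \<in> W1" "\<forall>x'\<in>W1 \<inter> M. in_upto x' T"
    using in_upto_open[of x T] st T RT D interior_subset unfolding stays_def by force
  obtain W2 where W2: "open W2" "x \<in> W2" "\<forall>x'\<in>W2. \<exists>z\<in>interior D. R T x' z"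
    using R_open[OF RT(1) open_interior T(2)] by blast
  have "x' \<in> Ws p" if "x' \<in> W1 \<inter> W2" "x' \<in> M" for x'
  proof -
    have "x' \<in> W2" using that by simp
    then obtain z where "z \<in> interior D" and zR: "R T x' z" using W2(3) by blast
    then have z: "z \<in> D" using interior_subset by blast
    have "stays x'" using stays_shift[OF _ zR] W1(3) that D(3)[OF z] by blast
    then show ?thesis using Ws_shift[OF _ zR] D(3)[OF z] by blast
  qed
  then show ?thesis using W1 W2 by (intro exI[of _ "W1 \<inter> W2"]) auto
qed

text \<open>Soon after the exit there is a time at which the solution exists and lies outside
  \<open>M\<close>. The complement of \<open>M\<close> is open, so nearby trajectories are outside
  at that same time.\<close>

lemma exits_open:
  assumes e: "exits x s y"
  shows "\<exists>W T. open W \<and> x \<in> W \<and> 0 \<le> T \<and> (\<forall>x'\<in>W. \<not> in_upto x' T)"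
proof -
  have y: "R s x y" "in_upto x s" "\<And>t. t > s \<Longrightarrow> \<not> in_upto x t" using e by (auto simp: exits_def)
  have dom: "0 \<le> s" "y \<in> U" using R_dom[OF y(1)] by auto
  obtain \<tau> where \<tau>: "0 < \<tau>" "\<And>t. t \<in> {0..\<tau>} \<Longrightarrow> \<exists>z. R t y z"
    using R_local[OF dom(2) open_U dom(2)] by blast
  \<comment> \<open>\<open>T\<close> is taken within the existence time \<tau> after the exit, so
    that absence from \<open>M\<close> means a position outside \<open>M\<close> and not a breakdown
    of the solution.\<close>
  have "\<not> in_upto x (s + \<tau>)" using y(3) \<tau>(1) by simp
  then obtain T where "T \<in> {0..s + \<tau>}" "\<forall>z\<in>M. \<not> R T x z" unfolding in_upto_def by blast
  then have T: "0 \<le> T" "T \<le> s + \<tau>" "\<And>z. R T x z \<Longrightarrow> z \<notin> M" by auto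
  have "s < T" using y(2) T unfolding in_upto_def by force
  then obtain z where z: "R (T - s) y z" using \<tau>(2)[of "T - s"] T by auto
  then have z: "R T x z" using R_trans[OF y(1) z] by simp
  then have "z \<in> - M" using T by blast
  moreover have "open (- M)" using closed_M by (simp add: open_Compl)
  ultimately obtain W where W: "open W" "x \<in> W" "\<forall>x'\<in>W. \<exists>z\<in>- M. R T x' z"
    using R_open[OF z] by blast
  have "\<not> in_upto x' T" if "x' \<in> W" for x'
    using W(3) that in_upto_fl[of x' T T] T(1) fl_eq by fastforce
  then show ?thesis using W(1,2) T(1) by blast
qed

text \<open>\<open>F\<close> decreases along the trajectory with limit \<open>F z\<close>, so all
  its values are at least \<open>F z\<close>. Near a strict maximum only \<open>z\<close> has such a
  value, and the critical point \<open>z\<close> is reached only from itself.\<close>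

lemma Ws_max_eq:
  assumes z: "z \<in> maxima M F" and x: "x \<in> Ws z" and st: "stays x"
  shows "x = z"
proof -
  have zM: "z \<in> crit \<inter> M" by (rule Ws_stays[OF st x])
  then have zU: "z \<in> U" using M_sub by blast
  have lim: "converges x z" using x by (simp add: Ws_def)
  interpret rev: gradient_semiflow U M "\<lambda>x. - F x" "\<lambda>t x y. R t y x" crit
    by (rule reverse_gradient_semiflow)
  obtain W where W: "open W" "z \<in> W" "\<forall>y\<in>W. y \<noteq> z \<longrightarrow> F y < F z"
    using rev.strict_minimum[OF zU] z by (auto simp: maxima_def)
  have "isCont F z" using continuous_F open_U zU by (simp add: continuous_on_eq_continuous_at)
  then have limF: "((\<lambda>t. F (sflow t x)) \<longlongrightarrow> F z) at_top"
    using lim isCont_tendsto_compose by blast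
  obtain t where t: "0 \<le> t" "sflow t x \<in> W" by (rule limit_hits[OF lim W(1,2)])
  have "F z \<le> F (sflow t x)"
  proof (rule tendsto_upperbound[OF limF])
    show "eventually (\<lambda>s. F (sflow s x) \<le> F (sflow t x)) at_top"
      using eventually_ge_at_top[of t] by eventually_elim (use F_le stays_between[OF st t(1)] in blast)
  qed simp
  then have "sflow t x = z" using W t by force
  then show ?thesis using crit_eq'[of t x z] stays_sflow[OF st t(1)] zM by auto
qed

end


section \<open>The decomposition for gradient-like flows\<close>

lemma maxima_eq_minima: "maxima M F = minima M (\<lambda>x. - F x)" for F :: "'m::topological_space \<Rightarrow> real"
  by (simp add: maxima_def minima_def)

text \<open>Both components are available for every \<open>gradient_semiflow\<close>; joined, they
  let forward facts and their mirror images, under the prefix \<open>rev\<close>, be used side by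
  side.\<close>

locale gradient_flow = gradient_semiflow U M F R crit
  + rev: gradient_semiflow U M "\<lambda>x. - F x" "\<lambda>t x y. R t y x" crit
  for U M :: "'m::t2_space set" and F R crit
begin

definition saddle :: "'m set" where
  "saddle = crit \<inter> M - minima M F - maxima M F"

definition lines :: "'m set" where
  "lines = closure (\<Union>r\<in>saddle. Ws r \<union> rev.Ws r)"

text \<open>\<open>F x\<close> lies between the zero values at the two exit points, so both exit
  times are 0 and \<open>x\<close> is a noncritical frontier point. There \<open>M\<close> is one
  side of the zero set of \<open>F\<close>: if it is the nonnegative side, the backward trajectory
  remains in \<open>M\<close> for a while, otherwise the forward one does.\<close>

lemma exits_not_both:
  assumes e: "exits x s y" and e': "rev.exits x s' y'"
  shows False
proof -
  have R: "R s x y" "R s' y' x" and y: "y \<in> frontier M" "y' \<in> frontier M" "y \<notin> crit" "y' \<notin> crit"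
    using e e' by (auto simp: exits_def rev.exits_def)
  have F0: "F y = 0" "F y' = 0" using y frontier_zero by auto
  have Fx: "F x = 0" using F_le[OF R(1)] F_le[OF R(2)] F0 by simp
  have "s = 0" using F_less[OF R(1)] exits_not_crit[OF e] F0 Fx R_dom[OF R(1)] by force
  moreover have "s' = 0" using F_less[OF R(2)] y F0 Fx R_dom[OF R(2)] by force
  moreover have xU: "x \<in> U" using R_dom[OF R(1)] by simp
  ultimately have "x = y" using R(1) R_0 R_det by blast
  then obtain Q where Q: "open Q" "x \<in> Q" "(\<forall>z\<in>Q. z \<in> M \<longleftrightarrow> 0 \<le> F z) \<or> (\<forall>z\<in>Q. z \<in> M \<longleftrightarrow> F z \<le> 0)"
    using one_sided y by blast
  from Q(3) show False
  proof
    assume *: "\<forall>z\<in>Q. z \<in> M \<longleftrightarrow> 0 \<le> F z"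
    obtain \<tau> where \<tau>: "0 < \<tau>" "\<And>t. t \<in> {0..\<tau>} \<Longrightarrow> \<exists>z\<in>Q. R t z x"
      using R_local_rev[OF xU Q(1,2)] Q(2) by blast
    have "rev.in_upto x \<tau>" unfolding rev.in_upto_def
    proof
      fix t assume "t \<in> {0..\<tau>}"
      then obtain z where "z \<in> Q" "R t z x" using \<tau>(2) by blast
      then show "\<exists>z\<in>M. R t z x" using * F_le[of t z x] Fx by force
    qed
    then show False using e' \<open>s' = 0\<close> \<tau>(1) by (auto simp: rev.exits_def)
  next
    assume *: "\<forall>z\<in>Q. z \<in> M \<longleftrightarrow> F z \<le> 0"
    obtain \<tau> where \<tau>: "0 < \<tau>" "\<And>t. t \<in> {0..\<tau>} \<Longrightarrow> \<exists>z\<in>Q. R t x z"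
      using R_local[OF xU Q(1,2)] Q(2) by blast
    have "in_upto x \<tau>" unfolding in_upto_def
    proof
      fix t assume "t \<in> {0..\<tau>}"
      then obtain z where "z \<in> Q" "R t x z" using \<tau>(2) by blast
      then show "\<exists>z\<in>M. R t x z" using * F_le[of t x z] Fx by force
    qed
    then show False using e \<open>s = 0\<close> \<tau>(1) by (auto simp: exits_def)
  qed
qed

lemma in_upto_rev:
  assumes "rev.in_upto z t" "R t k z"
  shows "in_upto k t"
  unfolding in_upto_def
proof
  fix s assume s: "s \<in> {0..t}"
  then obtain y where y: "R s k y" "R (t - s) y z" using R_split[of s "t - s" k z] assms(2) by auto
  obtain m where "m \<in> M" "R (t - s) m z" using assms(1) s unfolding rev.in_upto_def by force
  then show "\<exists>z\<in>M. R s k z" using y R_inj by blast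
qed

lemma saddle_lines: "r \<in> saddle \<Longrightarrow> Ws r \<union> rev.Ws r \<subseteq> lines"
  unfolding lines_def using closure_subset by fast

lemma crit_cases: "z \<in> crit \<inter> M \<Longrightarrow> z \<in> saddle \<or> z \<in> minima M F \<or> z \<in> maxima M F"
  by (auto simp: saddle_def)

lemma maxima_interior: "q \<in> maxima M F \<Longrightarrow> q \<in> interior M"
  using rev.minima_interior[of q] by (simp add: maxima_eq_minima)

section \<open>Extrema lie on the Neumann lines\<close>

text \<open>The trajectory of \<open>k\<close> leaves \<open>M\<close> or tends to a minimum
  \<open>c\<close>, which differs from \<open>x\<close>. From a common time on, trajectories
  starting near \<open>k\<close> have left \<open>M\<close> in the first case, where
  \<open>E\<close> is empty; in the second case they are confined to an invariant neighbourhood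
  \<open>E\<close> of \<open>c\<close> that misses \<open>x\<close>.\<close>

lemma uniform_capture:
  assumes k: "k \<in> M" "k \<notin> lines" "\<And>z. z \<in> maxima M F \<Longrightarrow> k \<noteq> z" and x: "x \<notin> minima M F"
  shows "\<exists>O' T E. open O' \<and> k \<in> O' \<and> 0 \<le> T \<and> closed E \<and> x \<notin> E \<and>
    (\<forall>k'\<in>O'. \<forall>s\<ge>T. \<forall>z. in_upto k' s \<and> R s k' z \<longrightarrow> z \<in> E)"
proof (cases "stays k")
  case False
  then obtain s y where e: "exits k s y" using stays_or_exits[OF k(1)] by blast
  obtain W T where W: "open W" "k \<in> W" "0 \<le> T" "\<forall>x'\<in>W. \<not> in_upto x' T" using exits_open[OF e] by blast
  then have "\<forall>k'\<in>W. \<forall>s\<ge>T. \<forall>z. in_upto k' s \<and> R s k' z \<longrightarrow> z \<in> {}"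
    using in_upto_mono by blast
  then show ?thesis using W(1-3) by (intro exI[of _ W] exI[of _ T] exI[of _ "{}"]) simp
next
  case True
  then obtain c where c: "c \<in> crit \<inter> M" "k \<in> Ws c"
    using stays_limit k(1) unfolding Ws_def by blast
  have "c \<notin> saddle" using saddle_lines[of c] c(2) k(2) by blast
  moreover have "c \<notin> maxima M F" using Ws_max_eq[OF _ c(2) True] k(3) by blast
  ultimately have cm: "c \<in> minima M F" using crit_cases c by blast
  have "open (- {x})" "c \<in> - {x}" using x cm by (auto simp: open_Compl)
  then obtain E where E: "compact E" "E \<subseteq> - {x}" "c \<in> interior E"
      "\<And>y. y \<in> E \<Longrightarrow> stays y \<and> (\<forall>t\<ge>0. sflow t y \<in> E)"
    using min_basin[OF cm] by metis
  obtain T where T: "0 \<le> T" "sflow T k \<in> interior E"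
    by (rule limit_hits[of k c "interior E"]) (use c E in \<open>auto simp: Ws_def\<close>)
  obtain W where W: "open W" "k \<in> W" "\<forall>k'\<in>W. \<exists>w\<in>interior E. R T k' w"
    using R_open[of T k "sflow T k" "interior E"] stays_sflow[OF True T(1)] T(2) by blast
  have "z \<in> E" if z: "k' \<in> W" "s \<ge> T" "R s k' z" for k' s z
  proof -
    obtain w where w: "w \<in> E" "R T k' w" using W(3) z(1) interior_subset by blast
    have "R (s - T) w z" using R_between[OF z(3) T(1) z(2)] w(2) z(3) by (simp add: fl_eq)
    then have "sflow (s - T) w = z" using stays_sflow[of w "s - T"] E(4)[OF w(1)] z(2) R_det by auto
    then show ?thesis using E(4)[OF w(1)] z(2) by force
  qed
  then show ?thesis using W(1,2) T(1) E(2) compact_imp_closed[OF E(1)]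
    by (intro exI[of _ W] exI[of _ T] exI[of _ E]) auto
qed

text \<open>Points of the unstable set of \<open>q\<close> outside \<open>D\<close> have come
  through the compact gate \<open>K\<close>. A time \<open>Tm\<close> after the gate, uniformly on
  \<open>K\<close>, trajectories have left \<open>M\<close> or are in a closed set \<open>Em\<close>
  without \<open>x\<close>. So points of the unstable set near \<open>x\<close> were in
  \<open>D\<close> a time \<open>Tm\<close> ago, and as \<open>D\<close> is closed the same holds
  for \<open>x\<close>.\<close>

lemma closure_unstable:
  assumes q: "q \<in> maxima M F" "q \<notin> lines"
    and x: "x \<in> closure (rev.Ws q)" "x \<in> M" "x \<notin> minima M F"
  shows "x \<in> rev.Ws q"
proof (rule ccontr)
  assume nx: "x \<notin> rev.Ws q"
  have q': "q \<in> minima M (\<lambda>x. - F x)" using q(1) by (simp add: maxima_eq_minima)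
  \<comment> \<open>With \<open>D\<close> disjoint from \<open>lines\<close>, no trajectory starting
    in the gate \<open>K\<close> tends to a saddle.\<close>
  have "open (- lines)" "q \<in> - lines" using q by (auto simp: lines_def)
  then obtain D K where D: "compact D" "D \<subseteq> - lines" "D \<subseteq> interior M" "compact K" "K \<subseteq> D - {q}"
    "\<And>y. y \<in> D \<Longrightarrow> rev.stays y \<and> y \<in> rev.Ws q \<and> (\<forall>t\<ge>0. rev.sflow t y \<in> D)"
    "\<And>x. x \<in> rev.Ws q \<Longrightarrow> x \<notin> D \<Longrightarrow> \<exists>t\<ge>0. rev.sflow t x \<in> K"
    by (rule rev.min_basin[OF q']) blast
  have xD: "x \<notin> D" using D(6) nx by blast
  have "\<exists>O' T E. open O' \<and> k \<in> O' \<and> 0 \<le> T \<and> closed E \<and> x \<notin> E \<and>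
    (\<forall>k'\<in>O'. \<forall>s\<ge>T. \<forall>z. in_upto k' s \<and> R s k' z \<longrightarrow> z \<in> E)" if k: "k \<in> K" for k
  proof (rule uniform_capture[OF _ _ _ x(3)])
    show "k \<in> M" "k \<notin> lines" using k D interior_subset by blast+
    \<comment> \<open>The only critical point in the unstable set of \<open>q\<close> is
      \<open>q\<close>, which \<open>K\<close> omits.\<close>
    show "k \<noteq> z" if "z \<in> maxima M F" for z
      using rev.crit_Ws[of k q] rev.minima_crit[of z] that D(5,6) k by (auto simp: maxima_eq_minima)
  qed
  then obtain O' T E where *: "\<And>k. k \<in> K \<Longrightarrow> open (O' k) \<and> k \<in> O' k \<and> (0::real) \<le> T k \<and> closed (E k) \<and> x \<notin> E k \<and>
    (\<forall>k'\<in>O' k. \<forall>s\<ge>T k. \<forall>z. in_upto k' s \<and> R s k' z \<longrightarrow> z \<in> E k)" by metis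
  obtain C where C: "C \<subseteq> K" "finite C" "K \<subseteq> (\<Union>c\<in>C. O' c)"
    using compactE_image[OF D(4), of K O'] * by blast
  define Tm where "Tm = Max (insert 0 (T ` C))"
  have Tm: "0 \<le> Tm" "\<And>c. c \<in> C \<Longrightarrow> T c \<le> Tm" using C(2) by (auto simp: Tm_def)
  define Em where "Em = (\<Union>c\<in>C. E c)"
  have Em: "closed Em" "x \<notin> Em" using C * by (auto simp: Em_def intro!: closed_UN)
  have reach: "z \<in> Em" if z: "k \<in> K" "s \<ge> Tm" "in_upto k s" "R s k z" for k s z
  proof -
    obtain c where c: "c \<in> C" "k \<in> O' c" using C(3) z(1) by blast
    then have "c \<in> K" "s \<ge> T c" using C Tm z(2) by force+
    then show ?thesis using *[of c] c z unfolding Em_def by blast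
  qed
  \<comment> \<open>Leaving \<open>M\<close> backwards is an open condition, and no point of the
    unstable set of \<open>q\<close> does so.\<close>
  have st: "rev.stays x"
  proof (rule ccontr)
    assume "\<not> rev.stays x"
    then obtain s y where e: "rev.exits x s y" using rev.stays_or_exits[OF x(2)] by blast
    obtain W T where W: "open W" "x \<in> W" "0 \<le> T" "\<forall>x'\<in>W. \<not> rev.in_upto x' T"
      using rev.exits_open[OF e] by blast
    obtain z where "z \<in> W" "z \<in> rev.Ws q" using x(1) W(1,2) unfolding closure_iff_nhds_not_empty by blast
    then show False using rev.Ws_minima_stays[OF q'] W unfolding rev.stays_def by blast
  qed
  define w where "w = rev.sflow Tm x"
  have w: "R Tm w x" using rev.stays_sflow[OF st Tm(1)] unfolding w_def by blast
  have "w \<in> D"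
  proof (rule ccontr)
    assume "w \<notin> D"
    then obtain W where W: "open W" "x \<in> W" "\<forall>x'\<in>W. \<exists>z\<in>- D. R Tm z x'"
      using rev.R_open[OF w, of "- D"] compact_imp_closed[OF D(1)] by (auto simp: open_Compl)
    have "open (W \<inter> - D \<inter> - Em)" "x \<in> W \<inter> - D \<inter> - Em"
      using W xD Em compact_imp_closed[OF D(1)] by (auto simp: open_Compl intro!: open_Int)
    then obtain z where z: "z \<in> W" "z \<notin> D" "z \<notin> Em" "z \<in> rev.Ws q"
      using x(1) unfolding closure_iff_nhds_not_empty by blast
    have stz: "rev.stays z" by (rule rev.Ws_minima_stays[OF q' z(4)])
    obtain t where t: "t \<ge> 0" "rev.sflow t z \<in> K" using D(7) z by blast
    have Rt: "R t (rev.sflow t z) z" using rev.stays_sflow[OF stz t(1)] by blast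
    have "in_upto (rev.sflow t z) t" using in_upto_rev[OF _ Rt] stz t(1) by (simp add: rev.stays_def)
    \<comment> \<open>As \<open>z\<close> avoids \<open>Em\<close>, it passed the gate less than
      \<open>Tm\<close> ago; beyond the gate its backward trajectory remains in
      \<open>D\<close>.\<close>
    then have "t < Tm" using reach[OF t(2) _ _ Rt] z(3) by force
    then have "rev.sflow Tm z = rev.sflow (Tm - t) (rev.sflow t z)"
      using rev.sflow_shift(2)[OF stz Rt, of "Tm - t"] by simp
    then have "rev.sflow Tm z \<in> D" using D(5) D(6)[of "rev.sflow t z"] t(2) \<open>t < Tm\<close> by auto
    moreover obtain z' where "z' \<in> - D" "R Tm z' z" using W(3) z(1) by blast
    moreover have "R Tm (rev.sflow Tm z) z" using rev.stays_sflow[OF stz Tm(1)] by blast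
    ultimately show False using R_inj by blast
  qed
  then show False using D(6) rev.Ws_shift[OF st w] nx by blast
qed

lemma maxima_lines:
  assumes ne: "saddle \<noteq> {}" and q: "q \<in> maxima M F"
  shows "q \<in> lines"
proof (rule ccontr)
  assume nq: "q \<notin> lines"
  have q': "q \<in> minima M (\<lambda>x. - F x)" using q by (simp add: maxima_eq_minima)
  let ?T = "rev.Ws q"
  have qT: "q \<in> ?T" using rev.min_basin[OF q' open_UNIV] interior_subset by (metis UNIV_I subsetD)
  have CM: "closure ?T \<subseteq> M"
    by (rule closure_minimal[OF _ closed_M]) (auto simp: rev.Ws_def)
  have op: "\<exists>W. open W \<and> x \<in> W \<and> W \<inter> M \<subseteq> closure ?T" if x: "x \<in> closure ?T" for x
  proof (cases "x \<in> ?T")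
    case True
    then obtain W where "open W" "x \<in> W" "W \<inter> M \<subseteq> ?T" using rev.Ws_minima_open[OF q'] by blast
    then show ?thesis using closure_subset[of ?T] by (intro exI[of _ W]) auto
  next
    case False
    have xM: "x \<in> M" using x CM by blast
    then have xm: "x \<in> minima M F" using closure_unstable[OF q nq x] False by blast
    have xi: "x \<in> interior M" by (rule minima_interior[OF xm])
    have xU: "x \<in> U" using xM M_sub by blast
    obtain V where V: "open V" "x \<in> V" "V \<inter> crit \<subseteq> {x}" using crit_isolated[OF xU] by blast
    obtain W where W: "open W" "x \<in> W" "closure W \<subseteq> V \<inter> interior M" "connected (W - {x})"
      using nbhd_base[OF xU, of "V \<inter> interior M"] V xi by auto
    have WV: "W \<subseteq> V" "W \<subseteq> interior M" using W(3) closure_subset by blast+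
    \<comment> \<open>Inside the punctured disc the unstable set is open, and it is relatively
      closed because the disc contains no minimum besides \<open>x\<close>. Connectedness leaves no
      frontier point for it.\<close>
    have "W - {x} \<subseteq> ?T"
    proof (rule ccontr)
      assume "\<not> W - {x} \<subseteq> ?T"
      moreover obtain z where "z \<in> W" "z \<in> ?T" using x W(1,2) unfolding closure_iff_nhds_not_empty by blast
      ultimately obtain y where y: "y \<in> W" "y \<noteq> x" "y \<in> frontier ?T"
        using connected_Int_frontier[OF W(4), of ?T] False by blast
      have "y \<in> M" "y \<notin> minima M F"
        using y WV V minima_crit[of y] interior_subset by blast+
      then have "y \<in> ?T" using closure_unstable[OF q nq] y(3) by (auto simp: frontier_def)
      then obtain Z where Z: "open Z" "y \<in> Z" "Z \<inter> M \<subseteq> ?T" using rev.Ws_minima_open[OF q'] by blast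
      have "y \<in> Z \<inter> interior M" "open (Z \<inter> interior M)" "Z \<inter> interior M \<subseteq> ?T"
        using Z y WV interior_subset[of M] by auto
      then have "y \<in> interior ?T" by (meson interiorI)
      then show False using y(3) by (simp add: frontier_def)
    qed
    then show ?thesis using W(1,2) x closure_subset[of ?T] by (intro exI[of _ W]) auto
  qed
  define Z where "Z = \<Union>{W. open W \<and> W \<inter> M \<subseteq> closure ?T}"
  have "open Z" by (auto simp: Z_def)
  moreover have "closure ?T = M \<inter> Z"
  proof
    show "closure ?T \<subseteq> M \<inter> Z"
    proof
      fix x assume x: "x \<in> closure ?T"
      then obtain W where "open W" "x \<in> W" "W \<inter> M \<subseteq> closure ?T" using op by metis
      then show "x \<in> M \<inter> Z" using x CM by (auto simp: Z_def)
    qed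
  qed (auto simp: Z_def)
  ultimately have "openin (top_of_set M) (closure ?T)" by (auto simp: openin_open)
  moreover have "closedin (top_of_set M) (closure ?T)" using CM by (simp add: closed_subset)
  ultimately have "closure ?T = M"
    using connected_M qT closure_subset unfolding connected_clopen by blast
  obtain r where r: "r \<in> saddle" using ne by blast
  \<comment> \<open>A saddle is not a minimum, so it would lie in the unstable set itself; being at
    rest it would have to be \<open>q\<close>.\<close>
  then have "r \<in> ?T"
    using closure_unstable[OF q nq, of r] \<open>closure ?T = M\<close> by (auto simp: saddle_def)
  then have "q = r" using rev.crit_Ws r by (auto simp: saddle_def)
  then show False using r q by (auto simp: saddle_def)
qed

section \<open>Assembling the partition\<close>

text \<open>A trajectory staying in \<open>M\<close> has a critical limit, and a critical frontier
  point is a saddle because extrema are interior. So a limit of the present kind is an actual exit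
  point.\<close>

lemma frontier_Ws_exits:
  assumes "x \<in> Ws y" "y \<in> frontier M - saddle"
  shows "\<exists>s. exits x s y"
proof -
  have xM: "x \<in> M" using assms by (simp add: Ws_def)
  have "\<not> stays x"
    using Ws_stays[OF _ assms(1)] crit_cases minima_interior maxima_interior frontier_interior assms(2) by blast
  then obtain s z where e: "exits x s z" using stays_or_exits[OF xM] by blast
  moreover have "z = y" using limit_unique[OF exits_limit[OF e]] assms(1) by (auto simp: Ws_def)
  ultimately show ?thesis by blast
qed

lemma exits_Ws: "exits x s y \<Longrightarrow> x \<in> M \<Longrightarrow> x \<in> Ws y \<and> y \<in> frontier M - saddle"
  using exits_limit by (auto simp: Ws_def exits_def saddle_def)

text \<open>The limit of a trajectory that stays is no saddle, and it is a maximum only for the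
  constant trajectory; maxima belong to \<open>lines\<close>.\<close>

lemma forward_cases:
  assumes "saddle \<noteq> {}" and x: "x \<in> M" "x \<notin> lines"
  shows "(\<exists>p\<in>minima M F. x \<in> Ws p) \<or> (\<exists>y\<in>frontier M - saddle. x \<in> Ws y)"
proof (cases "stays x")
  case True
  then obtain z where z: "z \<in> crit \<inter> M" "x \<in> Ws z"
    using stays_limit x(1) unfolding Ws_def by blast
  have "z \<notin> saddle" using saddle_lines[of z] z x by blast
  moreover have "z \<notin> maxima M F" using Ws_max_eq[OF _ z(2) True] maxima_lines[OF assms(1)] x by blast
  ultimately show ?thesis using crit_cases z by blast
next
  case False
  then show ?thesis using stays_or_exits[OF x(1)] exits_Ws[OF _ x(1)] by blast
qed

text \<open>Tending to a minimum and leaving \<open>M\<close> are open conditions that each exclude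
  a saddle as limit. This keeps \<open>x\<close> away from the closure taken in
  \<open>lines\<close>, which a pointwise statement would not do.\<close>

lemma forward_open:
  assumes "(\<exists>p\<in>minima M F. x \<in> Ws p) \<or> (\<exists>y\<in>frontier M - saddle. x \<in> Ws y)"
  shows "\<exists>W. open W \<and> x \<in> W \<and> (\<forall>x'\<in>W \<inter> M. \<forall>r\<in>saddle. x' \<notin> Ws r)"
  using assms
proof
  assume "\<exists>p\<in>minima M F. x \<in> Ws p"
  then obtain p where p: "p \<in> minima M F" "x \<in> Ws p" by blast
  obtain W where W: "open W" "x \<in> W" "W \<inter> M \<subseteq> Ws p" using Ws_minima_open[OF p] by blast
  have "x' \<notin> Ws r" if "x' \<in> W \<inter> M" "r \<in> saddle" for x' r
    using W that p limit_unique[of x' p r] by (auto simp: Ws_def saddle_def)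
  then show ?thesis using W by blast
next
  assume "\<exists>y\<in>frontier M - saddle. x \<in> Ws y"
  then obtain y s where e: "exits x s y" using frontier_Ws_exits by blast
  obtain W T where W: "open W" "x \<in> W" "0 \<le> T" "\<forall>x'\<in>W. \<not> in_upto x' T" using exits_open[OF e] by blast
  have "x' \<notin> Ws r" if x': "x' \<in> W \<inter> M" "r \<in> saddle" for x' r
  proof -
    have "\<not> stays x'" using W x' by (auto simp: stays_def)
    then obtain s z where "exits x' s z" using stays_or_exits[of x'] x' by blast
    then show ?thesis using Ws_exits x' by (auto simp: saddle_def)
  qed
  then show ?thesis using W by blast
qed

end

lemma (in gradient_semiflow) gradient_flow: "gradient_flow U M F R crit"
  by (intro gradient_flow.intro gradient_semiflow_axioms reverse_gradient_semiflow)

lemma (in gradient_flow) reverse_gradient_flow: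
  "gradient_flow U M (\<lambda>x. - F x) (\<lambda>t x y. R t y x) crit"
  by (rule rev.gradient_flow)

context gradient_flow begin

text \<open>Each time direction offers two alternatives, an extremum or an exit. Of the four
  combinations the double exit is impossible; the other three are \<open>O1\<close>,
  \<open>O2\<close> and \<open>O3\<close>.\<close>

lemma decomposition:
  assumes ne: "lines \<noteq> {}"
  defines "O1 \<equiv> \<Union>(p, q)\<in>minima M F \<times> maxima M F. Ws p \<inter> rev.Ws q"
    and "O2 \<equiv> \<Union>p\<in>minima M F. Ws p \<inter> (\<Union>y\<in>frontier M - saddle. rev.Ws y)"
    and "O3 \<equiv> \<Union>q\<in>maxima M F. (\<Union>y\<in>frontier M - saddle. Ws y) \<inter> rev.Ws q"
  shows "M = O1 \<union> O2 \<union> O3 \<union> lines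
    \<and> disjoint_family_on (\<lambda>(p, q). Ws p \<inter> rev.Ws q) (minima M F \<times> maxima M F)
    \<and> disjoint_family_on (\<lambda>p. Ws p \<inter> (\<Union>y\<in>frontier M - saddle. rev.Ws y)) (minima M F)
    \<and> disjoint_family_on (\<lambda>q. (\<Union>y\<in>frontier M - saddle. Ws y) \<inter> rev.Ws q) (maxima M F)
    \<and> O1 \<inter> O2 = {} \<and> O1 \<inter> O3 = {} \<and> O2 \<inter> O3 = {} \<and> (O1 \<union> O2 \<union> O3) \<inter> lines = {}"
proof -
  \<comment> \<open>The prefix \<open>rev\<close> mirrors the results of
    \<open>gradient_semiflow\<close>; those proved in \<open>gradient_flow\<close> itself need this
    further interpretation.\<close>
  interpret r: gradient_flow U M "\<lambda>x. - F x" "\<lambda>t x y. R t y x" crit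
    by (rule reverse_gradient_flow)
  have eq: "maxima M (\<lambda>x. - F x) = minima M F" "minima M (\<lambda>x. - F x) = maxima M F"
    by (simp_all add: maxima_eq_minima)
  have saddle: "r.saddle = saddle" unfolding r.saddle_def saddle_def eq by blast
  have lines: "r.lines = lines" unfolding r.lines_def lines_def saddle by (simp add: Un_commute)
  have ne': "saddle \<noteq> {}" using ne by (auto simp: lines_def)
  have sub: "Ws y \<subseteq> M" "rev.Ws y \<subseteq> M" for y by (auto simp: Ws_def rev.Ws_def)
  have lM: "lines \<subseteq> M" unfolding lines_def
    by (rule closure_minimal[OF _ closed_M]) (use sub in blast)
  have uniq: "y = z" if "x \<in> Ws y" "x \<in> Ws z" for x y z
    using that limit_unique by (auto simp: Ws_def)
  have uniq': "y = z" if "x \<in> rev.Ws y" "x \<in> rev.Ws z" for x y z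
    using that rev.limit_unique by (auto simp: rev.Ws_def)
  have fr: "p \<notin> frontier M" if "p \<in> minima M F \<or> p \<in> maxima M F" for p
    using that minima_interior maxima_interior frontier_interior by blast
  have nb: False if "y \<in> frontier M - saddle" "x \<in> Ws y" "y' \<in> frontier M - saddle" "x \<in> rev.Ws y'" for x y y'
    using frontier_Ws_exits[OF that(2,1)] r.frontier_Ws_exits[OF that(4)] that(3) exits_not_both
    unfolding saddle by blast
  have cover: "x \<in> O1 \<union> O2 \<union> O3 \<union> lines" if x: "x \<in> M" for x
  proof (cases "x \<in> lines")
    case False
    have a: "(\<exists>p\<in>minima M F. x \<in> Ws p) \<or> (\<exists>y\<in>frontier M - saddle. x \<in> Ws y)"
      by (rule forward_cases[OF ne' x False])
    have b: "(\<exists>p\<in>maxima M F. x \<in> rev.Ws p) \<or> (\<exists>y\<in>frontier M - saddle. x \<in> rev.Ws y)"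
      using r.forward_cases[of x] ne' x False unfolding saddle lines eq by blast
    from a show ?thesis
    proof
      assume "\<exists>p\<in>minima M F. x \<in> Ws p"
      then show ?thesis using b unfolding O1_def O2_def by auto
    next
      assume y: "\<exists>y\<in>frontier M - saddle. x \<in> Ws y"
      then have "\<exists>p\<in>maxima M F. x \<in> rev.Ws p" using b nb by metis
      then show ?thesis using y unfolding O3_def by auto
    qed
  qed simp
  have away: "x \<notin> lines" if x: "x \<in> O1 \<union> O2 \<union> O3" for x
  proof
    assume xl: "x \<in> lines"
    have a: "(\<exists>p\<in>minima M F. x \<in> Ws p) \<or> (\<exists>y\<in>frontier M - saddle. x \<in> Ws y)"
      and b: "(\<exists>p\<in>maxima M F. x \<in> rev.Ws p) \<or> (\<exists>y\<in>frontier M - saddle. x \<in> rev.Ws y)"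
      using x unfolding O1_def O2_def O3_def by blast+
    obtain W where W: "open W" "x \<in> W" "\<forall>x'\<in>W \<inter> M. \<forall>r\<in>saddle. x' \<notin> Ws r"
      using forward_open[OF a] by blast
    obtain W' where W': "open W'" "x \<in> W'" "\<forall>x'\<in>W' \<inter> M. \<forall>r\<in>saddle. x' \<notin> rev.Ws r"
      using r.forward_open[of x] b unfolding eq saddle by blast
    have "open (W \<inter> W')" "x \<in> W \<inter> W'" using W W' by auto
    then have "(\<Union>r\<in>saddle. Ws r \<union> rev.Ws r) \<inter> (W \<inter> W') \<noteq> {}"
      using xl unfolding lines_def closure_iff_nhds_not_empty by blast
    then obtain z r where "z \<in> W" "z \<in> W'" "r \<in> saddle" "z \<in> Ws r \<or> z \<in> rev.Ws r" by auto
    then show False using W(3) W'(3) sub by (metis IntI subsetD)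
  qed
  have "O1 \<subseteq> M" "O2 \<subseteq> M" "O3 \<subseteq> M" using sub unfolding O1_def O2_def O3_def by fast+
  then have "M = O1 \<union> O2 \<union> O3 \<union> lines" using cover lM by blast
  moreover have "disjoint_family_on (\<lambda>(p, q). Ws p \<inter> rev.Ws q) (minima M F \<times> maxima M F)"
    unfolding disjoint_family_on_def using uniq uniq' by force
  moreover have "disjoint_family_on (\<lambda>p. Ws p \<inter> (\<Union>y\<in>frontier M - saddle. rev.Ws y)) (minima M F)"
    unfolding disjoint_family_on_def using uniq by blast
  moreover have "disjoint_family_on (\<lambda>q. (\<Union>y\<in>frontier M - saddle. Ws y) \<inter> rev.Ws q) (maxima M F)"
    unfolding disjoint_family_on_def using uniq' by blast
  moreover have "O1 \<inter> O2 = {}" "O1 \<inter> O3 = {}" "O2 \<inter> O3 = {}"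
    unfolding O1_def O2_def O3_def using uniq uniq' fr by blast+
  moreover have "(O1 \<union> O2 \<union> O3) \<inter> lines = {}" using away by blast
  ultimately show ?thesis by blast
qed

end


section \<open>Local solutions of ordinary differential equations\<close>

text \<open>Picard iteration for a bounded, globally Lipschitz field. Clamping time to [0, \<tau>]
  by \<open>c\<close> lets the integral operator act on bounded continuous functions on the whole
  line, a complete space, where it contracts with factor \<open>L * \<tau>\<close>.\<close>

lemma picard_local_solution:
  fixes Y :: "'a::euclidean_space \<Rightarrow> 'a"
  assumes lip: "L-lipschitz_on UNIV Y" and bound: "\<And>x. norm (Y x) \<le> B"
    and \<tau>: "0 \<le> \<tau>" "L * \<tau> < 1"
  shows "\<exists>u. u 0 = y \<and> (\<forall>t\<in>{0..\<tau>}. norm (u t - y) \<le> B * t \<and>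
    (u has_vector_derivative Y (u t)) (at t within {0..\<tau>}))"
proof -
  define c where "c t = max 0 (min t \<tau>)" for t :: real
  have c: "0 \<le> c t" "c t \<le> \<tau>" for t using \<tau> by (auto simp: c_def)
  have c_id: "c t = t" if "t \<in> {0..\<tau>}" for t using that by (auto simp: c_def)
  have contY: "continuous_on S Y" for S
    using lipschitz_on_continuous_on[OF lip] continuous_on_subset by blast
  have cv: "continuous_on S (\<lambda>s. Y (apply_bcontfun v s))" for S :: "real set" and v :: "real \<Rightarrow>\<^sub>C 'a"
    by (rule continuous_on_compose2[OF contY[of UNIV]]) auto
  have B0: "0 \<le> B" using bound[of 0] norm_ge_zero order_trans by blast
  define I where "I v t = integral {0..c t} (\<lambda>s. Y (apply_bcontfun v s))" for v :: "real \<Rightarrow>\<^sub>C 'a" and t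
  have intg: "(\<lambda>s. Y (apply_bcontfun v s)) integrable_on {a..b}" for v :: "real \<Rightarrow>\<^sub>C 'a" and a b
    by (rule integrable_continuous_real[OF cv])
  have I_bound: "norm (I v t) \<le> B * c t" for v t
    using integral_bound[OF c(1) cv[of "{0..c t}" v], of B] bound c unfolding I_def by simp
  have I_cont: "continuous_on UNIV (I v)" for v
  proof -
    have "continuous_on {0..\<tau>} (\<lambda>x. integral {0..x} (\<lambda>s. Y (apply_bcontfun v s)))"
      by (rule indefinite_integral_continuous_1[OF intg])
    moreover have "continuous_on UNIV c" unfolding c_def by (intro continuous_intros)
    ultimately show ?thesis unfolding I_def
      by (rule continuous_on_compose2) (use c in auto)
  qed
  have bc: "(\<lambda>t. y + I v t) \<in> bcontfun" for v
  proof (rule bcontfun_normI)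
    show "continuous_on UNIV (\<lambda>t. y + I v t)" by (intro continuous_intros I_cont)
    show "norm (y + I v t) \<le> norm y + B * \<tau>" for t
      using norm_triangle_ineq[of y "I v t"] I_bound[of v t] mult_left_mono[OF c(2) B0, of t] by linarith
  qed
  define T where "T v = Bcontfun (\<lambda>t. y + I v t)" for v
  have T: "apply_bcontfun (T v) t = y + I v t" for v t
    unfolding T_def using bc by (simp add: Bcontfun_inverse)
  have L0: "0 \<le> L" by (rule lipschitz_on_nonneg[OF lip])
  have "dist (T v) (T w) \<le> (L * \<tau>) * dist v w" for v w
  proof (rule dist_bound)
    fix t
    have "I v t - I w t = integral {0..c t} (\<lambda>s. Y (apply_bcontfun v s) - Y (apply_bcontfun w s))"
      unfolding I_def by (rule integral_diff[symmetric]) (rule intg)+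
    also have "norm \<dots> \<le> (L * dist v w) * (c t - 0)"
    proof (rule integral_bound[OF c(1)])
      show "continuous_on {0..c t} (\<lambda>s. Y (apply_bcontfun v s) - Y (apply_bcontfun w s))"
        by (intro continuous_intros cv)
      show "norm (Y (apply_bcontfun v s) - Y (apply_bcontfun w s)) \<le> L * dist v w" for s
        using lipschitz_onD[OF lip, of "apply_bcontfun v s" "apply_bcontfun w s"]
          mult_left_mono[OF dist_bounded[where f = v and g = w and x = s] L0] by (simp add: dist_norm)
    qed
    also have "\<dots> \<le> (L * dist v w) * \<tau>"
      using c[of t] L0 by (intro mult_left_mono) auto
    finally show "dist (apply_bcontfun (T v) t) (apply_bcontfun (T w) t) \<le> L * \<tau> * dist v w"
      by (simp add: T dist_norm mult_ac)
  qed
  then obtain v where v: "T v = v"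
    using banach_fix_type[of "L * \<tau>" T] L0 \<tau> by auto
  have eq: "apply_bcontfun v t = y + I v t" for t using T[of v t] v by simp
  have "(apply_bcontfun v has_vector_derivative Y (apply_bcontfun v t)) (at t within {0..\<tau>})"
    if t: "t \<in> {0..\<tau>}" for t
  proof -
    have "((\<lambda>x. y + integral {0..x} (\<lambda>s. Y (apply_bcontfun v s))) has_vector_derivative
        0 + Y (apply_bcontfun v t)) (at t within {0..\<tau>})"
      by (intro has_vector_derivative_add has_vector_derivative_const integral_has_vector_derivative[OF cv t])
    then have *: "((\<lambda>x. y + integral {0..x} (\<lambda>s. Y (apply_bcontfun v s))) has_vector_derivative
        Y (apply_bcontfun v t)) (at t within {0..\<tau>})" by simp
    have "apply_bcontfun v x = y + integral {0..x} (\<lambda>s. Y (apply_bcontfun v s))" if "x \<in> {0..\<tau>}" for x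
      using eq[of x] unfolding I_def c_id[OF that] .
    from this * show ?thesis by (rule has_vector_derivative_transform[OF t])
  qed
  moreover have "apply_bcontfun v 0 = y" using eq[of 0] c_id[of 0] \<tau> by (simp add: I_def)
  moreover have "norm (apply_bcontfun v t - y) \<le> B * t" if "t \<in> {0..\<tau>}" for t
    using eq[of t] I_bound[of v t] c_id[OF that] by simp
  ultimately show ?thesis by blast
qed

text \<open>Gronwall's estimate: the squared distance times \<open>exp (- (2 * L * s))\<close> does
  not increase. The factor 2 comes from differentiating the square.\<close>

lemma solutions_dist_le:
  fixes u v :: "real \<Rightarrow> 'a::euclidean_space"
  assumes lip: "L-lipschitz_on S Y" and ab: "a \<le> b"
    and u: "\<And>s. s \<in> {a..b} \<Longrightarrow> u s \<in> S \<and> (u has_vector_derivative Y (u s)) (at s within {a..b})"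
    and v: "\<And>s. s \<in> {a..b} \<Longrightarrow> v s \<in> S \<and> (v has_vector_derivative Y (v s)) (at s within {a..b})"
  shows "dist (u b) (v b) \<le> exp (L * (b - a)) * dist (u a) (v a)"
proof -
  define w where "w s = u s - v s" for s
  define \<phi> where "\<phi> s = exp (- (2 * L * s)) * (w s \<bullet> w s)" for s
  have dw: "(w has_vector_derivative (Y (u s) - Y (v s))) (at s within {a..b})" if "s \<in> {a..b}" for s
    unfolding w_def using u[OF that] v[OF that] by (intro has_vector_derivative_diff) auto
  have "\<phi> b \<le> \<phi> a"
  proof (rule DERIV_nonpos_imp_decreasing_open[OF ab])
    have "continuous_on {a..b} w"
      using dw has_vector_derivative_continuous continuous_on_eq_continuous_within by blast
    then show "continuous_on {a..b} \<phi>" unfolding \<phi>_def by (intro continuous_intros)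
    fix s assume s: "a < s" "s < b"
    then have sin: "s \<in> {a..b}" by simp
    have d: "(w has_vector_derivative (Y (u s) - Y (v s))) (at s)"
      using dw[OF sin] s by (simp add: at_within_Icc_at)
    have dd: "((\<lambda>s. w s \<bullet> w s) has_vector_derivative (w s \<bullet> (Y (u s) - Y (v s)) + (Y (u s) - Y (v s)) \<bullet> w s)) (at s)"
      by (rule bounded_bilinear.has_vector_derivative[OF bounded_bilinear_inner d d])
    have de: "((\<lambda>s. exp (- (2 * L * s))) has_real_derivative (- 2 * L * exp (- (2 * L * s)))) (at s)"
      by (auto intro!: derivative_eq_intros)
    have "(\<phi> has_real_derivative
        (- 2 * L * exp (- (2 * L * s))) * (w s \<bullet> w s) +
        (w s \<bullet> (Y (u s) - Y (v s)) + (Y (u s) - Y (v s)) \<bullet> w s) * exp (- (2 * L * s))) (at s)"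
      unfolding \<phi>_def using dd
      by (intro DERIV_mult de) (simp add: has_real_derivative_iff_has_vector_derivative)
    moreover have "(- 2 * L * exp (- (2 * L * s))) * (w s \<bullet> w s) +
        (w s \<bullet> (Y (u s) - Y (v s)) + (Y (u s) - Y (v s)) \<bullet> w s) * exp (- (2 * L * s)) \<le> 0"
    proof -
      have "w s \<bullet> (Y (u s) - Y (v s)) \<le> norm (w s) * norm (Y (u s) - Y (v s))" by (rule norm_cauchy_schwarz)
      also have "\<dots> \<le> norm (w s) * (L * norm (w s))"
        using lipschitz_onD[OF lip, of "u s" "v s"] u[OF sin] v[OF sin]
        by (intro mult_left_mono) (auto simp: dist_norm w_def)
      finally have "w s \<bullet> (Y (u s) - Y (v s)) \<le> L * (w s \<bullet> w s)"
        by (simp add: power2_norm_eq_inner[symmetric] power2_eq_square mult_ac)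
      then have "exp (- (2 * L * s)) * (2 * (w s \<bullet> (Y (u s) - Y (v s))) - 2 * L * (w s \<bullet> w s)) \<le> 0"
        by (intro mult_nonneg_nonpos) auto
      then show ?thesis by (simp add: algebra_simps inner_commute)
    qed
    ultimately show "\<exists>y. (\<phi> has_real_derivative y) (at s) \<and> y \<le> 0" by blast
  qed
  then have "exp (- (2 * L * b)) * (norm (w b))\<^sup>2 \<le> exp (- (2 * L * a)) * (norm (w a))\<^sup>2"
    by (simp add: \<phi>_def power2_norm_eq_inner)
  then have *: "exp (2 * L * b) * (exp (- (2 * L * b)) * (norm (w b))\<^sup>2)
      \<le> exp (2 * L * b) * (exp (- (2 * L * a)) * (norm (w a))\<^sup>2)"
    by (intro mult_left_mono) auto
  have "(norm (w b))\<^sup>2 \<le> exp (2 * (L * (b - a))) * (norm (w a))\<^sup>2"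
  proof -
    have "exp (2 * L * b) * exp (- (2 * L * b)) = 1" by (simp add: mult_exp_exp)
    moreover have "exp (2 * L * b) * exp (- (2 * L * a)) = exp (2 * (L * (b - a)))"
      by (simp add: mult_exp_exp algebra_simps)
    ultimately show ?thesis using * by (simp add: mult.assoc[symmetric])
  qed
  also have "\<dots> = (exp (L * (b - a)) * norm (w a))\<^sup>2"
    by (simp add: power_mult_distrib exp_double)
  finally have "norm (w b) \<le> exp (L * (b - a)) * norm (w a)"
    by (rule power2_le_imp_le) simp
  then show ?thesis by (simp add: w_def dist_norm)
qed


section \<open>Vector fields in charts\<close>

lemma chart_facts:
  assumes A: "smooth_atlas A" and c: "c \<in> A"
  shows chart_open: "open (fst c)"
    and chart_continuous: "continuous_on (fst c) (snd c)"
    and chart_inv_continuous: "continuous_on (snd c ` fst c) (chart_inv c)"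
    and chart_inj: "inj_on (snd c) (fst c)"
    and chart_inv_chart: "x \<in> fst c \<Longrightarrow> chart_inv c (snd c x) = x"
    and chart_image_open: "open V \<Longrightarrow> open (snd c ` (fst c \<inter> V))"
proof -
  have o: "open (fst c)" "open (snd c ` fst c)"
    and h: "homeomorphism (fst c) (snd c ` fst c) (snd c) (chart_inv c)"
    using A c unfolding smooth_atlas_def by blast+
  show "open (fst c)" by (rule o(1))
  show "continuous_on (fst c) (snd c)" "continuous_on (snd c ` fst c) (chart_inv c)"
    using h by (auto simp: homeomorphism_def)
  show inv: "chart_inv c (snd c x) = x" if "x \<in> fst c" for x
    using h that by (auto simp: homeomorphism_def)
  show "inj_on (snd c) (fst c)" by (rule inj_on_inverseI) (rule inv)
  show "open (snd c ` (fst c \<inter> V))" if "open V"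
  proof -
    have "openin (top_of_set (fst c)) (fst c \<inter> V)" using that by (simp add: openin_open_Int)
    then have "openin (top_of_set (snd c ` fst c)) (snd c ` (fst c \<inter> V))"
      using homeomorphism_imp_open_map[OF h] by blast
    then show ?thesis using o(2) openin_open_eq by blast
  qed
qed

lemma smooth_on_differentiable: "smooth_on S h \<Longrightarrow> u \<in> S \<Longrightarrow> h differentiable (at u)"
  unfolding smooth_on_def by (drule spec[of _ "Suc 0"]) simp

lemma transition_has_derivative:
  assumes A: "smooth_atlas A" and c: "c \<in> A" "c' \<in> A" "x \<in> fst c" "x \<in> fst c'"
  shows "((snd c' \<circ> chart_inv c) has_derivative
    frechet_derivative (snd c' \<circ> chart_inv c) (at (snd c x))) (at (snd c x))"
proof -
  have "smooth_on (snd c ` (fst c \<inter> fst c')) (snd c' \<circ> chart_inv c)"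
    using A c by (auto simp: smooth_atlas_def)
  then have "(snd c' \<circ> chart_inv c) differentiable (at (snd c x))"
    by (rule smooth_on_differentiable) (use c in auto)
  then show ?thesis by (simp add: frechet_derivative_works)
qed

section \<open>Integral curves of a field given in charts\<close>

text \<open>The notion \<open>neg_gradient_curve\<close> for an arbitrary field, so that reversing
  time stays within it by passing from \<open>X\<close> to \<open>- X\<close>.\<close>

definition integral_curve ::
    "'m::topological_space chart set \<Rightarrow> 'm set \<Rightarrow> ('m chart \<Rightarrow> 'm \<Rightarrow> real^2) \<Rightarrow> real set \<Rightarrow> (real \<Rightarrow> 'm) \<Rightarrow> bool" where
  "integral_curve A U X I \<gamma> \<longleftrightarrow> continuous_on I \<gamma> \<and> \<gamma> ` I \<subseteq> U \<and>
     (\<forall>s\<in>I. \<forall>c\<in>A. \<gamma> s \<in> fst c \<longrightarrow>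
        ((snd c \<circ> \<gamma>) has_vector_derivative X c (\<gamma> s)) (at s within I))"

definition reaches ::
    "'m::topological_space chart set \<Rightarrow> 'm set \<Rightarrow> ('m chart \<Rightarrow> 'm \<Rightarrow> real^2) \<Rightarrow> real \<Rightarrow> 'm \<Rightarrow> 'm \<Rightarrow> bool" where
  "reaches A U X t x y \<longleftrightarrow> 0 \<le> t \<and> (\<exists>\<gamma>. integral_curve A U X {0..t} \<gamma> \<and> \<gamma> 0 = x \<and> \<gamma> t = y)"

text \<open>Slope 1 yields translations of time, slope -1 its reversal.\<close>

lemma integral_curve_affine:
  assumes \<gamma>: "integral_curve A U X I \<gamma>" and sub: "(\<lambda>s. m * s + k) ` J \<subseteq> I"
  shows "integral_curve A U (\<lambda>c x. m *\<^sub>R X c x) J (\<lambda>s. \<gamma> (m * s + k))"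
  unfolding integral_curve_def
proof (intro conjI ballI impI)
  have cont: "continuous_on I \<gamma>" and U: "\<gamma> ` I \<subseteq> U" using \<gamma> by (auto simp: integral_curve_def)
  show "continuous_on J (\<lambda>s. \<gamma> (m * s + k))"
    by (rule continuous_on_compose2[OF cont _ sub]) (intro continuous_intros)
  show "(\<lambda>s. \<gamma> (m * s + k)) ` J \<subseteq> U" using U sub by auto
  fix s c assume s: "s \<in> J" "c \<in> A" "\<gamma> (m * s + k) \<in> fst c"
  then have "((snd c \<circ> \<gamma>) has_vector_derivative X c (\<gamma> (m * s + k))) (at (m * s + k) within I)"
    using \<gamma> sub by (auto simp: integral_curve_def)
  then have "((snd c \<circ> \<gamma>) has_vector_derivative X c (\<gamma> (m * s + k)))
      (at (m * s + k) within (\<lambda>s. m * s + k) ` J)"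
    by (rule has_vector_derivative_within_subset[OF _ sub])
  moreover have "((\<lambda>s. m * s + k) has_vector_derivative m) (at s within J)"
    by (auto intro!: derivative_eq_intros)
  ultimately have "((snd c \<circ> \<gamma>) \<circ> (\<lambda>s. m * s + k) has_vector_derivative m *\<^sub>R X c (\<gamma> (m * s + k)))
      (at s within J)"
    by (intro vector_diff_chain_within)
  then show "(snd c \<circ> (\<lambda>s. \<gamma> (m * s + k)) has_vector_derivative m *\<^sub>R X c (\<gamma> (m * s + k))) (at s within J)"
    by (simp add: comp_def)
qed

lemma integral_curve_shift:
  "integral_curve A U X I \<gamma> \<Longrightarrow> (\<lambda>s. s + k) ` J \<subseteq> I \<Longrightarrow> integral_curve A U X J (\<lambda>s. \<gamma> (s + k))"
  using integral_curve_affine[of A U X I \<gamma> 1 k J] by simp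

lemma integral_curve_subset:
  "integral_curve A U X I \<gamma> \<Longrightarrow> J \<subseteq> I \<Longrightarrow> integral_curve A U X J \<gamma>"
  using integral_curve_shift[of A U X I \<gamma> 0 J] by simp

lemma integral_curve_reverse:
  "integral_curve A U X {0..t} \<gamma> \<Longrightarrow> integral_curve A U (\<lambda>c x. - X c x) {0..t} (\<lambda>s. \<gamma> (t - s))"
  using integral_curve_affine[of A U X "{0..t}" \<gamma> "-1" t "{0..t}"] by fastforce

lemma reaches_reverse: "reaches A U (\<lambda>c x. - X c x) t y x \<longleftrightarrow> reaches A U X t x y"
proof -
  have *: "reaches A U (\<lambda>c x. - X c x) t y x" if r: "reaches A U X t x y" for X x y
  proof -
    obtain \<gamma> where "0 \<le> t" "integral_curve A U X {0..t} \<gamma>" "\<gamma> 0 = x" "\<gamma> t = y"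
      using r by (auto simp: reaches_def)
    then show ?thesis unfolding reaches_def
      by (intro conjI exI[of _ "\<lambda>s. \<gamma> (t - s)"] integral_curve_reverse) auto
  qed
  show ?thesis using *[of X x y] *[of "\<lambda>c x. - X c x" y x] by auto
qed

lemma integral_curve_join:
  fixes \<gamma>1 \<gamma>2 :: "real \<Rightarrow> 'm::topological_space"
  assumes \<gamma>: "integral_curve A U X {0..s} \<gamma>1" "integral_curve A U X {0..t} \<gamma>2"
    and eq: "\<gamma>1 s = \<gamma>2 0" and st: "0 \<le> s" "0 \<le> t"
  shows "integral_curve A U X {0..s + t} (\<lambda>r. if r \<in> {0..s} then \<gamma>1 r else \<gamma>2 (r - s))"
  unfolding integral_curve_def
proof (intro conjI ballI impI)
  let ?\<gamma> = "\<lambda>r. if r \<in> {0..s} then \<gamma>1 r else \<gamma>2 (r - s)"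
  have \<gamma>2: "integral_curve A U X {s..s + t} (\<lambda>r. \<gamma>2 (r - s))"
    using integral_curve_shift[OF \<gamma>(2), of "- s" "{s..s+t}"] by auto
  have un: "{0..s + t} = {0..s} \<union> {s..s + t}" using st by auto
  show "continuous_on {0..s + t} ?\<gamma>" unfolding un
  proof (rule continuous_on_If)
    show "continuous_on {0..s} \<gamma>1" "continuous_on {s..s + t} (\<lambda>r. \<gamma>2 (r - s))"
      using \<gamma>(1) \<gamma>2 by (auto simp: integral_curve_def)
  qed (use eq in auto)
  show "?\<gamma> ` {0..s + t} \<subseteq> U"
    using \<gamma> st unfolding integral_curve_def by (auto simp: image_subset_iff)
  fix r c assume r: "r \<in> {0..s + t}" "c \<in> A" "?\<gamma> r \<in> fst c"
  \<comment> \<open>At the junction the derivative is glued from two one-sided ones, which agree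
    because the field is evaluated at the common point.\<close>
  have cl: "closure {0..s} \<inter> closure {s..s + t} = {s}" using st by auto
  have "((\<lambda>r. if r \<in> {0..s} then (snd c \<circ> \<gamma>1) r else (snd c \<circ> (\<lambda>r. \<gamma>2 (r - s))) r) has_vector_derivative
     (if r \<in> {0..s} then X c (\<gamma>1 r) else X c (\<gamma>2 (r - s)))) (at r within {0..s + t})"
  proof (rule has_vector_derivative_If_within_closures[OF _ un])
    show "r \<in> {0..s} \<union> {s..s + t}" using r un by simp
    have e: "{0..s} \<union> {s} = {0..s}" "{s..s + t} \<union> {s} = {s..s + t}" using st by auto
    show "(snd c \<circ> \<gamma>1 has_vector_derivative X c (\<gamma>1 r)) (at r within {0..s} \<union> closure {0..s} \<inter> closure {s..s + t})"
      if "r \<in> {0..s} \<union> closure {0..s} \<inter> closure {s..s + t}"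
      using that \<gamma>(1) r unfolding cl e integral_curve_def by auto
    show "(snd c \<circ> (\<lambda>r. \<gamma>2 (r - s)) has_vector_derivative X c (\<gamma>2 (r - s)))
        (at r within {s..s + t} \<union> closure {0..s} \<inter> closure {s..s + t})"
      if "r \<in> {s..s + t} \<union> closure {0..s} \<inter> closure {s..s + t}"
    proof -
      have rs: "r \<in> {s..s + t}" using that st unfolding cl by auto
      then have "\<gamma>2 (r - s) \<in> fst c" using r(3) eq st by (cases "r = s") auto
      then show ?thesis using \<gamma>2 rs r(2) unfolding cl e integral_curve_def by blast
    qed
    show "(snd c \<circ> \<gamma>1) r = (snd c \<circ> (\<lambda>r. \<gamma>2 (r - s))) r" "X c (\<gamma>1 r) = X c (\<gamma>2 (r - s))"
      if "r \<in> closure {0..s}" "r \<in> closure {s..s + t}"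
      using that cl eq by auto
  qed
  then show "(snd c \<circ> ?\<gamma> has_vector_derivative X c (?\<gamma> r)) (at r within {0..s + t})"
    by (rule back_subst[where P = "\<lambda>f. (f has_vector_derivative _) _", THEN back_subst[where P = "\<lambda>d. (_ has_vector_derivative d) _"]]) auto
qed

section \<open>Local flow and uniqueness\<close>

text \<open>\<open>transformation\<close> says that the components in different charts describe one
  tangent vector. The Lipschitz condition in charts is what existence and uniqueness rest
  on.\<close>

locale chart_field =
  fixes A :: "'m::t2_space chart set" and U :: "'m set" and X :: "'m chart \<Rightarrow> 'm \<Rightarrow> real^2"
  assumes atlas: "smooth_atlas A" and open_U: "open U"
    and transformation: "c \<in> A \<Longrightarrow> c' \<in> A \<Longrightarrow> x \<in> fst c \<Longrightarrow> x \<in> fst c' \<Longrightarrow> x \<in> U \<Longrightarrow>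
      X c' x = frechet_derivative (snd c' \<circ> chart_inv c) (at (snd c x)) (X c x)"
    and locally_lipschitz: "c \<in> A \<Longrightarrow> x \<in> fst c \<Longrightarrow> x \<in> U \<Longrightarrow>
      \<exists>r>0. \<exists>L. L-lipschitz_on (cball (snd c x) r) (\<lambda>u. X c (chart_inv c u))"
begin

lemma chart_at: obtains c where "c \<in> A" "x \<in> fst c"
  using atlas unfolding smooth_atlas_def by (metis UNIV_I UN_E)

lemma lipschitz_ball:
  assumes c: "c \<in> A" "x \<in> fst c" and x: "x \<in> U" "open B" "x \<in> B"
  obtains r L where "0 < r" "cball (snd c x) r \<subseteq> snd c ` (fst c \<inter> (U \<inter> B))"
    "L-lipschitz_on (cball (snd c x) r) (\<lambda>u. X c (chart_inv c u))"
proof -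
  have "open (snd c ` (fst c \<inter> (U \<inter> B)))"
    by (rule chart_image_open[OF atlas c(1) open_Int[OF open_U x(2)]])
  then obtain e where e: "0 < e" "cball (snd c x) e \<subseteq> snd c ` (fst c \<inter> (U \<inter> B))"
    using c x unfolding open_contains_cball by blast
  obtain r L where r: "0 < r" "L-lipschitz_on (cball (snd c x) r) (\<lambda>u. X c (chart_inv c u))"
    using locally_lipschitz[OF c x(1)] by blast
  show ?thesis
  proof (rule that[of "min e r" L])
    show "L-lipschitz_on (cball (snd c x) (min e r)) (\<lambda>u. X c (chart_inv c u))"
      by (rule lipschitz_on_subset[OF r(2)]) auto
  qed (use e r in auto)
qed

text \<open>In a chart the field is composed with the nearest-point projection onto a closed ball;
  this makes it globally Lipschitz and bounded and leaves it unchanged on the ball. Solutions from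
  the ball of half the radius remain in the full ball up to time \<tau>, so they solve the original
  equation.\<close>

lemma local_flow:
  assumes x: "x \<in> U" and B: "open B" "x \<in> B"
  shows "\<exists>W \<tau> \<Phi>. open W \<and> x \<in> W \<and> 0 < \<tau> \<and>
    (\<forall>y\<in>W. \<forall>t\<in>{0..\<tau>}. reaches A U X t y (\<Phi> t y) \<and> \<Phi> t y \<in> B) \<and>
    (\<forall>t\<in>{0..\<tau>}. continuous_on W (\<Phi> t))"
proof -
  obtain c where c: "c \<in> A" "x \<in> fst c" by (rule chart_at)
  define p where "p = snd c x"
  obtain r L where r: "0 < r" and rsub: "cball p r \<subseteq> snd c ` (fst c \<inter> (U \<inter> B))"
    and lip: "L-lipschitz_on (cball p r) (\<lambda>u. X c (chart_inv c u))"
    using lipschitz_ball[OF c x B] unfolding p_def by blast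
  define Y where "Y u = X c (chart_inv c (closest_point (cball p r) u))" for u
  have cb: "convex (cball p r)" "closed (cball p r)" "cball p r \<noteq> {}" using r by auto
  have cp: "closest_point (cball p r) u \<in> cball p r" for u by (rule closest_point_in_set[OF cb(2,3)])
  have L0: "0 \<le> L" by (rule lipschitz_on_nonneg[OF lip])
  have lipY: "L-lipschitz_on UNIV Y"
  proof (rule lipschitz_onI[OF _ L0])
    fix u v
    have "dist (Y u) (Y v) \<le> L * dist (closest_point (cball p r) u) (closest_point (cball p r) v)"
      unfolding Y_def by (rule lipschitz_onD[OF lip cp cp])
    also have "\<dots> \<le> L * dist u v"
      by (rule mult_left_mono[OF closest_point_lipschitz[OF cb] L0])
    finally show "dist (Y u) (Y v) \<le> L * dist u v" .
  qed
  define N where "N = norm (Y p) + L * r"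
  have bound: "norm (Y u) \<le> N" for u
  proof -
    have "p \<in> cball p r" using r by simp
    then have "dist (Y u) (Y p) \<le> L * dist (closest_point (cball p r) u) p"
      using lipschitz_onD[OF lip cp[of u], of p] closest_point_self[of p "cball p r"] by (simp add: Y_def)
    also have "\<dots> \<le> L * r" using cp[of u] L0 by (intro mult_left_mono) (auto simp: dist_commute)
    finally show ?thesis using norm_triangle_sub[of "Y u" "Y p"] by (simp add: N_def dist_norm)
  qed
  have N0: "0 \<le> N" using bound[of p] norm_ge_zero order_trans by blast
  \<comment> \<open>The first bound gives the contraction \<open>L * \<tau> < 1\<close>, the second
    keeps the displacement \<open>N * \<tau>\<close> within \<open>r / 2\<close>. The added 1
    prevents division by zero.\<close>
  define \<tau> where "\<tau> = min (1 / (2 * (L + 1))) (r / (2 * (N + 1)))"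
  have \<tau>: "0 < \<tau>" "L * \<tau> < 1" "N * \<tau> \<le> r / 2"
  proof -
    show "0 < \<tau>" using L0 N0 r by (auto simp: \<tau>_def)
    have "L * \<tau> \<le> L * (1 / (2 * (L + 1)))" using L0 by (intro mult_left_mono) (auto simp: \<tau>_def)
    also have "\<dots> < 1" using L0 by (simp add: field_simps)
    finally show "L * \<tau> < 1" .
    have "N * \<tau> \<le> N * (r / (2 * (N + 1)))" using N0 by (intro mult_left_mono) (auto simp: \<tau>_def)
    also have "\<dots> \<le> r / 2" using N0 r by (simp add: field_simps)
    finally show "N * \<tau> \<le> r / 2" .
  qed
  have "\<forall>y. \<exists>u. u 0 = y \<and> (\<forall>t\<in>{0..\<tau>}. norm (u t - y) \<le> N * t \<and>
      (u has_vector_derivative Y (u t)) (at t within {0..\<tau>}))"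
    using picard_local_solution[OF lipY bound _ \<tau>(2)] \<tau>(1) by auto
  then obtain sol where sol: "\<And>y. sol y 0 = y"
    "\<And>y t. t \<in> {0..\<tau>} \<Longrightarrow> norm (sol y t - y) \<le> N * t"
    "\<And>y t. t \<in> {0..\<tau>} \<Longrightarrow> (sol y has_vector_derivative Y (sol y t)) (at t within {0..\<tau>})"
    by metis
  define \<Phi> where "\<Phi> t y = chart_inv c (sol (snd c y) t)" for t y
  define W where "W = fst c \<inter> snd c -` ball p (r / 2)"
  have W: "open W" "x \<in> W"
    using continuous_open_preimage[OF chart_continuous[OF atlas c(1)] chart_open[OF atlas c(1)], of "ball p (r/2)"]
      c r by (auto simp: W_def p_def)
  have in_ball: "sol (snd c y) t \<in> cball p r" if "y \<in> W" "t \<in> {0..\<tau>}" for y t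
  proof -
    have "norm (sol (snd c y) t - snd c y) \<le> r / 2"
      using sol(2)[OF that(2), of "snd c y"] \<tau>(3) N0 that(2) mult_left_mono[of t \<tau> N] by auto
    then show ?thesis using that(1) dist_triangle[of p "sol (snd c y) t" "snd c y"]
      by (auto simp: W_def dist_norm norm_minus_commute)
  qed
  have inv: "chart_inv c u \<in> fst c \<inter> (U \<inter> B) \<and> snd c (chart_inv c u) = u" if "u \<in> cball p r" for u
    using rsub that chart_inv_chart[OF atlas c(1)] by auto
  have cinv: "continuous_on (cball p r) (chart_inv c)"
    by (rule continuous_on_subset[OF chart_inv_continuous[OF atlas c(1)]]) (use rsub in auto)
  have curve: "integral_curve A U X {0..\<tau>} (\<lambda>t. \<Phi> t y)" if y: "y \<in> W" for y
    unfolding integral_curve_def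
  proof (intro conjI ballI impI)
    let ?u = "sol (snd c y)"
    have "continuous_on {0..\<tau>} ?u"
      using sol(3) has_vector_derivative_continuous continuous_on_eq_continuous_within by blast
    then show "continuous_on {0..\<tau>} (\<lambda>t. \<Phi> t y)"
      unfolding \<Phi>_def by (rule continuous_on_compose2[OF cinv]) (use in_ball[OF y] in auto)
    show "(\<lambda>t. \<Phi> t y) ` {0..\<tau>} \<subseteq> U" using in_ball[OF y] inv by (auto simp: \<Phi>_def)
    fix s c' assume s: "s \<in> {0..\<tau>}" and c': "c' \<in> A" "\<Phi> s y \<in> fst c'"
    have z: "\<Phi> s y \<in> fst c" "\<Phi> s y \<in> U" "snd c (\<Phi> s y) = ?u s"
      using inv[OF in_ball[OF y s]] by (auto simp: \<Phi>_def)
    have "Y (?u s) = X c (\<Phi> s y)"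
      unfolding Y_def using closest_point_self[OF in_ball[OF y s]] by (simp add: \<Phi>_def)
    then have "(?u has_vector_derivative X c (\<Phi> s y)) (at s within {0..\<tau>})"
      using sol(3)[OF s] by metis
    then have du: "(?u has_derivative (\<lambda>h. h *\<^sub>R X c (\<Phi> s y))) (at s within {0..\<tau>})"
      by (simp add: has_vector_derivative_def)
    \<comment> \<open>The velocity in another chart \<open>c'\<close> follows from the chain rule:
      the derivative of the transition map sends \<open>X c\<close> to \<open>X c'\<close>.\<close>
    let ?D = "frechet_derivative (snd c' \<circ> chart_inv c) (at (?u s))"
    have dD: "((snd c' \<circ> chart_inv c) has_derivative ?D) (at (?u s))"
      using transition_has_derivative[OF atlas c(1) c'(1) z(1) c'(2)] z(3) by simp
    have "(((snd c' \<circ> chart_inv c) \<circ> ?u) has_derivative (?D \<circ> (\<lambda>h. h *\<^sub>R X c (\<Phi> s y)))) (at s within {0..\<tau>})"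
      by (rule diff_chain_within[OF du has_derivative_at_withinI[OF dD]])
    moreover have "?D \<circ> (\<lambda>h. h *\<^sub>R X c (\<Phi> s y)) = (\<lambda>h. h *\<^sub>R X c' (\<Phi> s y))"
      using transformation[OF c(1) c'(1) z(1) c'(2) z(2)] z(3)
        linear_cmul[OF has_derivative_linear[OF dD]] by (auto simp: fun_eq_iff)
    ultimately show "(snd c' \<circ> (\<lambda>t. \<Phi> t y) has_vector_derivative X c' (\<Phi> s y)) (at s within {0..\<tau>})"
      by (simp add: has_vector_derivative_def \<Phi>_def comp_def)
  qed
  have "reaches A U X t y (\<Phi> t y) \<and> \<Phi> t y \<in> B" if y: "y \<in> W" and t: "t \<in> {0..\<tau>}" for y t
  proof -
    have "\<Phi> 0 y = y" using y chart_inv_chart[OF atlas c(1)] by (simp add: \<Phi>_def sol(1) W_def)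
    then have "reaches A U X t y (\<Phi> t y)" unfolding reaches_def
      using t by (intro conjI exI[of _ "\<lambda>t. \<Phi> t y"] integral_curve_subset[OF curve[OF y]]) auto
    then show ?thesis using inv[OF in_ball[OF y t]] by (simp add: \<Phi>_def)
  qed
  moreover have "continuous_on W (\<Phi> t)" if t: "t \<in> {0..\<tau>}" for t
  proof -
    have "(exp (L * t))-lipschitz_on UNIV (\<lambda>y. sol y t)"
    proof (rule lipschitz_onI)
      fix y z
      have s: "s \<in> {0..t} \<Longrightarrow> sol y s \<in> UNIV \<and> (sol y has_vector_derivative Y (sol y s)) (at s within {0..t})" for s y
        using sol(3)[of s y] t by (auto intro: has_vector_derivative_within_subset)
      show "dist (sol y t) (sol z t) \<le> exp (L * t) * dist y z"
        using solutions_dist_le[OF lipY, of 0 t "sol y" "sol z"] s t by (simp add: sol(1))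
    qed simp
    then have "continuous_on UNIV (\<lambda>y. sol y t)" by (rule lipschitz_on_continuous_on)
    moreover have "continuous_on W (snd c)"
      by (rule continuous_on_subset[OF chart_continuous[OF atlas c(1)]]) (auto simp: W_def)
    ultimately have "continuous_on W (\<lambda>y. sol (snd c y) t)"
      by (rule continuous_on_compose2) auto
    then show ?thesis
      unfolding \<Phi>_def by (rule continuous_on_compose2[OF cinv]) (use in_ball[OF _ t] in auto)
  qed
  ultimately show ?thesis using W \<tau>(1) by blast
qed

lemma integral_curve_nbhd:
  assumes "integral_curve A U X {0..t} \<gamma>" "s \<in> {0..t}" "open B" "\<gamma> s \<in> B"
  shows "\<exists>d>0. \<forall>r\<in>{0..t}. \<bar>r - s\<bar> < d \<longrightarrow> \<gamma> r \<in> B"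
proof -
  have "(\<gamma> \<longlongrightarrow> \<gamma> s) (at s within {0..t})"
    using assms(1,2) by (auto simp: integral_curve_def continuous_on_def)
  then have "\<forall>\<^sub>F r in at s within {0..t}. \<gamma> r \<in> B" using assms(3,4) by (rule topological_tendstoD)
  then obtain d where "d > 0" "\<forall>r\<in>{0..t}. r \<noteq> s \<and> dist r s < d \<longrightarrow> \<gamma> r \<in> B"
    unfolding eventually_at by blast
  then show ?thesis using assms(4) by (intro exI[of _ d]) (auto simp: dist_real_def)
qed

text \<open>Agreement is propagated along the interval. Near a time where the curves differ,
  disjoint open sets separate them and there is no agreement to propagate; near a time where they
  agree, both run in one chart and Gronwall's estimate applies.\<close>

lemma integral_curve_unique:
  assumes \<gamma>1: "integral_curve A U X {0..t} \<gamma>1" and \<gamma>2: "integral_curve A U X {0..t} \<gamma>2"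
    and eq: "\<gamma>1 0 = \<gamma>2 0" and t: "0 \<le> t"
  shows "\<gamma>1 t = \<gamma>2 t"
proof (rule real_chain_induct[OF t, where P = "\<lambda>s. \<gamma>1 s = \<gamma>2 s"])
  show "\<gamma>1 0 = \<gamma>2 0" by (rule eq)
  fix s assume "0 \<le> s" "s \<le> t"
  then have s: "s \<in> {0..t}" by simp
  show "\<exists>d>0. \<forall>a b. 0 \<le> a \<and> a \<le> b \<and> b \<le> t \<and> \<bar>a - s\<bar> < d \<and> \<bar>b - s\<bar> < d \<and> \<gamma>1 a = \<gamma>2 a \<longrightarrow> \<gamma>1 b = \<gamma>2 b"
  proof (cases "\<gamma>1 s = \<gamma>2 s")
    case False
    then obtain B1 B2 where B: "open B1" "open B2" "\<gamma>1 s \<in> B1" "\<gamma>2 s \<in> B2" "B1 \<inter> B2 = {}"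
      using hausdorff[OF False] by metis
    obtain d1 where d1: "d1 > 0" "\<And>r. r \<in> {0..t} \<Longrightarrow> \<bar>r - s\<bar> < d1 \<Longrightarrow> \<gamma>1 r \<in> B1"
      using integral_curve_nbhd[OF \<gamma>1 s B(1,3)] by blast
    obtain d2 where d2: "d2 > 0" "\<And>r. r \<in> {0..t} \<Longrightarrow> \<bar>r - s\<bar> < d2 \<Longrightarrow> \<gamma>2 r \<in> B2"
      using integral_curve_nbhd[OF \<gamma>2 s B(2,4)] by blast
    have False if "0 \<le> a" "a \<le> b" "b \<le> t" "\<bar>a - s\<bar> < min d1 d2" "\<gamma>1 a = \<gamma>2 a" for a b
      using d1(2)[of a] d2(2)[of a] B(5) that by auto
    then show ?thesis using d1(1) d2(1) by (intro exI[of _ "min d1 d2"]) auto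
  next
    case True
    obtain c where c: "c \<in> A" "\<gamma>1 s \<in> fst c" by (rule chart_at)
    have xU: "\<gamma>1 s \<in> U" using \<gamma>1 s by (auto simp: integral_curve_def)
    obtain r L where r: "0 < r" "L-lipschitz_on (cball (snd c (\<gamma>1 s)) r) (\<lambda>u. X c (chart_inv c u))"
      using lipschitz_ball[OF c xU open_UNIV] by blast
    define B where "B = fst c \<inter> snd c -` ball (snd c (\<gamma>1 s)) r"
    have B: "open B" "\<gamma>1 s \<in> B"
      using continuous_open_preimage[OF chart_continuous[OF atlas c(1)] chart_open[OF atlas c(1)],
          of "ball (snd c (\<gamma>1 s)) r"] c r by (auto simp: B_def)
    obtain d1 where d1: "d1 > 0" "\<And>r. r \<in> {0..t} \<Longrightarrow> \<bar>r - s\<bar> < d1 \<Longrightarrow> \<gamma>1 r \<in> B"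
      using integral_curve_nbhd[OF \<gamma>1 s B] by blast
    obtain d2 where d2: "d2 > 0" "\<And>r. r \<in> {0..t} \<Longrightarrow> \<bar>r - s\<bar> < d2 \<Longrightarrow> \<gamma>2 r \<in> B"
      using integral_curve_nbhd[OF \<gamma>2 s B(1)] B(2) True by auto
    have "\<gamma>1 b = \<gamma>2 b" if ab: "0 \<le> a" "a \<le> b" "b \<le> t" "\<bar>a - s\<bar> < min d1 d2"
      "\<bar>b - s\<bar> < min d1 d2" "\<gamma>1 a = \<gamma>2 a" for a b
    proof -
      have near: "q \<in> {0..t} \<and> \<bar>q - s\<bar> < d1 \<and> \<bar>q - s\<bar> < d2" if "q \<in> {a..b}" for q
        using ab that by auto
      have sol: "(snd c \<circ> \<gamma>) q \<in> cball (snd c (\<gamma>1 s)) r \<and>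
          ((snd c \<circ> \<gamma>) has_vector_derivative X c (chart_inv c ((snd c \<circ> \<gamma>) q))) (at q within {a..b})"
        if "integral_curve A U X {0..t} \<gamma>" "q \<in> {a..b}" "\<gamma> q \<in> B" for \<gamma> q
      proof -
        have "integral_curve A U X {a..b} \<gamma>"
          by (rule integral_curve_subset[OF that(1)]) (use ab in auto)
        then show ?thesis
          using that c chart_inv_chart[OF atlas c(1)] by (auto simp: integral_curve_def B_def)
      qed
      have "dist ((snd c \<circ> \<gamma>1) b) ((snd c \<circ> \<gamma>2) b)
          \<le> exp (L * (b - a)) * dist ((snd c \<circ> \<gamma>1) a) ((snd c \<circ> \<gamma>2) a)"
        using near d1(2) d2(2) by (intro solutions_dist_le[OF r(2) ab(2)] sol[OF \<gamma>1] sol[OF \<gamma>2]) auto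
      then have "snd c (\<gamma>1 b) = snd c (\<gamma>2 b)" using ab(6) by simp
      moreover have "\<gamma>1 b \<in> fst c" "\<gamma>2 b \<in> fst c"
        using near[of b] d1(2)[of b] d2(2)[of b] ab(2) by (auto simp: B_def)
      ultimately show ?thesis using inj_onD[OF chart_inj[OF atlas c(1)]] by blast
    qed
    then show ?thesis using d1(1) d2(1) by (intro exI[of _ "min d1 d2"]) auto
  qed
qed

lemma reaches_det: "reaches A U X t x y \<Longrightarrow> reaches A U X t x z \<Longrightarrow> y = z"
  unfolding reaches_def by (elim conjE exE) (metis integral_curve_unique)

text \<open>By uniqueness every solution from \<open>W\<close> up to time \<tau> is given by the
  local flow, whose maps at fixed times are continuous.\<close>

lemma reaches_cont:
  assumes x: "x \<in> U"
  shows "\<exists>W \<tau>. open W \<and> x \<in> W \<and> 0 < \<tau> \<and>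
      (\<forall>t\<in>{0..\<tau>}. \<forall>y\<in>W. \<forall>z B. reaches A U X t y z \<and> open B \<and> z \<in> B \<longrightarrow>
         (\<exists>W'. open W' \<and> y \<in> W' \<and> (\<forall>y'\<in>W'. \<exists>z'\<in>B. reaches A U X t y' z')))"
proof -
  obtain W \<tau> \<Phi> where W: "open W" "x \<in> W" "0 < \<tau>"
    and *: "\<forall>y\<in>W. \<forall>t\<in>{0..\<tau>}. reaches A U X t y (\<Phi> t y) \<and> \<Phi> t y \<in> UNIV"
      "\<forall>t\<in>{0..\<tau>}. continuous_on W (\<Phi> t)"
    using local_flow[OF x open_UNIV UNIV_I] by blast
  have \<Phi>: "\<And>y t. y \<in> W \<Longrightarrow> t \<in> {0..\<tau>} \<Longrightarrow> reaches A U X t y (\<Phi> t y)"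
    and cont: "\<And>t. t \<in> {0..\<tau>} \<Longrightarrow> continuous_on W (\<Phi> t)"
    using * by auto
  have "\<exists>W'. open W' \<and> y \<in> W' \<and> (\<forall>y'\<in>W'. \<exists>z'\<in>B. reaches A U X t y' z')"
    if "t \<in> {0..\<tau>}" "y \<in> W" "reaches A U X t y z" "open B" "z \<in> B" for t y z B
  proof (intro exI[of _ "W \<inter> \<Phi> t -` B"] conjI ballI)
    show "open (W \<inter> \<Phi> t -` B)" by (rule continuous_open_preimage[OF cont[OF that(1)] W(1) that(4)])
    show "y \<in> W \<inter> \<Phi> t -` B" using reaches_det[OF that(3) \<Phi>[OF that(2,1)]] that by simp
    show "\<exists>z'\<in>B. reaches A U X t y' z'" if "y' \<in> W \<inter> \<Phi> t -` B" for y'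
      using \<Phi>[of y' t] that \<open>t \<in> {0..\<tau>}\<close> by blast
  qed
  then show ?thesis using W by (intro exI[of _ W] exI[of _ \<tau>]) blast
qed

lemma reaches_local:
  assumes "x \<in> U" "open B" "x \<in> B"
  shows "\<exists>W \<tau>. open W \<and> x \<in> W \<and> 0 < \<tau> \<and> (\<forall>y\<in>W. \<forall>t\<in>{0..\<tau>}. \<exists>z\<in>B. reaches A U X t y z)"
proof -
  obtain W \<tau> \<Phi> where "open W" "x \<in> W" "0 < \<tau>"
    and "\<forall>y\<in>W. \<forall>t\<in>{0..\<tau>}. reaches A U X t y (\<Phi> t y) \<and> \<Phi> t y \<in> B"
    using local_flow[OF assms] by blast
  then show ?thesis by (intro exI[of _ W] exI[of _ \<tau>]) blast
qed

end

lemma reaches_dom: "reaches A U X t x y \<Longrightarrow> 0 \<le> t \<and> x \<in> U \<and> y \<in> U"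
  unfolding reaches_def integral_curve_def by force

lemma reaches_0: "x \<in> U \<Longrightarrow> reaches A U X 0 x x"
  unfolding reaches_def integral_curve_def
  by (auto intro!: exI[of _ "\<lambda>_. x"] simp: has_vector_derivative_def has_derivative_within_singleton_iff bounded_linear_scaleR_left)

lemma reaches_trans:
  assumes "reaches A U X s x y" "reaches A U X t y z"
  shows "reaches A U X (s + t) x z"
proof -
  obtain \<gamma>1 \<gamma>2 where \<gamma>: "0 \<le> s" "0 \<le> t" "integral_curve A U X {0..s} \<gamma>1" "\<gamma>1 0 = x" "\<gamma>1 s = y"
     "integral_curve A U X {0..t} \<gamma>2" "\<gamma>2 0 = y" "\<gamma>2 t = z"
    using assms by (auto simp: reaches_def)
  let ?\<gamma> = "\<lambda>r. if r \<in> {0..s} then \<gamma>1 r else \<gamma>2 (r - s)"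
  have "integral_curve A U X {0..s + t} ?\<gamma>" by (rule integral_curve_join) (use \<gamma> in auto)
  moreover have "?\<gamma> (s + t) = z" using \<gamma> by (cases "t = 0") auto
  moreover have "?\<gamma> 0 = x" using \<gamma> by simp
  ultimately show ?thesis unfolding reaches_def using \<gamma>(1,2) by (intro conjI exI[of _ ?\<gamma>]) auto
qed

lemma reaches_split:
  assumes "reaches A U X (s + t) x z" "0 \<le> s" "0 \<le> t"
  shows "\<exists>y. reaches A U X s x y \<and> reaches A U X t y z"
proof -
  obtain \<gamma> where \<gamma>: "integral_curve A U X {0..s + t} \<gamma>" "\<gamma> 0 = x" "\<gamma> (s + t) = z"
    using assms by (auto simp: reaches_def)
  have "integral_curve A U X {0..s} \<gamma>" by (rule integral_curve_subset[OF \<gamma>(1)]) (use assms in auto)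
  moreover have "integral_curve A U X {0..t} (\<lambda>r. \<gamma> (r + s))"
    by (rule integral_curve_shift[OF \<gamma>(1)]) (use assms in auto)
  ultimately show ?thesis unfolding reaches_def
    using \<gamma> assms by (intro exI[of _ "\<gamma> s"] conjI exI[of _ \<gamma>] exI[of _ "\<lambda>r. \<gamma> (r + s)"]) (auto simp: add.commute)
qed

lemma (in chart_field) reverse_chart_field: "chart_field A U (\<lambda>c x. - X c x)"
proof
  show "smooth_atlas A" "open U" by (fact atlas open_U)+
  show "- X c' x = frechet_derivative (snd c' \<circ> chart_inv c) (at (snd c x)) (- X c x)"
    if "c \<in> A" "c' \<in> A" "x \<in> fst c" "x \<in> fst c'" "x \<in> U" for c c' x
    using transformation[OF that]
      linear_neg[OF has_derivative_linear[OF transition_has_derivative[OF atlas that(1-4)]]] by simp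
  show "\<exists>r>0. \<exists>L. L-lipschitz_on (cball (snd c x) r) (\<lambda>u. - X c (chart_inv c u))"
    if "c \<in> A" "x \<in> fst c" "x \<in> U" for c x
    using locally_lipschitz[OF that] by simp
qed


section \<open>Calculus and linear algebra in the plane\<close>

lemma Ck_on_subset: "Ck_on k S h \<Longrightarrow> T \<subseteq> S \<Longrightarrow> Ck_on k T h"
  by (induction k arbitrary: h) (auto intro: continuous_on_subset)

lemma smooth_on_subset: "smooth_on S h \<Longrightarrow> T \<subseteq> S \<Longrightarrow> smooth_on T h"
  unfolding smooth_on_def using Ck_on_subset by blast

lemma frechet_derivative_cong:
  assumes "open S" "u \<in> S" "\<And>v. v \<in> S \<Longrightarrow> h v = k v"
  shows "frechet_derivative h (at u) = frechet_derivative k (at u)"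
proof -
  have "(h has_derivative D) (at u) \<longleftrightarrow> (k has_derivative D) (at u)" for D
    using has_derivative_transform_within_open[OF _ assms(1,2), where f = h and g = k]
      has_derivative_transform_within_open[OF _ assms(1,2), where f = k and g = h] assms(3) by auto
  then show ?thesis by (simp add: frechet_derivative_def)
qed

lemma partial_deriv_cong:
  assumes "open S" "u \<in> S" "\<And>v. v \<in> S \<Longrightarrow> h v = k v"
  shows "partial_deriv i h u = partial_deriv i k u"
  using frechet_derivative_cong[OF assms] by (simp add: partial_deriv_def)

lemma Ck_on_cong:
  assumes S: "open S"
  shows "Ck_on k S h \<Longrightarrow> (\<And>u. u \<in> S \<Longrightarrow> h u = h' u) \<Longrightarrow> Ck_on k S h'"
proof (induction k arbitrary: h h')
  case 0
  then show ?case using continuous_on_eq by (metis Ck_on.simps(1))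
next
  case (Suc k)
  have "h' differentiable (at u)" if u: "u \<in> S" for u
  proof -
    obtain D where "(h has_derivative D) (at u)" using Suc.prems(1) u by (auto simp: differentiable_def)
    then show ?thesis
      using has_derivative_transform_within_open[OF _ S u, where f = h and g = h'] Suc.prems(2)
      by (auto simp: differentiable_def)
  qed
  moreover have "Ck_on k S (\<lambda>u. frechet_derivative h' (at u) b)" if "b \<in> Basis" for b
  proof (rule Suc.IH)
    show "Ck_on k S (\<lambda>u. frechet_derivative h (at u) b)" using Suc.prems(1) that by simp
    show "frechet_derivative h (at u) b = frechet_derivative h' (at u) b" if "u \<in> S" for u
      by (rule fun_cong[OF frechet_derivative_cong[OF S that Suc.prems(2)]])
  qed
  ultimately show ?case by simp
qed

lemma smooth_on_cong:
  "open S \<Longrightarrow> smooth_on S h \<Longrightarrow> (\<And>u. u \<in> S \<Longrightarrow> h u = h' u) \<Longrightarrow> smooth_on S h'"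
  unfolding smooth_on_def using Ck_on_cong by blast

lemma axis_Basis: "axis i (1::real) \<in> Basis"
  by (simp add: axis_in_Basis_iff)

lemma smooth_on_partial_deriv: "smooth_on S h \<Longrightarrow> smooth_on S (partial_deriv i h)"
  unfolding smooth_on_def
proof
  fix k assume "\<forall>k. Ck_on k S h"
  then have "Ck_on (Suc k) S h" by blast
  then show "Ck_on k S (partial_deriv i h)"
    using axis_Basis[of i] by (simp add: partial_deriv_def[abs_def])
qed

lemma frechet_derivative_partial:
  fixes h :: "real^2 \<Rightarrow> real"
  assumes "h differentiable (at u)"
  shows "frechet_derivative h (at u) w = (\<chi> i. partial_deriv i h u) \<bullet> w"
proof -
  let ?D = "frechet_derivative h (at u)"
  have lin: "linear ?D" using assms by (simp add: frechet_derivative_works has_derivative_linear)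
  have "?D w = ?D (\<Sum>i\<in>UNIV. (w $ i) *\<^sub>R axis i 1)"
    using basis_expansion[of w] by (simp add: scalar_mult_eq_scaleR)
  also have "\<dots> = (\<Sum>i\<in>UNIV. (w $ i) * partial_deriv i h u)"
    by (simp add: linear_sum[OF lin] linear_cmul[OF lin] partial_deriv_def)
  finally show ?thesis by (simp add: inner_vec_def mult.commute)
qed

section \<open>Local Lipschitz continuity of smooth and rational expressions\<close>

definition locally_lipschitz_at :: "'a::metric_space \<Rightarrow> ('a \<Rightarrow> 'b::metric_space) \<Rightarrow> bool" where
  "locally_lipschitz_at u h \<longleftrightarrow> (\<exists>r>0. \<exists>L. L-lipschitz_on (cball u r) h)"

text \<open>The partial derivatives are continuous, hence bounded on a compact ball; the sum of
  their bounds over the basis bounds the operator norm of the derivative.\<close>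

lemma smooth_locally_lipschitz:
  fixes h :: "'a::euclidean_space \<Rightarrow> 'b::real_normed_vector"
  assumes S: "open S" "u \<in> S" and h: "smooth_on S h"
  shows "locally_lipschitz_at u h"
proof -
  obtain r where r: "0 < r" "cball u r \<subseteq> S" using S open_contains_cball by blast
  have "Ck_on (Suc 0) S h" using h by (auto simp: smooth_on_def)
  then have diff: "\<And>v. v \<in> S \<Longrightarrow> h differentiable (at v)"
    and cont: "\<And>b. b \<in> Basis \<Longrightarrow> continuous_on S (\<lambda>v. frechet_derivative h (at v) b)" by auto
  have "\<exists>B\<ge>0. \<forall>v\<in>cball u r. norm (frechet_derivative h (at v) b) \<le> B" if b: "b \<in> Basis" for b
  proof -
    have "compact ((\<lambda>v. frechet_derivative h (at v) b) ` cball u r)"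
      by (intro compact_continuous_image continuous_on_subset[OF cont[OF b] r(2)] compact_cball)
    then have "bounded ((\<lambda>v. frechet_derivative h (at v) b) ` cball u r)" by (rule compact_imp_bounded)
    then obtain B where "\<forall>v\<in>cball u r. norm (frechet_derivative h (at v) b) \<le> B"
      unfolding bounded_iff by blast
    then show ?thesis by (intro exI[of _ "max B 0"]) fastforce
  qed
  then obtain B where B: "\<And>b. b \<in> Basis \<Longrightarrow> 0 \<le> B b"
    "\<And>b v. b \<in> Basis \<Longrightarrow> v \<in> cball u r \<Longrightarrow> norm (frechet_derivative h (at v) b) \<le> B b" by metis
  define C where "C = (\<Sum>b\<in>Basis. B b)"
  have "C-lipschitz_on (cball u r) h"
  proof (rule bounded_derivative_imp_lipschitz)
    fix v assume v: "v \<in> cball u r"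
    then have d: "(h has_derivative frechet_derivative h (at v)) (at v)"
      using diff r(2) by (auto simp: frechet_derivative_works)
    then show "(h has_derivative frechet_derivative h (at v)) (at v within cball u r)"
      by (rule has_derivative_at_withinI)
    have lin: "linear (frechet_derivative h (at v))" by (rule has_derivative_linear[OF d])
    show "onorm (frechet_derivative h (at v)) \<le> C"
    proof (rule onorm_le)
      fix w
      have "frechet_derivative h (at v) w = frechet_derivative h (at v) (\<Sum>b\<in>Basis. (w \<bullet> b) *\<^sub>R b)"
        by (simp add: euclidean_representation)
      also have "\<dots> = (\<Sum>b\<in>Basis. (w \<bullet> b) *\<^sub>R frechet_derivative h (at v) b)"
        by (simp add: linear_sum[OF lin] linear_cmul[OF lin])
      also have "norm \<dots> \<le> (\<Sum>b\<in>Basis. norm w * B b)"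
        using B(2)[OF _ v] by (intro sum_norm_le) (auto intro!: mult_mono Basis_le_norm)
      finally show "norm (frechet_derivative h (at v) w) \<le> C * norm w"
        unfolding C_def sum_distrib_left[symmetric] by (simp add: mult.commute)
    qed
  qed (use B(1) in \<open>auto simp: C_def intro: sum_nonneg\<close>)
  then show ?thesis using r(1) unfolding locally_lipschitz_at_def by blast
qed

lemma locally_lipschitz_at_common:
  assumes "locally_lipschitz_at u p" "locally_lipschitz_at u q"
  obtains r L where "0 < r" "L-lipschitz_on (cball u r) p" "L-lipschitz_on (cball u r) q"
proof -
  obtain r1 L1 r2 L2 where r: "0 < r1" "L1-lipschitz_on (cball u r1) p" "0 < r2" "L2-lipschitz_on (cball u r2) q"
    using assms unfolding locally_lipschitz_at_def by blast
  show ?thesis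
    by (rule that[of "min r1 r2" "max L1 L2"])
      (use r in \<open>auto intro: lipschitz_on_mono\<close>)
qed

lemma locally_lipschitz_at_diff:
  fixes p q :: "'a::metric_space \<Rightarrow> real"
  assumes "locally_lipschitz_at u p" "locally_lipschitz_at u q"
  shows "locally_lipschitz_at u (\<lambda>v. p v - q v)"
  using locally_lipschitz_at_common[OF assms] lipschitz_on_diff
  unfolding locally_lipschitz_at_def by metis

lemma lipschitz_bounded:
  fixes p :: "'a::metric_space \<Rightarrow> real"
  assumes "L-lipschitz_on (cball u r) p" "v \<in> cball u r"
  shows "\<bar>p v\<bar> \<le> \<bar>p u\<bar> + L * r"
proof -
  have r: "0 \<le> r" using assms(2) zero_le_dist[of u v] by (simp add: order_trans[OF zero_le_dist])
  have "\<bar>p v - p u\<bar> \<le> L * dist v u"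
    using lipschitz_onD[OF assms(1,2), of u] r by (simp add: dist_real_def)
  also have "\<dots> \<le> L * r"
    using assms lipschitz_on_nonneg[OF assms(1)] by (intro mult_left_mono) (auto simp: dist_commute)
  finally show ?thesis by linarith
qed

lemma locally_lipschitz_at_mult:
  fixes p q :: "'a::metric_space \<Rightarrow> real"
  assumes "locally_lipschitz_at u p" "locally_lipschitz_at u q"
  shows "locally_lipschitz_at u (\<lambda>v. p v * q v)"
proof -
  obtain r L where r: "0 < r" "L-lipschitz_on (cball u r) p" "L-lipschitz_on (cball u r) q"
    using locally_lipschitz_at_common[OF assms] by metis
  have L: "0 \<le> L" by (rule lipschitz_on_nonneg[OF r(2)])
  define P where "P = \<bar>p u\<bar> + L * r"
  define Q where "Q = \<bar>q u\<bar> + L * r"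
  have PQ: "0 \<le> P" "0 \<le> Q" using L r(1) by (auto simp: P_def Q_def)
  have "((P + Q) * L)-lipschitz_on (cball u r) (\<lambda>v. p v * q v)"
  proof (rule lipschitz_onI)
    fix v w assume vw: "v \<in> cball u r" "w \<in> cball u r"
    have "p v * q v - p w * q w = p v * (q v - q w) + q w * (p v - p w)" by (simp add: algebra_simps)
    then have "\<bar>p v * q v - p w * q w\<bar> \<le> \<bar>p v\<bar> * \<bar>q v - q w\<bar> + \<bar>q w\<bar> * \<bar>p v - p w\<bar>"
      by (metis abs_mult abs_triangle_ineq)
    also have "\<dots> \<le> P * (L * dist v w) + Q * (L * dist v w)"
      using lipschitz_bounded[OF r(2) vw(1)] lipschitz_bounded[OF r(3) vw(2)]
        lipschitz_onD[OF r(2) vw] lipschitz_onD[OF r(3) vw] PQ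
      unfolding P_def[symmetric] Q_def[symmetric] dist_real_def
      by (intro add_mono mult_mono) simp_all
    finally show "dist (p v * q v) (p w * q w) \<le> (P + Q) * L * dist v w"
      by (simp add: dist_real_def algebra_simps)
  qed (use PQ L in auto)
  then show ?thesis using r(1) unfolding locally_lipschitz_at_def by blast
qed

lemma locally_lipschitz_at_inverse:
  fixes q :: "'a::metric_space \<Rightarrow> real"
  assumes q: "locally_lipschitz_at u q" and nz: "q u \<noteq> 0"
  shows "locally_lipschitz_at u (\<lambda>v. inverse (q v))"
proof -
  obtain r0 L where r0: "0 < r0" "L-lipschitz_on (cball u r0) q"
    using q unfolding locally_lipschitz_at_def by blast
  have L: "0 \<le> L" by (rule lipschitz_on_nonneg[OF r0(2)])
  define m where "m = \<bar>q u\<bar> / 2"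
  have m: "0 < m" using nz by (simp add: m_def)
  \<comment> \<open>Within this radius \<open>q\<close> changes by at most \<open>m\<close>, half of
    its absolute value at \<open>u\<close>, and so stays away from zero.\<close>
  define r where "r = min r0 (m / (L + 1))"
  have r: "0 < r" "L-lipschitz_on (cball u r) q"
    using r0 m L by (auto simp: r_def intro: lipschitz_on_mono)
  have lower: "m \<le> \<bar>q v\<bar>" if v: "v \<in> cball u r" for v
  proof -
    have "\<bar>q v - q u\<bar> \<le> L * dist v u"
      using lipschitz_onD[OF r(2) v, of u] r(1) by (simp add: dist_real_def)
    also have "\<dots> \<le> L * r" using v L by (intro mult_left_mono) (auto simp: dist_commute)
    also have "\<dots> \<le> L * (m / (L + 1))" using L by (intro mult_left_mono) (auto simp: r_def)
    also have "\<dots> \<le> m" using L m by (simp add: field_simps)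
    finally show ?thesis unfolding m_def by linarith
  qed
  have "(L / m\<^sup>2)-lipschitz_on (cball u r) (\<lambda>v. inverse (q v))"
  proof (rule lipschitz_onI)
    fix v w assume vw: "v \<in> cball u r" "w \<in> cball u r"
    have nz: "q v \<noteq> 0" "q w \<noteq> 0" using lower vw m by force+
    have "\<bar>inverse (q v) - inverse (q w)\<bar> = \<bar>q v - q w\<bar> / (\<bar>q v\<bar> * \<bar>q w\<bar>)"
      using nz by (simp add: inverse_eq_divide divide_simps abs_divide abs_mult abs_minus_commute)
    also have "\<dots> \<le> (L * dist v w) / (m * m)"
      using lipschitz_onD[OF r(2) vw] lower vw m L
      by (intro frac_le mult_mono) (auto simp: dist_real_def)
    finally show "dist (inverse (q v)) (inverse (q w)) \<le> L / m\<^sup>2 * dist v w"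
      by (simp add: dist_real_def power2_eq_square)
  qed (use L in auto)
  then show ?thesis using r(1) unfolding locally_lipschitz_at_def by blast
qed

lemma locally_lipschitz_at_vec:
  fixes h :: "'a::metric_space \<Rightarrow> real^2"
  assumes "\<And>i. locally_lipschitz_at u (\<lambda>v. h v $ i)"
  shows "locally_lipschitz_at u h"
proof -
  obtain r L where r: "0 < r" "L-lipschitz_on (cball u r) (\<lambda>v. h v $ 1)" "L-lipschitz_on (cball u r) (\<lambda>v. h v $ 2)"
    using locally_lipschitz_at_common[OF assms assms] by metis
  have "(L + L)-lipschitz_on (cball u r) h"
  proof (rule lipschitz_onI)
    fix v w assume vw: "v \<in> cball u r" "w \<in> cball u r"
    have "dist (h v) (h w) \<le> (\<Sum>i\<in>UNIV. \<bar>(h v - h w) $ i\<bar>)" unfolding dist_norm by (rule norm_le_l1_cart)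
    also have "\<dots> \<le> L * dist v w + L * dist v w"
      using lipschitz_onD[OF r(2) vw] lipschitz_onD[OF r(3) vw] by (simp add: sum_2 dist_real_def)
    finally show "dist (h v) (h w) \<le> (L + L) * dist v w" by (simp add: algebra_simps)
  qed (use lipschitz_on_nonneg[OF r(2)] in auto)
  then show ?thesis using r(1) unfolding locally_lipschitz_at_def by blast
qed

lemma locally_lipschitz_at_component:
  fixes h :: "'a::metric_space \<Rightarrow> 'b::real_normed_vector^'n"
  assumes "locally_lipschitz_at u h"
  shows "locally_lipschitz_at u (\<lambda>v. h v $ i)"
proof -
  obtain r L where r: "0 < r" "L-lipschitz_on (cball u r) h" using assms unfolding locally_lipschitz_at_def by blast
  have "L-lipschitz_on (cball u r) (\<lambda>v. h v $ i)"
    using r(2) unfolding lipschitz_on_def by (meson dist_vec_nth_le order_trans)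
  then show ?thesis using r(1) unfolding locally_lipschitz_at_def by blast
qed

lemma locally_lipschitz_at_cong:
  assumes "locally_lipschitz_at u h" "open S" "u \<in> S" "\<And>v. v \<in> S \<Longrightarrow> h v = k v"
  shows "locally_lipschitz_at u k"
proof -
  obtain r L where r: "0 < r" "L-lipschitz_on (cball u r) h"
    using assms(1) unfolding locally_lipschitz_at_def by blast
  obtain e where e: "0 < e" "cball u e \<subseteq> S" using assms(2,3) open_contains_cball by blast
  have "L-lipschitz_on (cball u (min r e)) h" by (rule lipschitz_on_subset[OF r(2)]) auto
  then have "L-lipschitz_on (cball u (min r e)) k"
    by (rule lipschitz_on_transform) (use e assms(4) in force)
  then show ?thesis using r e unfolding locally_lipschitz_at_def by (metis min_less_iff_conj)
qed

text \<open>Cramer's rule writes the solution of a linear system as a rational function of its coefficients.\<close>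

lemma locally_lipschitz_at_linear_system:
  fixes G :: "'a::metric_space \<Rightarrow> real^2^2" and b :: "'a \<Rightarrow> real^2"
  assumes G: "locally_lipschitz_at u G" and b: "locally_lipschitz_at u b" and det: "det (G u) \<noteq> 0"
    and S: "open S" "u \<in> S" and x: "\<And>v. v \<in> S \<Longrightarrow> det (G v) \<noteq> 0 \<and> G v *v x v = b v"
  shows "locally_lipschitz_at u x"
proof (rule locally_lipschitz_at_vec)
  fix k :: 2
  define N where "N v = det (\<chi> i j. if j = k then b v $ i else G v $ i $ j)" for v
  note comp = locally_lipschitz_at_component[OF b]
    locally_lipschitz_at_component[OF locally_lipschitz_at_component[OF G]]
  have entry: "locally_lipschitz_at u (\<lambda>v. if j = k then b v $ i else G v $ i $ j)" for i j
    by (cases "j = k") (simp_all add: comp)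
  have "locally_lipschitz_at u N"
    unfolding N_def det_2 vec_lambda_beta
    by (intro locally_lipschitz_at_diff locally_lipschitz_at_mult entry)
  moreover have "locally_lipschitz_at u (\<lambda>v. det (G v))"
    unfolding det_2 by (intro locally_lipschitz_at_diff locally_lipschitz_at_mult comp)
  then have "locally_lipschitz_at u (\<lambda>v. inverse (det (G v)))"
    by (rule locally_lipschitz_at_inverse) (rule det)
  ultimately have "locally_lipschitz_at u (\<lambda>v. N v * inverse (det (G v)))"
    by (rule locally_lipschitz_at_mult)
  then show "locally_lipschitz_at u (\<lambda>v. x v $ k)"
  proof (rule locally_lipschitz_at_cong[OF _ S])
    fix v assume v: "v \<in> S"
    then have "x v = (\<chi> k. det (\<chi> i j. if j = k then b v $ i else G v $ i $ j) / det (G v))"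
      using cramer[of "G v" "x v" "b v"] x by blast
    then show "N v * inverse (det (G v)) = x v $ k" by (simp add: N_def divide_inverse)
  qed
qed

lemma positive_definite_inverse:
  fixes G :: "real^2^2"
  assumes pd: "\<And>v. v \<noteq> 0 \<Longrightarrow> v \<bullet> (G *v v) > 0"
  shows "det G \<noteq> 0" "G *v (matrix_inv G *v d) = d" "matrix_inv G *v (G *v d) = d"
proof -
  have "\<forall>x. G *v x = 0 \<longrightarrow> x = 0" using pd by force
  then obtain B where B: "B ** G = mat 1" using matrix_left_invertible_ker[of G] by blast
  then have "G ** B = mat 1" using matrix_left_right_inverse by blast
  then have inv: "G ** matrix_inv G = mat 1 \<and> matrix_inv G ** G = mat 1"
    using B unfolding matrix_inv_def
    by (intro someI[of "\<lambda>A'. G ** A' = mat 1 \<and> A' ** G = mat 1" B] conjI)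
  show "det G \<noteq> 0" using B by (metis det_I det_mul mult_zero_right zero_neq_one)
  show "G *v (matrix_inv G *v d) = d" "matrix_inv G *v (G *v d) = d"
    using inv by (simp_all add: matrix_vector_mul_assoc)
qed


section \<open>The gradient field of a Morse function\<close>

abbreviation neg_gradient ::
    "('m chart \<Rightarrow> 'm \<Rightarrow> real^2^2) \<Rightarrow> ('m \<Rightarrow> real) \<Rightarrow> 'm chart \<Rightarrow> 'm \<Rightarrow> real^2" where
  "neg_gradient g F \<equiv> \<lambda>c x. - gradient g c F x"

text \<open>The content of \<open>morse_on\<close> for open \<open>U\<close>, with the derivatives
  taken of \<open>F\<close> itself instead of an unspecified extension.\<close>

locale morse_gradient =
  fixes A :: "'m::t2_space chart set" and g :: "'m chart \<Rightarrow> 'm \<Rightarrow> real^2^2"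
    and U :: "'m set" and F :: "'m \<Rightarrow> real"
  assumes atlas: "smooth_atlas A" and metric: "riemannian_metric A g" and open_U: "open U"
    and smooth_F: "smooth_function A U F"
    and nondegenerate: "\<And>x. x \<in> U \<Longrightarrow> critical_point A F x \<Longrightarrow> nondegenerate_at A F x"
begin

definition dF :: "'m chart \<Rightarrow> real^2 \<Rightarrow> real^2" where
  "dF c u = (\<chi> i. partial_deriv i (F \<circ> chart_inv c) u)"

definition crit :: "'m set" where
  "crit = {x\<in>U. critical_point A F x}"

lemma chart_at: obtains c where "c \<in> A" "x \<in> fst c"
  using atlas unfolding smooth_atlas_def by (metis UNIV_I UN_E)

lemma image_open: "c \<in> A \<Longrightarrow> open (snd c ` (fst c \<inter> U))"
  by (rule chart_image_open[OF atlas _ open_U])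

lemma inv: "c \<in> A \<Longrightarrow> x \<in> fst c \<Longrightarrow> chart_inv c (snd c x) = x"
  by (rule chart_inv_chart[OF atlas])

lemma smooth_chart: "c \<in> A \<Longrightarrow> smooth_on (snd c ` (fst c \<inter> U)) (F \<circ> chart_inv c)"
  using smooth_F by (simp add: smooth_function_def)

lemma F_has_derivative:
  assumes "c \<in> A" "x \<in> fst c" "x \<in> U"
  shows "((F \<circ> chart_inv c) has_derivative (\<lambda>w. dF c (snd c x) \<bullet> w)) (at (snd c x))"
proof -
  have "(F \<circ> chart_inv c) differentiable (at (snd c x))"
    by (rule smooth_on_differentiable[OF smooth_chart[OF assms(1)]]) (use assms in auto)
  then show ?thesis unfolding dF_def frechet_derivative_partial[symmetric, OF \<open>_ differentiable _\<close>]
    by (simp add: frechet_derivative_works)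
qed

lemma metric_pos: "c \<in> A \<Longrightarrow> x \<in> fst c \<Longrightarrow> v \<noteq> 0 \<Longrightarrow> v \<bullet> (g c x *v v) > 0"
  using metric by (simp add: riemannian_metric_def)

lemma gradient_eq: "c \<in> A \<Longrightarrow> x \<in> fst c \<Longrightarrow> gradient g c F x = matrix_inv (g c x) *v dF c (snd c x)"
  by (simp add: gradient_def dF_def)

lemma metric_gradient: "c \<in> A \<Longrightarrow> x \<in> fst c \<Longrightarrow> g c x *v gradient g c F x = dF c (snd c x)"
  using positive_definite_inverse(2)[OF metric_pos] by (simp add: gradient_eq)

text \<open>The gradient represents \<open>dF\<close> through the metric. The tensor law for
  \<open>g\<close> and the chain rule for \<open>dF\<close> show that \<open>J\<close> applied to
  the gradient in \<open>c\<close> represents \<open>dF\<close> in \<open>c'\<close>, when tested on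
  vectors of the form \<open>J *v v\<close>; these are all vectors.\<close>

lemma gradient_transformation:
  assumes c: "c \<in> A" "c' \<in> A" "x \<in> fst c" "x \<in> fst c'" and x: "x \<in> U"
  shows "gradient g c' F x = frechet_derivative (snd c' \<circ> chart_inv c) (at (snd c x)) (gradient g c F x)"
proof -
  let ?D = "frechet_derivative (snd c' \<circ> chart_inv c) (at (snd c x))"
  define J where "J = matrix ?D"
  have dD: "((snd c' \<circ> chart_inv c) has_derivative ?D) (at (snd c x))"
    by (rule transition_has_derivative[OF atlas c])
  have J: "J *v v = ?D v" for v
    unfolding J_def using has_derivative_linear[OF dD]
    by (intro matrix_works) (simp add: linear_matrix_vector_mul_eq)
  have gJ: "g c x = transpose J ** g c' x ** J"
    using metric c unfolding riemannian_metric_def J_def Let_def by blast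
  have form: "v \<bullet> (g c x *v w) = (J *v v) \<bullet> (g c' x *v (J *v w))" for v w
    unfolding gJ matrix_vector_mul_assoc[symmetric] transpose_matrix_vector
    by (metis dot_lmul_matrix inner_commute)
  have d: "dF c (snd c x) \<bullet> v = dF c' (snd c' x) \<bullet> (J *v v)" for v
  proof -
    have o: "open (snd c ` (fst c \<inter> (fst c' \<inter> U)))"
      by (rule chart_image_open[OF atlas c(1)]) (intro open_Int open_U chart_open[OF atlas c(2)])
    have "((F \<circ> chart_inv c') has_derivative (\<lambda>w. dF c' (snd c' x) \<bullet> w)) (at ((snd c' \<circ> chart_inv c) (snd c x)))"
      using F_has_derivative[OF c(2,4) x] inv[OF c(1,3)] by simp
    then have "((F \<circ> chart_inv c') \<circ> (snd c' \<circ> chart_inv c) has_derivative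
        (\<lambda>w. dF c' (snd c' x) \<bullet> w) \<circ> ?D) (at (snd c x))"
      by (rule diff_chain_at[OF dD])
    then have "((F \<circ> chart_inv c) has_derivative (\<lambda>w. dF c' (snd c' x) \<bullet> w) \<circ> ?D) (at (snd c x))"
      by (rule has_derivative_transform_within_open[OF _ o]) (use c x inv in auto)
    from has_derivative_unique[OF F_has_derivative[OF c(1,3) x] this]
    show ?thesis by (simp add: fun_eq_iff J)
  qed
  \<comment> \<open>Positive definiteness of the metric in \<open>c\<close> makes \<open>J\<close>
    injective, hence surjective by dimension.\<close>
  have "J *v v = 0 \<Longrightarrow> v = 0" for v
    using form[of v v] metric_pos[OF c(1,3), of v] by force
  then have "inj ((*v) J)" by (intro iffD2[OF linear_injective_0]) auto
  then have surj: "surj ((*v) J)" by (rule linear_inj_imp_surj[OF matrix_vector_mul_linear])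
  have "g c' x *v (J *v gradient g c F x) = dF c' (snd c' x)"
  proof (rule vector_eq_rdot[THEN iffD1], intro allI)
    fix w
    obtain v where w: "w = J *v v" using surj by (metis surjD)
    show "(g c' x *v (J *v gradient g c F x)) \<bullet> w = dF c' (snd c' x) \<bullet> w"
      unfolding w using form[of v "gradient g c F x"] d[of v] metric_gradient[OF c(1,3)]
      by (simp add: inner_commute)
  qed
  then have "J *v gradient g c F x = matrix_inv (g c' x) *v dF c' (snd c' x)"
    using positive_definite_inverse(3)[OF metric_pos[OF c(2,4)]] by metis
  then show ?thesis by (simp add: J gradient_eq[OF c(2,4)])
qed

text \<open>The gradient solves a linear system with matrix \<open>g\<close> and right-hand side
  \<open>dF\<close>, both smooth in the chart.\<close>

lemma gradient_locally_lipschitz: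
  assumes c: "c \<in> A" "x \<in> fst c" and x: "x \<in> U"
  shows "locally_lipschitz_at (snd c x) (\<lambda>u. gradient g c F (chart_inv c u))"
proof (rule locally_lipschitz_at_linear_system)
  let ?S = "snd c ` (fst c \<inter> U)"
  show "open ?S" "snd c x \<in> ?S" using image_open c x by auto
  have "smooth_on ?S (\<lambda>u. g c (chart_inv c u))"
    by (rule smooth_on_subset[of "snd c ` fst c"]) (use metric c in \<open>auto simp: riemannian_metric_def\<close>)
  then show "locally_lipschitz_at (snd c x) (\<lambda>u. g c (chart_inv c u))"
    using image_open c x by (intro smooth_locally_lipschitz[of ?S]) auto
  show "locally_lipschitz_at (snd c x) (dF c)"
  proof (rule locally_lipschitz_at_vec)
    show "locally_lipschitz_at (snd c x) (\<lambda>v. dF c v $ i)" for i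
      using image_open c x smooth_on_partial_deriv[OF smooth_chart]
      by (simp add: dF_def) (intro smooth_locally_lipschitz[of ?S], auto)
  qed
  show "det (g c (chart_inv c (snd c x))) \<noteq> 0"
    using positive_definite_inverse(1)[OF metric_pos[OF c]] inv[OF c] by simp
  show "det (g c (chart_inv c u)) \<noteq> 0 \<and> g c (chart_inv c u) *v gradient g c F (chart_inv c u) = dF c u"
    if u: "u \<in> ?S" for u
  proof -
    obtain y where y: "y \<in> fst c" "u = snd c y" using u by auto
    show ?thesis
      using positive_definite_inverse(1)[OF metric_pos[OF c(1) y(1)]] metric_gradient[OF c(1) y(1)]
        inv[OF c(1) y(1)] y(2) by simp
  qed
qed

lemma neg_gradient_chart_field: "chart_field A U (neg_gradient g F)"
proof -
  interpret chart_field A U "\<lambda>c x. gradient g c F x"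
  proof
    show "smooth_atlas A" "open U" by (fact atlas open_U)+
    show "gradient g c' F x = frechet_derivative (snd c' \<circ> chart_inv c) (at (snd c x)) (gradient g c F x)"
      if "c \<in> A" "c' \<in> A" "x \<in> fst c" "x \<in> fst c'" "x \<in> U" for c c' x
      by (rule gradient_transformation[OF that])
    show "\<exists>r>0. \<exists>L. L-lipschitz_on (cball (snd c x) r) (\<lambda>u. gradient g c F (chart_inv c u))"
      if "c \<in> A" "x \<in> fst c" "x \<in> U" for c x
      using gradient_locally_lipschitz[OF that] by (simp add: locally_lipschitz_at_def)
  qed
  show ?thesis by (rule reverse_chart_field)
qed

lemma dF_zero: "x \<in> crit \<Longrightarrow> c \<in> A \<Longrightarrow> x \<in> fst c \<Longrightarrow> dF c (snd c x) = 0"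
  by (auto simp: crit_def critical_point_def dF_def vec_eq_iff)

lemma noncritical_chart:
  assumes "x \<in> U" "x \<notin> crit"
  obtains c where "c \<in> A" "x \<in> fst c" "dF c (snd c x) \<noteq> 0"
proof -
  obtain c i where "c \<in> A" "x \<in> fst c" "partial_deriv i (F \<circ> chart_inv c) (snd c x) \<noteq> 0"
    using assms unfolding crit_def critical_point_def by blast
  moreover from this have "dF c (snd c x) $ i \<noteq> 0" by (simp add: dF_def)
  ultimately show ?thesis using that by (metis zero_index)
qed

lemma crit_reaches:
  assumes x: "x \<in> crit" and t: "0 \<le> t"
  shows "reaches A U (neg_gradient g F) t x x"
  unfolding reaches_def integral_curve_def
proof (intro conjI exI[of _ "\<lambda>_. x"] ballI impI t)
  show "(snd c \<circ> (\<lambda>_. x) has_vector_derivative - gradient g c F x) (at s within {0..t})"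
    if "c \<in> A" "x \<in> fst c" for s c
    using dF_zero[OF x that] gradient_eq[OF that] by (simp add: comp_def)
qed (use x in \<open>auto simp: crit_def\<close>)

lemma continuous_F: "continuous_on U F"
proof (rule continuous_at_imp_continuous_on, rule ballI)
  fix x assume x: "x \<in> U"
  obtain c where c: "c \<in> A" "x \<in> fst c" by (rule chart_at)
  have "isCont (F \<circ> chart_inv c) (snd c x)" by (rule has_derivative_continuous[OF F_has_derivative[OF c x]])
  moreover have "isCont (snd c) x"
    using chart_continuous[OF atlas c(1)] chart_open[OF atlas c(1)] c(2) by (simp add: continuous_on_eq_continuous_at)
  ultimately have "isCont (\<lambda>y. (F \<circ> chart_inv c) (snd c y)) x"
    using isCont_o2[of x "snd c"] by blast
  moreover have "eventually (\<lambda>y. (F \<circ> chart_inv c) (snd c y) = F y) (nhds x)"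
    unfolding eventually_nhds using chart_open[OF atlas c(1)] c inv by (intro exI[of _ "fst c"]) auto
  ultimately show "isCont F x" by (simp add: isCont_cong)
qed

section \<open>Descent along the gradient flow and isolation of critical points\<close>

text \<open>Since \<open>dF\<close> is \<open>g\<close> applied to the gradient, the value is minus
  the squared length of the gradient.\<close>

lemma F_along_curve:
  assumes \<gamma>: "integral_curve A U (neg_gradient g F) I \<gamma>" and s: "s \<in> I"
    and c: "c \<in> A" "\<gamma> s \<in> fst c"
  shows "((F \<circ> \<gamma>) has_vector_derivative - (dF c (snd c (\<gamma> s)) \<bullet> gradient g c F (\<gamma> s))) (at s within I)"
proof -
  have U: "\<gamma> s \<in> U" and cont: "continuous_on I \<gamma>"
    and d: "((snd c \<circ> \<gamma>) has_derivative (\<lambda>h. h *\<^sub>R - gradient g c F (\<gamma> s))) (at s within I)"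
    using \<gamma> s c by (auto simp: integral_curve_def has_vector_derivative_def)
  have "((F \<circ> chart_inv c) has_derivative (\<lambda>w. dF c (snd c (\<gamma> s)) \<bullet> w)) (at ((snd c \<circ> \<gamma>) s))"
    using F_has_derivative[OF c U] by simp
  then have "((F \<circ> chart_inv c) has_derivative (\<lambda>w. dF c (snd c (\<gamma> s)) \<bullet> w))
      (at ((snd c \<circ> \<gamma>) s) within (snd c \<circ> \<gamma>) ` I)"
    by (rule has_derivative_at_withinI)
  then have "((F \<circ> chart_inv c) \<circ> (snd c \<circ> \<gamma>) has_derivative
      (\<lambda>w. dF c (snd c (\<gamma> s)) \<bullet> w) \<circ> (\<lambda>h. h *\<^sub>R - gradient g c F (\<gamma> s))) (at s within I)"
    by (rule diff_chain_within[OF d])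
  then have "((\<lambda>r. (F \<circ> chart_inv c) (snd c (\<gamma> r))) has_vector_derivative
      - (dF c (snd c (\<gamma> s)) \<bullet> gradient g c F (\<gamma> s))) (at s within I)"
    by (simp add: has_vector_derivative_def comp_def)
  moreover have "eventually (\<lambda>r. \<gamma> r \<in> fst c) (at s within I)"
    using cont s c chart_open[OF atlas c(1)] by (auto simp: continuous_on_def intro: topological_tendstoD)
  then have "eventually (\<lambda>r. (F \<circ> chart_inv c) (snd c (\<gamma> r)) = (F \<circ> \<gamma>) r) (at s within I)"
    by eventually_elim (use inv c in auto)
  ultimately show ?thesis
    unfolding has_vector_derivative_def
    by (rule has_derivative_transform_eventually) (use s c inv in auto)
qed

text \<open>A solution from a noncritical point never becomes critical, by backward uniqueness
  against the constant solution. Hence the derivative of \<open>F\<close> along it is negative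
  throughout.\<close>

lemma F_less:
  assumes R: "reaches A U (neg_gradient g F) t x y" and t: "0 < t" and x: "x \<notin> crit"
  shows "F y < F x"
proof -
  interpret X: chart_field A U "neg_gradient g F" by (rule neg_gradient_chart_field)
  interpret Y: chart_field A U "\<lambda>c x. - neg_gradient g F c x" by (rule X.reverse_chart_field)
  obtain \<gamma> where \<gamma>: "integral_curve A U (neg_gradient g F) {0..t} \<gamma>" "\<gamma> 0 = x" "\<gamma> t = y"
    using R by (auto simp: reaches_def)
  have neg: "\<exists>d. ((F \<circ> \<gamma>) has_vector_derivative d) (at s within {0..t}) \<and> d < 0" if s: "s \<in> {0..t}" for s
  proof -
    have U: "\<gamma> s \<in> U" using \<gamma> s by (auto simp: integral_curve_def)
    have "\<gamma> s \<notin> crit"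
    proof
      assume cr: "\<gamma> s \<in> crit"
      have "reaches A U (neg_gradient g F) s x (\<gamma> s)"
        unfolding reaches_def using s \<gamma> by (intro conjI exI[of _ \<gamma>] integral_curve_subset[OF \<gamma>(1)]) auto
      moreover have "reaches A U (neg_gradient g F) s (\<gamma> s) (\<gamma> s)"
        by (rule crit_reaches[OF cr]) (use s in auto)
      ultimately have "x = \<gamma> s"
        using Y.reaches_det[of s "\<gamma> s" x "\<gamma> s"] reaches_reverse[of A U "neg_gradient g F"] by blast
      then show False using x cr by simp
    qed
    then obtain c where c: "c \<in> A" "\<gamma> s \<in> fst c" "dF c (snd c (\<gamma> s)) \<noteq> 0"
      using noncritical_chart[OF U] by blast
    define v where "v = gradient g c F (\<gamma> s)"
    have gv: "g c (\<gamma> s) *v v = dF c (snd c (\<gamma> s))" unfolding v_def by (rule metric_gradient[OF c(1,2)])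
    then have "v \<noteq> 0" using c(3) by auto
    then have "dF c (snd c (\<gamma> s)) \<bullet> v > 0" using metric_pos[OF c(1,2), of v] gv by (simp add: inner_commute)
    then show ?thesis using F_along_curve[OF \<gamma>(1) s c(1,2)] unfolding v_def by force
  qed
  have "(F \<circ> \<gamma>) t < (F \<circ> \<gamma>) 0"
  proof (rule DERIV_neg_imp_decreasing_open[OF t])
    show "continuous_on {0..t} (F \<circ> \<gamma>)"
      using neg has_vector_derivative_continuous continuous_on_eq_continuous_within by blast
    fix s assume s: "0 < s" "s < t"
    then obtain d where "((F \<circ> \<gamma>) has_vector_derivative d) (at s within {0..t})" "d < 0" using neg[of s] by auto
    then show "\<exists>d. ((F \<circ> \<gamma>) has_real_derivative d) (at s) \<and> d < 0"
      using s by (auto simp: at_within_Icc_at has_real_derivative_iff_has_vector_derivative)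
  qed
  then show ?thesis using \<gamma> by simp
qed

lemma local_extremum_crit:
  assumes x: "x \<in> U" and ext: "eventually (\<lambda>y. F x \<le> F y) (nhds x) \<or> eventually (\<lambda>y. F y \<le> F x) (nhds x)"
  shows "x \<in> crit"
proof -
  have "dF c (snd c x) = 0" if c: "c \<in> A" "x \<in> fst c" for c
  proof -
    obtain B where B: "open B" "x \<in> B" "(\<forall>y\<in>B. F x \<le> F y) \<or> (\<forall>y\<in>B. F y \<le> F x)"
      using ext unfolding eventually_nhds by blast
    have "(\<lambda>w. dF c (snd c x) \<bullet> w) = (\<lambda>v. 0)"
    proof (rule differential_zero_maxmin[OF _ _ F_has_derivative[OF c x]])
      show "snd c x \<in> snd c ` (fst c \<inter> B)" using c B by auto
      show "open (snd c ` (fst c \<inter> B))" by (rule chart_image_open[OF atlas c(1) B(1)])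
      show "(\<forall>u\<in>snd c ` (fst c \<inter> B). (F \<circ> chart_inv c) u \<le> (F \<circ> chart_inv c) (snd c x)) \<or>
        (\<forall>u\<in>snd c ` (fst c \<inter> B). (F \<circ> chart_inv c) (snd c x) \<le> (F \<circ> chart_inv c) u)"
        using B(3) c inv by auto
    qed
    then have "dF c (snd c x) \<bullet> dF c (snd c x) = 0" by meson
    then show ?thesis by simp
  qed
  then show ?thesis using x by (auto simp: crit_def critical_point_def dF_def vec_eq_iff)
qed

text \<open>The transpose reflects the order of indices: entry (i, j) of \<open>hessian\<close>
  differentiates the j-th partial derivative in direction i, whereas row j of a derivative matrix
  belongs to the j-th component.\<close>

lemma dF_has_derivative:
  assumes c: "c \<in> A" "x \<in> fst c" and x: "x \<in> U"
  shows "(dF c has_derivative (\<lambda>w. transpose (hessian c F x) *v w)) (at (snd c x))"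
proof -
  have "(dF c has_derivative (\<lambda>w. \<chi> j. (\<chi> i. partial_deriv i (partial_deriv j (F \<circ> chart_inv c)) (snd c x)) \<bullet> w)) (at (snd c x))"
    unfolding has_derivative_componentwise_within[of "dF c"]
  proof
    fix b :: "real^2" assume "b \<in> Basis"
    then obtain j where b: "b = axis j 1" by (auto simp: Basis_vec_def)
    have "partial_deriv j (F \<circ> chart_inv c) differentiable (at (snd c x))"
      by (rule smooth_on_differentiable[OF smooth_on_partial_deriv[OF smooth_chart[OF c(1)]]]) (use c x in auto)
    then have "(partial_deriv j (F \<circ> chart_inv c) has_derivative
       (\<lambda>w. (\<chi> i. partial_deriv i (partial_deriv j (F \<circ> chart_inv c)) (snd c x)) \<bullet> w)) (at (snd c x))"
      by (simp add: frechet_derivative_partial[symmetric] frechet_derivative_works)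
    then show "((\<lambda>u. dF c u \<bullet> b) has_derivative
       (\<lambda>w. (\<chi> j. (\<chi> i. partial_deriv i (partial_deriv j (F \<circ> chart_inv c)) (snd c x)) \<bullet> w) \<bullet> b)) (at (snd c x))"
      by (simp add: b dF_def inner_axis)
  qed
  moreover have "(\<lambda>w. \<chi> j. (\<chi> i. partial_deriv i (partial_deriv j (F \<circ> chart_inv c)) (snd c x)) \<bullet> w) =
      (\<lambda>w. transpose (hessian c F x) *v w)"
    by (simp add: fun_eq_iff vec_eq_iff hessian_def transpose_def matrix_vector_mult_def inner_vec_def
        del: transpose_matrix_vector)
  ultimately show ?thesis by simp
qed

lemma crit_isolated:
  assumes x: "x \<in> U"
  shows "\<exists>W. open W \<and> x \<in> W \<and> W \<inter> crit \<subseteq> {x}"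
proof -
  \<comment> \<open>\<open>critical_point\<close> requires vanishing in all charts, so for a
    noncritical point the chart is one in which \<open>dF\<close> does not vanish.\<close>
  obtain c where c: "c \<in> A" "x \<in> fst c" and alt: "dF c (snd c x) \<noteq> 0 \<or> x \<in> crit"
  proof (cases "x \<in> crit")
    case True
    then show ?thesis using that chart_at by metis
  next
    case False
    then show ?thesis using that noncritical_chart[OF x] by metis
  qed
  let ?u = "snd c x"
  note d = dF_has_derivative[OF c x]
  have "\<exists>e>0. \<forall>u. dist u ?u < e \<longrightarrow> u = ?u \<or> dF c u \<noteq> 0"
  proof (cases "dF c ?u = 0")
    case False
    have "isCont (dF c) ?u" by (rule has_derivative_continuous[OF d])
    then obtain e where "e > 0" "\<forall>u. dist u ?u < e \<longrightarrow> dist (dF c u) (dF c ?u) < norm (dF c ?u)"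
      using False unfolding continuous_at_eps_delta by (metis zero_less_norm_iff)
    then show ?thesis by (intro exI[of _ e]) (auto simp: dist_norm)
  next
    case True
    let ?H = "transpose (hessian c F x)"
    have "det ?H \<noteq> 0"
      using nondegenerate[OF x] alt True c by (auto simp: crit_def nondegenerate_at_def)
    then have "invertible ?H" unfolding invertible_det_nz .
    then have "inj ((*v) ?H)" unfolding invertible_eq_bij by (rule bij_is_inj)
    then obtain m where m: "m > 0" "\<And>w. m * norm w \<le> norm (?H *v w)"
      using linear_inj_bounded_below_pos[of "(*v) ?H"] by (metis matrix_vector_mul_linear)
    \<comment> \<open>An error of \<open>m / 2\<close> against the lower bound \<open>m\<close> for
      the invertible linear part leaves \<open>dF\<close> nonzero off the centre.\<close>
    obtain e where e: "e > 0" "\<And>u. norm (u - ?u) < e \<Longrightarrow>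
        norm (dF c u - dF c ?u - ?H *v (u - ?u)) \<le> (m / 2) * norm (u - ?u)"
      using d m(1) unfolding has_derivative_at_alt by (metis half_gt_zero)
    have "dF c u \<noteq> 0" if u: "dist u ?u < e" "u \<noteq> ?u" for u
    proof
      assume "dF c u = 0"
      then have "m * norm (u - ?u) \<le> (m / 2) * norm (u - ?u)"
        using e(2)[of u] m(2)[of "u - ?u"] u True by (simp add: dist_norm del: transpose_matrix_vector)
      then show False using m(1) u(2) by (simp add: mult_le_cancel_right)
    qed
    then show ?thesis using e(1) by blast
  qed
  then obtain e where e: "e > 0" "\<And>u. dist u ?u < e \<Longrightarrow> u = ?u \<or> dF c u \<noteq> 0" by blast
  have "open (fst c \<inter> snd c -` ball ?u e)"
    by (rule continuous_open_preimage[OF chart_continuous[OF atlas c(1)] chart_open[OF atlas c(1)] open_ball])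
  moreover have "y = x" if "y \<in> fst c \<inter> snd c -` ball ?u e" "y \<in> crit" for y
    using e(2)[of "snd c y"] dF_zero[OF that(2) c(1)] that(1) c inj_onD[OF chart_inj[OF atlas c(1)], of y x]
    by (auto simp: dist_commute)
  ultimately show ?thesis using c e(1) by (intro exI[of _ "fst c \<inter> snd c -` ball ?u e"]) auto
qed

end


section \<open>The domain near its boundary\<close>

text \<open>In coordinates with \<open>F\<close> as the i-th one, the frontier lies on the zero
  line, so each open half disc is inside or outside \<open>M\<close> as a whole. If both were
  inside, the centre would be interior; both outside contradicts that \<open>M\<close> is the
  closure of its interior.\<close>

lemma one_sided_coordinate:
  fixes \<theta> :: "real^2 \<Rightarrow> 'm::topological_space"
  assumes \<theta>: "continuous_on (ball a e) \<theta>" "open (\<theta> ` ball a e)" and e: "0 < e" "a $ i = 0"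
    and F: "\<And>w. w \<in> ball a e \<Longrightarrow> F (\<theta> w) = w $ i"
    and M: "closed M" "M = closure (interior M)" "\<theta> a \<in> frontier M"
    and zero: "\<And>x. x \<in> frontier M \<Longrightarrow> F x = (0::real)"
  shows "(\<forall>z\<in>\<theta> ` ball a e. z \<in> M \<longleftrightarrow> 0 \<le> F z) \<or> (\<forall>z\<in>\<theta> ` ball a e. z \<in> M \<longleftrightarrow> F z \<le> 0)"
proof -
  define P where "P = ball a e \<inter> {w. 0 < w $ i}"
  define N where "N = ball a e \<inter> {w. w $ i < 0}"
  have "convex {w::real^2. 0 < w $ i}" "convex {w::real^2. w $ i < 0}"
    using convex_halfspace_gt[of 0 "axis i 1 :: real^2"] convex_halfspace_lt[of "axis i 1 :: real^2" 0]
    by (simp_all add: inner_axis' )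
  then have conn: "connected P" "connected N"
    unfolding P_def N_def by (auto intro: convex_connected convex_Int)
  have side: "\<theta> ` C \<subseteq> M \<or> \<theta> ` C \<inter> M = {}" if "connected C" "C \<subseteq> ball a e" "\<forall>w\<in>C. w $ i \<noteq> 0" for C
  proof -
    have "connected (\<theta> ` C)"
      using that \<theta>(1) by (intro connected_continuous_image) (auto intro: continuous_on_subset)
    moreover have "\<theta> ` C \<inter> frontier M = {}" using that F zero by fastforce
    ultimately show ?thesis using connected_Int_frontier[of "\<theta> ` C" M] by blast
  qed
  have sideP: "\<theta> ` P \<subseteq> M \<or> \<theta> ` P \<inter> M = {}" by (rule side[OF conn(1)]) (auto simp: P_def)
  have sideN: "\<theta> ` N \<subseteq> M \<or> \<theta> ` N \<inter> M = {}" by (rule side[OF conn(2)]) (auto simp: N_def)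
  \<comment> \<open>Every point of the zero line is approached from both half discs, so by
    closedness it belongs to \<open>M\<close> as soon as one half does.\<close>
  have near: "\<theta> ` P \<inter> B \<noteq> {}" "\<theta> ` N \<inter> B \<noteq> {}"
    if w: "w \<in> ball a e" "w $ i = 0" and B: "open B" "\<theta> w \<in> B" for w B
  proof -
    have "open (ball a e \<inter> \<theta> -` B)" by (rule continuous_open_preimage[OF \<theta>(1) open_ball B(1)])
    then obtain d where d: "0 < d" "ball w d \<subseteq> ball a e \<inter> \<theta> -` B"
      using w B unfolding open_contains_ball by blast
    have "w + (d/2) *\<^sub>R axis i 1 \<in> ball w d" "w - (d/2) *\<^sub>R axis i 1 \<in> ball w d"
      using d(1) by (auto simp: dist_norm norm_axis_1)
    then have mem: "w + (d/2) *\<^sub>R axis i 1 \<in> ball a e \<inter> \<theta> -` B" "w - (d/2) *\<^sub>R axis i 1 \<in> ball a e \<inter> \<theta> -` B"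
      using d(2) by blast+
    have "(w + (d/2) *\<^sub>R axis i 1) $ i > 0" "(w - (d/2) *\<^sub>R axis i 1) $ i < 0"
      using w d(1) by (simp_all add: axis_def)
    then have "w + (d/2) *\<^sub>R axis i 1 \<in> P" "w - (d/2) *\<^sub>R axis i 1 \<in> N"
      using mem by (auto simp: P_def N_def)
    then show "\<theta> ` P \<inter> B \<noteq> {}" "\<theta> ` N \<inter> B \<noteq> {}" using mem by blast+
  qed
  have limit: "\<theta> w \<in> M" if w: "w \<in> ball a e" "w $ i = 0" and "\<theta> ` P \<subseteq> M \<or> \<theta> ` N \<subseteq> M" for w
    using near[OF w, of "- M"] M(1) that(3) by (auto simp: open_Compl)
  have split: "z \<in> \<theta> ` P \<or> z \<in> \<theta> ` N \<or> (\<exists>w\<in>ball a e. w $ i = 0 \<and> z = \<theta> w)" if z: "z \<in> \<theta> ` ball a e" for z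
  proof -
    obtain w where "w \<in> ball a e" "z = \<theta> w" using z by blast
    then show ?thesis by (cases "w $ i" "0::real" rule: linorder_cases) (auto simp: P_def N_def)
  qed
  have sign: "0 < F z" if "z \<in> \<theta> ` P" for z using that F by (auto simp: P_def)
  have sign': "F z < 0" if "z \<in> \<theta> ` N" for z using that F by (auto simp: N_def)
  have not_both: "\<not> (\<theta> ` P \<subseteq> M \<and> \<theta> ` N \<subseteq> M)"
  proof
    assume *: "\<theta> ` P \<subseteq> M \<and> \<theta> ` N \<subseteq> M"
    have "\<theta> ` ball a e \<subseteq> M"
    proof
      fix z assume "z \<in> \<theta> ` ball a e"
      from split[OF this] show "z \<in> M" using * limit by auto
    qed
    then have "\<theta> a \<in> interior M" using e \<theta>(2) by (meson centre_in_ball image_eqI interiorI)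
    then show False using M(3) by (simp add: frontier_def)
  qed
  have not_none: "\<not> (\<theta> ` P \<inter> M = {} \<and> \<theta> ` N \<inter> M = {})"
  proof
    assume none: "\<theta> ` P \<inter> M = {} \<and> \<theta> ` N \<inter> M = {}"
    have "\<theta> a \<in> M" using M(3) frontier_subset_closed[OF M(1)] by blast
    then have "\<theta> a \<in> closure (interior M)" using M(2) by simp
    moreover have "\<theta> a \<in> \<theta> ` ball a e" using e by simp
    ultimately have "interior M \<inter> \<theta> ` ball a e \<noteq> {}"
      using \<theta>(2) unfolding closure_iff_nhds_not_empty by blast
    then obtain w where w: "w \<in> ball a e" "\<theta> w \<in> interior M" by blast
    have wM: "\<theta> w \<in> M" using w(2) interior_subset by blast
    have "w \<notin> P" "w \<notin> N" using none wM by blast+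
    \<comment> \<open>An interior point of \<open>M\<close> on the zero line would have points of
      \<open>P\<close> arbitrarily near, and these would lie in \<open>M\<close>.\<close>
    then have "w $ i = 0" using w(1) by (auto simp: P_def N_def)
    from near(1)[OF w(1) this open_interior w(2)] show False
      using none interior_subset[of M] by blast
  qed
  from not_both not_none sideP sideN consider
      "\<theta> ` P \<subseteq> M" "\<theta> ` N \<inter> M = {}" | "\<theta> ` N \<subseteq> M" "\<theta> ` P \<inter> M = {}" by blast
  then show ?thesis
  proof cases
    case 1
    have "z \<in> M \<longleftrightarrow> 0 \<le> F z" if z: "z \<in> \<theta> ` ball a e" for z
      using split[OF z] 1 sign[of z] sign'[of z] limit F by fastforce
    then show ?thesis by blast
  next
    case 2
    have "z \<in> M \<longleftrightarrow> F z \<le> 0" if z: "z \<in> \<theta> ` ball a e" for z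
      using split[OF z] 2 sign[of z] sign'[of z] limit F by fastforce
    then show ?thesis by blast
  qed
qed

text \<open>Loops are compared by free homotopy, and a homotopy between the constant loops at
  \<open>x\<close> and \<open>y\<close> moves the base point along a path from \<open>x\<close> to
  \<open>y\<close>.\<close>

lemma simply_connected_imp_connected_topological:
  fixes S :: "'a::topological_space set"
  assumes "simply_connected S"
  shows "connected S"
proof (rule path_connected_imp_connected, unfold path_connected_def, intro ballI)
  fix x y assume xy: "x \<in> S" "y \<in> S"
  have "homotopic_loops S (\<lambda>_. x) (\<lambda>_. y)"
    by (rule assms[unfolded simply_connected_def, rule_format])
      (use xy in \<open>auto simp: path_def pathfinish_def pathstart_def path_image_def\<close>)
  then obtain h where h: "continuous_on ({0..1::real} \<times> {0..1::real}) h" "h \<in> ({0..1} \<times> {0..1}) \<rightarrow> S"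
      "\<forall>t\<in>{0..1}. h (0, t) = x" "\<forall>t\<in>{0..1}. h (1, t) = y"
    unfolding homotopic_loops by blast
  have "path (\<lambda>s. h (s, 0))"
    unfolding path_def by (rule continuous_on_compose2[OF h(1)]) (auto intro!: continuous_intros)
  moreover have "path_image (\<lambda>s. h (s, 0)) \<subseteq> S" using h(2) by (auto simp: path_image_def)
  ultimately show "\<exists>g. path g \<and> path_image g \<subseteq> S \<and> pathstart g = x \<and> pathfinish g = y"
    using h(3,4) by (intro exI[of _ "\<lambda>s. h (s, 0)"]) (auto simp: pathstart_def pathfinish_def)
qed

text \<open>The image of a simple loop is connected and has more than one point, as the parameters 0
  and 1/2 are separated; such a set has no isolated point.\<close>

lemma piecewise_smooth_frontier_islimpt:
  fixes x :: "'m::t2_space"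
  assumes "piecewise_smooth_boundary A M" "x \<in> frontier M"
  shows "x islimpt frontier M"
proof -
  obtain \<gamma> where \<gamma>: "piecewise_smooth_loop A \<gamma>" "x \<in> path_image \<gamma>" "path_image \<gamma> \<subseteq> frontier M"
    using assms unfolding piecewise_smooth_boundary_def by (metis UN_E UN_upper)
  have sp: "simple_path \<gamma>" using \<gamma>(1) by (simp add: piecewise_smooth_loop_def)
  then have conn: "connected (path_image \<gamma>)" by (simp add: simple_path_imp_path connected_path_image)
  have "\<exists>y\<in>path_image \<gamma>. y \<noteq> x"
  proof -
    have "\<gamma> 0 \<noteq> \<gamma> (1/2)"
    proof
      assume "\<gamma> 0 = \<gamma> (1/2)"
      have "\<gamma> s = \<gamma> t \<Longrightarrow> s = t \<or> s = 0 \<and> t = 1 \<or> s = 1 \<and> t = 0"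
        if "s \<in> {0..1}" "t \<in> {0..1}" for s t
        using sp that unfolding simple_path_def loop_free_def by blast
      from this[of 0 "1/2"] show False using \<open>\<gamma> 0 = \<gamma> (1/2)\<close> by simp
    qed
    moreover have "\<gamma> 0 \<in> path_image \<gamma>" "\<gamma> (1/2) \<in> path_image \<gamma>" by (auto simp: path_image_def)
    ultimately show ?thesis by metis
  qed
  then obtain z where z: "z \<in> path_image \<gamma>" "z \<noteq> x" by blast
  show ?thesis unfolding islimpt_def
  proof (intro allI impI)
    fix T assume T: "x \<in> T" "open T"
    show "\<exists>y\<in>frontier M. y \<in> T \<and> y \<noteq> x"
    proof (rule ccontr)
      assume "\<not> ?thesis"
      then have "T \<inter> - {x} \<inter> path_image \<gamma> = {}" "path_image \<gamma> \<subseteq> T \<union> - {x}" using \<gamma>(3) T by blast+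
      then have "T \<inter> path_image \<gamma> = {} \<or> - {x} \<inter> path_image \<gamma> = {}"
        by (intro connectedD[OF conn T(2)]) (auto simp: open_Compl)
      then show False using T \<gamma>(2) z by blast
    qed
  qed
qed

context morse_gradient begin

text \<open>The i-th chart coordinate, in whose direction \<open>F\<close> has nonzero derivative,
  is replaced by \<open>F\<close>. The new coordinates are injective on a ball by the mean value
  theorem, and invariance of domain makes them a homeomorphism onto an open set.\<close>

lemma one_sided:
  assumes M: "closed M" "M = closure (interior M)" "M \<subseteq> U" and zero: "\<And>x. x \<in> frontier M \<Longrightarrow> F x = 0"
    and x: "x \<in> frontier M" "x \<notin> crit"
  shows "\<exists>Q. open Q \<and> x \<in> Q \<and> ((\<forall>z\<in>Q. z \<in> M \<longleftrightarrow> 0 \<le> F z) \<or> (\<forall>z\<in>Q. z \<in> M \<longleftrightarrow> F z \<le> 0))"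
proof -
  have xU: "x \<in> U" using x M frontier_subset_closed by blast
  obtain c where c: "c \<in> A" "x \<in> fst c" "dF c (snd c x) \<noteq> 0" using noncritical_chart[OF xU x(2)] by blast
  let ?u = "snd c x" and ?h = "F \<circ> chart_inv c" and ?S = "snd c ` (fst c \<inter> U)"
  obtain i where i: "partial_deriv i ?h ?u \<noteq> 0" using c(3) by (auto simp: dF_def vec_eq_iff)
  have S: "open ?S" "?u \<in> ?S" using image_open[OF c(1)] c xU by auto
  have sm: "smooth_on ?S (partial_deriv i ?h)" by (rule smooth_on_partial_deriv[OF smooth_chart[OF c(1)]])
  have cont: "continuous_on ?S (partial_deriv i ?h)"
    using sm unfolding smooth_on_def by (metis Ck_on.simps(1))
  have "open (?S \<inter> partial_deriv i ?h -` (- {0}))"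
    by (rule continuous_open_preimage[OF cont S(1)]) (simp add: open_Compl)
  then obtain r where r: "0 < r" "ball ?u r \<subseteq> ?S \<inter> partial_deriv i ?h -` (- {0})"
    using S(2) i unfolding open_contains_ball by blast
  define \<psi> :: "real^2 \<Rightarrow> real^2" where "\<psi> u = (\<chi> j. if j = i then ?h u else u $ j)" for u
  have dh: "(?h has_derivative (\<lambda>w. dF c v \<bullet> w)) (at v)" if "v \<in> ball ?u r" for v
    using F_has_derivative[OF c(1)] that r(2) by fastforce
  have cont_h: "continuous_on (ball ?u r) ?h"
    using has_derivative_continuous[OF dh] by (intro continuous_at_imp_continuous_on) blast
  have cont_\<psi>: "continuous_on (ball ?u r) \<psi>"
    unfolding \<psi>_def
  proof (rule continuous_on_vec_lambda)
    show "continuous_on (ball ?u r) (\<lambda>u. if j = i then ?h u else u $ j)" for j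
      using cont_h by (cases "j = i") (auto intro: continuous_intros)
  qed
  have inj: "inj_on \<psi> (ball ?u r)"
  proof (rule inj_onI, rule ccontr)
    fix u v assume uv: "u \<in> ball ?u r" "v \<in> ball ?u r" "\<psi> u = \<psi> v" "u \<noteq> v"
    have h: "?h u = ?h v" and j: "\<And>j. j \<noteq> i \<Longrightarrow> u $ j = v $ j"
      using uv(3) by (auto simp: \<psi>_def vec_eq_iff split: if_splits)
    have seg: "closed_segment u v \<subseteq> ball ?u r" by (rule closed_segment_subset[OF uv(1,2) convex_ball])
    \<comment> \<open>\<open>u\<close> and \<open>v\<close> have the same value of \<open>F\<close>
      and differ in the i-th coordinate alone, so the mean value theorem produces a zero of the i-th
      partial derivative on their segment; the ball contains none.\<close>
    obtain w where w: "w \<in> closed_segment u v" "?h v - ?h u = dF c w \<bullet> (v - u)"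
    proof -
      let ?l = "\<lambda>t::real. u + t *\<^sub>R (v - u)"
      have l: "?l t \<in> closed_segment u v" if "t \<in> {0..1}" for t
        using that unfolding closed_segment_def by (auto simp: algebra_simps intro!: exI[of _ t])
      have "\<exists>t\<in>{0..1}. ?h (?l 1) - ?h (?l 0) = dF c (?l t) \<bullet> ((1 - 0) *\<^sub>R (v - u))"
      proof (rule mvt_very_simple)
        fix t :: real assume "0 \<le> t" "t \<le> 1"
        then have "?l t \<in> ball ?u r" using l[of t] seg by (meson atLeastAtMost_iff subsetD)
        moreover have "(?l has_derivative (\<lambda>s. s *\<^sub>R (v - u))) (at t within {0..1})"
          by (auto intro!: derivative_eq_intros)
        ultimately show "((\<lambda>t. ?h (?l t)) has_derivative (\<lambda>s. dF c (?l t) \<bullet> (s *\<^sub>R (v - u)))) (at t within {0..1})"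
          using has_derivative_compose[OF _ dh] by blast
      qed simp
      then obtain t where t: "t \<in> {0..1}" "?h v - ?h u = dF c (?l t) \<bullet> (v - u)" by auto
      show ?thesis by (rule that[OF l[OF t(1)] t(2)])
    qed
    have "v - u = (v $ i - u $ i) *\<^sub>R axis i 1"
      using j by (auto simp: vec_eq_iff axis_def)
    then have "dF c w \<bullet> (v - u) = dF c w \<bullet> ((v $ i - u $ i) *\<^sub>R axis i 1)" by (rule arg_cong)
    then have "dF c w \<bullet> (v - u) = (v $ i - u $ i) * partial_deriv i ?h w"
      by (simp add: dF_def inner_axis)
    moreover have "partial_deriv i ?h w \<noteq> 0" using w(1) seg r(2) by blast
    ultimately have "v $ i = u $ i" using w(2) h by simp
    then have "u = v" using j by (metis vec_eq_iff)
    then show False using uv(4) by blast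
  qed
  obtain \<kappa> where hom: "homeomorphism (ball ?u r) (\<psi> ` ball ?u r) \<psi> \<kappa>"
    using invariance_of_domain_homeomorphism[OF open_ball cont_\<psi> _ inj] by blast
  have "open (\<psi> ` ball ?u r)" by (rule invariance_of_domain[OF cont_\<psi> open_ball inj])
  then obtain e where e: "0 < e" "ball (\<psi> ?u) e \<subseteq> \<psi> ` ball ?u r"
    using r(1) unfolding open_contains_ball by (meson centre_in_ball imageI)
  define \<theta> where "\<theta> = chart_inv c \<circ> \<kappa>"
  have \<kappa>: "\<kappa> w \<in> ball ?u r" "\<psi> (\<kappa> w) = w" if "w \<in> ball (\<psi> ?u) e" for w
    using hom that e(2) unfolding homeomorphism_def by auto
  \<comment> \<open>Written as a preimage under continuous maps, the coordinate neighbourhood is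
    open.\<close>
  have Q: "\<theta> ` ball (\<psi> ?u) e = fst c \<inter> snd c -` (ball ?u r \<inter> \<psi> -` ball (\<psi> ?u) e)"
  proof (intro equalityI subsetI)
    fix z assume "z \<in> \<theta> ` ball (\<psi> ?u) e"
    then obtain w where w: "w \<in> ball (\<psi> ?u) e" "z = chart_inv c (\<kappa> w)" by (auto simp: \<theta>_def)
    obtain y where y: "y \<in> fst c" "\<kappa> w = snd c y" using \<kappa>(1)[OF w(1)] r(2) by auto
    then have "z = y" using w(2) inv[OF c(1)] by simp
    then show "z \<in> fst c \<inter> snd c -` (ball ?u r \<inter> \<psi> -` ball (\<psi> ?u) e)"
      using y \<kappa>[OF w(1)] w(1) by auto
  next
    fix z assume z: "z \<in> fst c \<inter> snd c -` (ball ?u r \<inter> \<psi> -` ball (\<psi> ?u) e)"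
    then have "\<kappa> (\<psi> (snd c z)) = snd c z" using hom by (auto simp: homeomorphism_def)
    then have "\<theta> (\<psi> (snd c z)) = z" using inv[OF c(1)] z by (simp add: \<theta>_def)
    then show "z \<in> \<theta> ` ball (\<psi> ?u) e" using z by (metis IntD2 image_eqI vimageD)
  qed
  have \<theta>_u: "\<theta> (\<psi> ?u) = x"
    using hom inv[OF c(1,2)] r(1) by (simp add: \<theta>_def homeomorphism_def)
  have "open (fst c \<inter> snd c -` (ball ?u r \<inter> \<psi> -` ball (\<psi> ?u) e))"
    by (intro continuous_open_preimage chart_continuous[OF atlas c(1)] chart_open[OF atlas c(1)] cont_\<psi> open_ball)
  then have open_Q: "open (\<theta> ` ball (\<psi> ?u) e)" by (simp add: Q)
  have "(\<forall>z\<in>\<theta> ` ball (\<psi> ?u) e. z \<in> M \<longleftrightarrow> 0 \<le> F z) \<or> (\<forall>z\<in>\<theta> ` ball (\<psi> ?u) e. z \<in> M \<longleftrightarrow> F z \<le> 0)"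
  proof (rule one_sided_coordinate[OF _ open_Q e(1) _ _ M(1,2)])
    have "continuous_on (\<psi> ` ball ?u r) \<kappa>" using hom by (simp add: homeomorphism_def)
    then have "continuous_on (ball (\<psi> ?u) e) \<kappa>" by (rule continuous_on_subset[OF _ e(2)])
    moreover have "\<kappa> ` ball (\<psi> ?u) e \<subseteq> snd c ` fst c" using \<kappa>(1) r(2) by blast
    ultimately show "continuous_on (ball (\<psi> ?u) e) \<theta>"
      unfolding \<theta>_def using continuous_on_subset[OF chart_inv_continuous[OF atlas c(1)]]
      by (intro continuous_on_compose) auto
    show "\<psi> ?u $ i = 0" using zero[OF x(1)] inv[OF c(1,2)] by (simp add: \<psi>_def)
    show "F (\<theta> w) = w $ i" if "w \<in> ball (\<psi> ?u) e" for w
    proof -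
      have "w $ i = \<psi> (\<kappa> w) $ i" using \<kappa>(2)[OF that] by simp
      then show ?thesis by (simp add: \<psi>_def \<theta>_def)
    qed
    show "\<theta> (\<psi> ?u) \<in> frontier M" using \<theta>_u x by simp
  qed (rule zero)
  then show ?thesis using open_Q \<theta>_u e(1) by (metis centre_in_ball image_eqI)
qed

text \<open>Round discs in a chart have these properties; in the plane they remain connected without
  their centre.\<close>

lemma nbhd_base:
  fixes x :: 'm
  assumes B: "open B" "x \<in> B"
  shows "\<exists>W. open W \<and> x \<in> W \<and> compact (closure W) \<and> closure W \<subseteq> B \<and> connected (W - {x})"
proof -
  obtain c where c: "c \<in> A" "x \<in> fst c" by (rule chart_at)
  have "open (snd c ` (fst c \<inter> B))" by (rule chart_image_open[OF atlas c(1) B(1)])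
  then obtain r where r: "0 < r" "cball (snd c x) r \<subseteq> snd c ` (fst c \<inter> B)"
    using c B unfolding open_contains_cball by blast
  define W where "W = fst c \<inter> snd c -` ball (snd c x) r"
  have cinv: "continuous_on (cball (snd c x) r) (chart_inv c)"
    by (rule continuous_on_subset[OF chart_inv_continuous[OF atlas c(1)]]) (use r in auto)
  have "compact (chart_inv c ` cball (snd c x) r)" by (intro compact_continuous_image cinv compact_cball)
  moreover have sub: "W \<subseteq> chart_inv c ` cball (snd c x) r"
  proof
    fix z assume "z \<in> W"
    then show "z \<in> chart_inv c ` cball (snd c x) r"
      using inv[OF c(1), of z] by (intro image_eqI[of _ _ "snd c z"]) (auto simp: W_def)
  qed
  ultimately have cl: "closure W \<subseteq> chart_inv c ` cball (snd c x) r" "compact (closure W)"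
    using closure_minimal compact_imp_closed compact_Int_closed[OF _ closed_closure]
    by (metis, metis inf.absorb_iff2)
  have "chart_inv c ` cball (snd c x) r \<subseteq> B" using r(2) inv[OF c(1)] by auto
  moreover have "W - {x} = chart_inv c ` (ball (snd c x) r - {snd c x})"
  proof (intro equalityI subsetI)
    fix z assume z: "z \<in> W - {x}"
    then have "snd c z \<noteq> snd c x" using inj_onD[OF chart_inj[OF atlas c(1)]] c by (auto simp: W_def)
    then show "z \<in> chart_inv c ` (ball (snd c x) r - {snd c x})"
      using z inv[OF c(1)] by (intro image_eqI[of _ _ "snd c z"]) (auto simp: W_def)
  next
    fix z assume "z \<in> chart_inv c ` (ball (snd c x) r - {snd c x})"
    then obtain u where u: "u \<in> ball (snd c x) r" "u \<noteq> snd c x" "z = chart_inv c u" by blast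
    have "u \<in> snd c ` (fst c \<inter> B)" using u(1) r(2) ball_subset_cball by blast
    then obtain y where "y \<in> fst c" "u = snd c y" by blast
    then show "z \<in> W - {x}" using u inv[OF c(1)] by (auto simp: W_def)
  qed
  moreover have "connected (chart_inv c ` (ball (snd c x) r - {snd c x}))"
  proof (rule connected_continuous_image)
    show "continuous_on (ball (snd c x) r - {snd c x}) (chart_inv c)"
      by (rule continuous_on_subset[OF cinv]) auto
    show "connected (ball (snd c x) r - {snd c x})" by (rule connected_punctured_ball) simp
  qed
  moreover have "open W" unfolding W_def
    by (rule continuous_open_preimage[OF chart_continuous[OF atlas c(1)] chart_open[OF atlas c(1)] open_ball])
  moreover have "x \<in> W" using c r(1) by (simp add: W_def)
  ultimately show ?thesis using cl by (intro exI[of _ W]) auto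
qed

end


section \<open>The stopped gradient flow\<close>

text \<open>\<open>morse_on\<close> speaks of some extension \<open>G\<close>; on an open set the
  derivatives of \<open>G\<close> and \<open>F\<close> coincide.\<close>

lemma morse_on_open:
  assumes A: "smooth_atlas A" and U: "open U" and F: "morse_on A U F"
  shows "smooth_function A U F"
    and "x \<in> U \<Longrightarrow> critical_point A F x \<Longrightarrow> nondegenerate_at A F x"
proof -
  obtain V G where V: "U \<subseteq> V" and G: "smooth_function A V G" and eq: "\<And>x. x \<in> U \<Longrightarrow> G x = F x"
    and nd: "\<And>x. x \<in> U \<Longrightarrow> critical_point A G x \<Longrightarrow> nondegenerate_at A G x"
    using F unfolding morse_on_def by metis
  have S: "open (snd c ` (fst c \<inter> U))" if "c \<in> A" for c by (rule chart_image_open[OF A that U])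
  have loc: "(G \<circ> chart_inv c) u = (F \<circ> chart_inv c) u" if "c \<in> A" "u \<in> snd c ` (fst c \<inter> U)" for c u
    using that eq chart_inv_chart[OF A that(1)] by auto
  show "smooth_function A U F"
    unfolding smooth_function_def
  proof
    fix c assume c: "c \<in> A"
    have "smooth_on (snd c ` (fst c \<inter> U)) (G \<circ> chart_inv c)"
      by (rule smooth_on_subset[of "snd c ` (fst c \<inter> V)"]) (use G c V in \<open>auto simp: smooth_function_def\<close>)
    then show "smooth_on (snd c ` (fst c \<inter> U)) (F \<circ> chart_inv c)"
      by (rule smooth_on_cong[OF S[OF c]]) (rule loc[OF c])
  qed
  assume x: "x \<in> U" "critical_point A F x"
  have mem: "snd c x \<in> snd c ` (fst c \<inter> U)" if "x \<in> fst c" for c using x that by auto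
  have first: "partial_deriv i (G \<circ> chart_inv c) u = partial_deriv i (F \<circ> chart_inv c) u"
    if "c \<in> A" "u \<in> snd c ` (fst c \<inter> U)" for c u i
    by (rule partial_deriv_cong[OF S[OF that(1)] that(2) loc[OF that(1)]])
  have "hessian c G x = hessian c F x" if c: "c \<in> A" "x \<in> fst c" for c
    using partial_deriv_cong[OF S[OF c(1)] mem[OF c(2)] first[OF c(1)]] by (simp add: hessian_def)
  moreover have "critical_point A G x"
    using x(2) first mem unfolding critical_point_def by metis
  ultimately show "nondegenerate_at A F x"
    using nd[OF x(1)] by (simp add: nondegenerate_at_def)
qed

lemma neg_gradient_curve_eq:
  "neg_gradient_curve A g U F I \<gamma> \<longleftrightarrow> integral_curve A U (neg_gradient g F) I \<gamma>"
  by (simp add: neg_gradient_curve_def integral_curve_def)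

lemma neg_gradient_curve_forward:
  assumes "0 \<le> t"
  shows "(\<exists>\<gamma>. neg_gradient_curve A g U F (closed_segment 0 t) \<gamma> \<and> \<gamma> 0 = x \<and> \<gamma> t = y) \<longleftrightarrow>
    reaches A U (neg_gradient g F) t x y"
  using assms by (simp add: neg_gradient_curve_eq reaches_def closed_segment_eq_real_ivl)

lemma neg_gradient_curve_backward:
  assumes t: "0 \<le> t"
  shows "(\<exists>\<gamma>. neg_gradient_curve A g U F (closed_segment 0 (- t)) \<gamma> \<and> \<gamma> 0 = x \<and> \<gamma> (- t) = y) \<longleftrightarrow>
    reaches A U (neg_gradient g F) t y x"
proof -
  have seg: "closed_segment 0 (- t) = {- t..0}"
    using t by (cases "t = 0") (auto simp: closed_segment_eq_real_ivl)
  show ?thesis unfolding seg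
  proof
    assume "\<exists>\<gamma>. neg_gradient_curve A g U F {- t..0} \<gamma> \<and> \<gamma> 0 = x \<and> \<gamma> (- t) = y"
    then obtain \<gamma> where "integral_curve A U (neg_gradient g F) {- t..0} \<gamma>" "\<gamma> 0 = x" "\<gamma> (- t) = y"
      by (auto simp: neg_gradient_curve_eq)
    then show "reaches A U (neg_gradient g F) t y x"
      unfolding reaches_def using assms
      by (intro conjI exI[of _ "\<lambda>s. \<gamma> (s + - t)"] integral_curve_shift) auto
  next
    assume "reaches A U (neg_gradient g F) t y x"
    then obtain \<gamma> where "integral_curve A U (neg_gradient g F) {0..t} \<gamma>" "\<gamma> 0 = y" "\<gamma> t = x"
      by (auto simp: reaches_def)
    moreover from this have "integral_curve A U (neg_gradient g F) {- t..0} (\<lambda>s. \<gamma> (s + t))"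
      by (intro integral_curve_shift) auto
    ultimately show "\<exists>\<gamma>. neg_gradient_curve A g U F {- t..0} \<gamma> \<and> \<gamma> 0 = x \<and> \<gamma> (- t) = y"
      by (intro exI[of _ "\<lambda>s. \<gamma> (s + t)"]) (auto simp: neg_gradient_curve_eq)
  qed
qed

text \<open>By \<open>reaches_reverse\<close>, each reversed axiom is the forward property of the
  field with the opposite sign.\<close>

lemma (in morse_gradient) gradient_semiflow:
  assumes M: "compact M" "connected M" "M \<subseteq> U" "piecewise_smooth_boundary A M"
    and zero: "\<And>x. x \<in> frontier M \<Longrightarrow> F x = 0"
  shows "gradient_semiflow U M F (reaches A U (neg_gradient g F)) crit"
proof -
  interpret X: chart_field A U "neg_gradient g F" by (rule neg_gradient_chart_field)
  interpret Y: chart_field A U "\<lambda>c x. - neg_gradient g F c x" by (rule X.reverse_chart_field)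
  let ?R = "reaches A U (neg_gradient g F)"
  note rev = reaches_reverse[of A U "neg_gradient g F", symmetric]
  have Mc: "closed M" by (rule compact_imp_closed[OF M(1)])
  have Mi: "M = closure (interior M)" using M(4) by (simp add: piecewise_smooth_boundary_def)
  show ?thesis
  proof
    show "\<exists>W \<tau>. open W \<and> x \<in> W \<and> 0 < \<tau> \<and> (\<forall>y\<in>W. \<forall>t\<in>{0..\<tau>}. \<exists>z\<in>B. ?R t z y)"
      if "x \<in> U" "open B" "x \<in> B" for x B
      unfolding rev by (rule Y.reaches_local[OF that])
    show "\<exists>W \<tau>. open W \<and> x \<in> W \<and> 0 < \<tau> \<and>
      (\<forall>t\<in>{0..\<tau>}. \<forall>y\<in>W. \<forall>z B. ?R t z y \<and> open B \<and> z \<in> B \<longrightarrow>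
         (\<exists>W'. open W' \<and> y \<in> W' \<and> (\<forall>y'\<in>W'. \<exists>z'\<in>B. ?R t z' y')))"
      if "x \<in> U" for x
      unfolding rev by (rule Y.reaches_cont[OF that])
    show "x = y" if "?R t x z" "?R t y z" for t x y z
      using that unfolding rev by (rule Y.reaches_det)
    show "crit \<subseteq> U" by (auto simp: crit_def)
  qed (rule M open_U continuous_F reaches_0 reaches_trans reaches_split X.reaches_local X.reaches_cont
      X.reaches_det crit_reaches reaches_dom F_less crit_isolated nbhd_base zero
      piecewise_smooth_frontier_islimpt[OF M(4)] one_sided[OF Mc Mi M(3) zero]
      local_extremum_crit[OF _ disjI1] local_extremum_crit[OF _ disjI2]; assumption)+
qed

section \<open>Identification with the flow and the sets of the statement\<close>

locale stopped_gradient_flow = gradient_flow U M F R crit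
  for U M :: "'m::t2_space set" and F and R :: "real \<Rightarrow> 'm \<Rightarrow> 'm \<Rightarrow> bool" and crit +
  fixes A :: "'m chart set" and g
  assumes R_eq: "R = reaches A U (neg_gradient g F)"
    and crit_critical: "crit = {x\<in>U. critical_point A F x}"
begin

lemma flow_forward: "0 \<le> t \<Longrightarrow> flow A g U F t x = fl t x"
  by (simp only: flow_def fl_def neg_gradient_curve_forward R_eq[symmetric])

lemma flow_backward: "0 \<le> t \<Longrightarrow> flow A g U F (- t) x = rev.fl t x"
  by (simp only: flow_def rev.fl_def neg_gradient_curve_backward R_eq[symmetric])

lemma flow_defined_forward: "0 \<le> t \<Longrightarrow> flow_defined A g U F t x \<longleftrightarrow> (\<exists>y. R t x y)"
  unfolding flow_defined_def R_eq neg_gradient_curve_forward[symmetric] by blast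

lemma flow_defined_backward: "0 \<le> t \<Longrightarrow> flow_defined A g U F (- t) x \<longleftrightarrow> (\<exists>y. R t y x)"
  unfolding flow_defined_def R_eq neg_gradient_curve_backward[symmetric] by blast

lemma flow_in_forward: "0 \<le> t \<Longrightarrow> flow_in A g U F S t x \<longleftrightarrow> (\<exists>z\<in>S. R t x z)"
  unfolding flow_in_def using flow_defined_forward[of t x] flow_forward[of t x] fl_eq R_fl by metis

lemma flow_in_backward: "0 \<le> t \<Longrightarrow> flow_in A g U F S (- t) x \<longleftrightarrow> (\<exists>z\<in>S. R t z x)"
  unfolding flow_in_def using flow_defined_backward[of t x] flow_backward[of t x] rev.fl_eq rev.R_fl by metis

text \<open>\<open>LEAST\<close> over real times is meaningful when the minimum is attained: the
  exit time hits the frontier, and no hitting time precedes it.\<close>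

lemma stopped_flow_forward:
  assumes x: "x \<in> M" and t: "0 \<le> t"
  shows "stopped_flow A g M U F t x = sflow t x"
proof -
  have "(\<forall>s\<in>{0..t}. flow_in A g U F M s x) \<longleftrightarrow> in_upto x t"
    by (simp add: in_upto_def flow_in_forward)
  then have eq: "stopped_flow A g M U F t x = (if in_upto x t then fl t x
      else flow A g U F (LEAST s. s \<in> {0..t} \<and> flow_in A g U F (frontier M) s x) x)"
    using t by (simp add: stopped_flow_def flow_forward)
  show ?thesis
  proof (cases "in_upto x t")
    case True
    then show ?thesis by (simp add: eq sflow_def)
  next
    case False
    then have "\<not> stays x" using t by (auto simp: stays_def)
    then obtain s y where e: "exits x s y" using stays_or_exits[OF x] by blast
    have st: "s < t" using e False in_upto_mono unfolding exits_def by (meson not_le)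
    have R: "R s x y" "y \<in> frontier M" using e by (auto simp: exits_def)
    have "(LEAST s. s \<in> {0..t} \<and> flow_in A g U F (frontier M) s x) = s"
      by (rule Least_equality)
        (use R R_dom[OF R(1)] st exits_first[OF e] in \<open>auto simp: flow_in_forward\<close>)
    then show ?thesis
      using eq False exits_sflow[OF e st] fl_eq[OF R(1)] flow_forward[of s x] R_dom[OF R(1)] by simp
  qed
qed

text \<open>Time 0 is excluded because \<open>stopped_flow\<close> treats it in the branch for
  nonnegative times; the limit at minus infinity does not see it. The sign change turns the least
  backward exit time into the \<open>GREATEST\<close> hitting time.\<close>

lemma stopped_flow_backward:
  assumes x: "x \<in> M" and t: "0 < t"
  shows "stopped_flow A g M U F (- t) x = rev.sflow t x"
proof -
  have "(\<forall>s\<in>{- t..0}. flow_in A g U F M s x) \<longleftrightarrow> rev.in_upto x t"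
  proof
    assume *: "\<forall>s\<in>{- t..0}. flow_in A g U F M s x"
    show "rev.in_upto x t" unfolding rev.in_upto_def
    proof
      fix s assume s: "s \<in> {0..t}"
      then have "flow_in A g U F M (- s) x" using * by simp
      then show "\<exists>z\<in>M. R s z x" using flow_in_backward[of s M x] s by simp
    qed
  next
    assume *: "rev.in_upto x t"
    show "\<forall>s\<in>{- t..0}. flow_in A g U F M s x"
    proof
      fix s assume s: "s \<in> {- t..0}"
      then have "\<exists>z\<in>M. R (- s) z x" using * by (simp add: rev.in_upto_def)
      then show "flow_in A g U F M s x" using flow_in_backward[of "- s" M x] s by simp
    qed
  qed
  then have eq: "stopped_flow A g M U F (- t) x = (if rev.in_upto x t then rev.fl t x
      else flow A g U F (GREATEST s. s \<in> {- t..0} \<and> flow_in A g U F (frontier M) s x) x)"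
    using t by (simp add: stopped_flow_def flow_backward)
  show ?thesis
  proof (cases "rev.in_upto x t")
    case True
    then show ?thesis by (simp add: eq rev.sflow_def)
  next
    case False
    then have "\<not> rev.stays x" using t less_imp_le unfolding rev.stays_def by blast
    then obtain s y where e: "rev.exits x s y" using rev.stays_or_exits[OF x] by blast
    have st: "s < t" using e False rev.in_upto_mono unfolding rev.exits_def by (meson not_le)
    have R: "R s y x" "y \<in> frontier M" using e by (auto simp: rev.exits_def)
    have s: "0 \<le> s" using R_dom[OF R(1)] by simp
    have "(GREATEST r. r \<in> {- t..0} \<and> flow_in A g U F (frontier M) r x) = - s"
    proof (rule Greatest_equality)
      show "- s \<in> {- t..0} \<and> flow_in A g U F (frontier M) (- s) x"
        using R s st flow_in_backward[OF s] by auto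
      fix r assume r: "r \<in> {- t..0} \<and> flow_in A g U F (frontier M) r x"
      then obtain z where "z \<in> frontier M" "R (- r) z x"
        using flow_in_backward[of "- r" "frontier M" x] by auto
      then show "r \<le> - s" using rev.exits_first[OF e] by force
    qed
    then show ?thesis
      using eq False rev.exits_sflow[OF e st] rev.fl_eq[OF R(1)] flow_backward[OF s] by simp
  qed
qed

lemma stable_set_eq: "stable_set A g M U F y = Ws y"
proof -
  have "((\<lambda>t. stopped_flow A g M U F t x) \<longlongrightarrow> y) at_top \<longleftrightarrow> converges x y" if "x \<in> M" for x
    by (rule tendsto_cong, rule eventually_mono[OF eventually_ge_at_top[of 0]])
      (rule stopped_flow_forward[OF that])
  then show ?thesis unfolding stable_set_def Ws_def by blast
qed

lemma unstable_set_eq: "unstable_set A g M U F y = rev.Ws y"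
proof -
  have "((\<lambda>t. stopped_flow A g M U F t x) \<longlongrightarrow> y) at_bot \<longleftrightarrow> rev.converges x y" if "x \<in> M" for x
    unfolding filterlim_at_bot_mirror
    by (rule tendsto_cong, rule eventually_mono[OF eventually_gt_at_top[of 0]])
      (rule stopped_flow_backward[OF that])
  then show ?thesis unfolding unstable_set_def rev.Ws_def by blast
qed

lemma saddles_eq: "saddles A M F = saddle"
  using M_sub unfolding saddles_def saddle_def unfolding crit_critical by blast

lemma neumann_line_set_eq: "neumann_line_set A g M U F = lines"
  by (simp add: neumann_line_set_def lines_def saddles_eq stable_set_eq unstable_set_eq)

lemma Omega_eq: "Omega A g M U F p q = Ws p \<inter> rev.Ws q"
  "Omega_min A g M U F = (\<lambda>p. Ws p \<inter> (\<Union>y\<in>frontier M - saddle. rev.Ws y))"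
  "Omega_max A g M U F = (\<lambda>q. (\<Union>y\<in>frontier M - saddle. Ws y) \<inter> rev.Ws q)"
  by (simp_all add: fun_eq_iff Omega_def Omega_min_def Omega_max_def saddles_eq stable_set_eq unstable_set_eq)

end

theorem proposition3p12:
  fixes A :: "'m::t2_space chart set"
    and g :: "'m chart \<Rightarrow> 'm \<Rightarrow> real^2^2"
    and M U :: "'m set"
    and f F :: "'m \<Rightarrow> real"
  assumes "closed_smooth_surface A"
    and "riemannian_metric A g"
    and "compact M"
    and "simply_connected M"
    and "piecewise_smooth_boundary A M"
    and "nonzero_angles A g M"
    and "morse_eigenfunction A g M f"
    and "extension_property A M f"
    and "\<forall>x\<in>frontier M. f x = 0"
    and "morse_extension A M f U F"
    and "neumann_line_set A g M U F \<noteq> {}"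
  shows
    "M = (\<Union>(p, q)\<in>minima M F \<times> maxima M F. Omega A g M U F p q)
         \<union> (\<Union>p\<in>minima M F. Omega_min A g M U F p)
         \<union> (\<Union>q\<in>maxima M F. Omega_max A g M U F q)
         \<union> neumann_line_set A g M U F
     \<and> disjoint_family_on (\<lambda>(p, q). Omega A g M U F p q) (minima M F \<times> maxima M F)
     \<and> disjoint_family_on (Omega_min A g M U F) (minima M F)
     \<and> disjoint_family_on (Omega_max A g M U F) (maxima M F)
     \<and> (\<Union>(p, q)\<in>minima M F \<times> maxima M F. Omega A g M U F p q)
         \<inter> (\<Union>p\<in>minima M F. Omega_min A g M U F p) = {}
     \<and> (\<Union>(p, q)\<in>minima M F \<times> maxima M F. Omega A g M U F p q)
         \<inter> (\<Union>q\<in>maxima M F. Omega_max A g M U F q) = {}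
     \<and> (\<Union>p\<in>minima M F. Omega_min A g M U F p)
         \<inter> (\<Union>q\<in>maxima M F. Omega_max A g M U F q) = {}
     \<and> ((\<Union>(p, q)\<in>minima M F \<times> maxima M F. Omega A g M U F p q)
         \<union> (\<Union>p\<in>minima M F. Omega_min A g M U F p)
         \<union> (\<Union>q\<in>maxima M F. Omega_max A g M U F q))
         \<inter> neumann_line_set A g M U F = {}"
proof -
  have atlas: "smooth_atlas A" using assms(1) by (simp add: closed_smooth_surface_def)
  have U: "open U" "M \<subseteq> U" "morse_on A U F" "\<And>x. x \<in> M \<Longrightarrow> F x = f x"
    using assms(10) by (auto simp: morse_extension_def)
  interpret m: morse_gradient A g U F
    by unfold_locales (fact atlas assms(2) U(1) morse_on_open[OF atlas U(1,3)])+
  \<comment> \<open>\<open>F\<close> agrees with \<open>f\<close> on \<open>M\<close>, which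
    contains its frontier, so \<open>F\<close> inherits the Dirichlet condition.\<close>
  have "frontier M \<subseteq> M" by (rule frontier_subset_closed[OF compact_imp_closed[OF assms(3)]])
  then have zero: "F x = 0" if "x \<in> frontier M" for x using U(4) assms(9) that by auto
  interpret s: gradient_semiflow U M F "reaches A U (neg_gradient g F)" m.crit
    by (rule m.gradient_semiflow[OF assms(3) simply_connected_imp_connected_topological[OF assms(4)] U(2) assms(5) zero])
  interpret d: gradient_flow U M F "reaches A U (neg_gradient g F)" m.crit
    by (rule s.gradient_flow)
  interpret stopped_gradient_flow U M F "reaches A U (neg_gradient g F)" m.crit A g
    by unfold_locales (simp_all add: m.crit_def)
  show ?thesis
    using d.decomposition[OF assms(11)[unfolded neumann_line_set_eq]] unfolding neumann_line_set_eq Omega_eq .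
qed

end
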